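(* Let $A,B\in M_n$ be two positive semi-definite matrices. Then, for all $1\le p\le 2$, all $r,s\in\mathbb{R}$ with similar signs (i.e. $rs>0$), and all $t\in\mathbb{R}$ such that $$\frac{rp-r}{(r+s)p}\le t\le \frac{rp+s}{(r+s)p},$$ we have $$\lambda\big((A\sharp_{r,t}B)^p\,(A\sharp_{s,1-t}B)^p\big)\prec_{\log}\lambda\big(A^{r+s-1}B\big)^p .$$
   Context: $M_n$ is the space of $n\times n$ complex matrices. For a matrix $X\in M_n$ with real eigenvalues, $\lambda(X)=(\lambda_1(X),\dots,\lambda_n(X))^t$ is the vector of eigenvalues (with multiplicity) in decreasing order $\lambda_1(X)\ge\dots\ge\lambda_n(X)$; products of two positive semi-definite matrices have real nonnegative eigenvalues. For a vector $v$ with nonnegative entries, $v^p$ is the entrywise power. For vectors $x,y\in\mathbb{R}^n$ with nonnegative entries in decreasing order, $x\prec_{\log}y$ (log-majorization) means $\prod_{i=1}^k x_i\le\prod_{i=1}^k y_i$ for $k=1,\dots,n-1$ and $\prod_{i=1}^n x_i=\prod_{i=1}^n y_i$. For real $r$ and $t$, $$A\sharp_{r,t}B=A^{\frac r2}\big(A^{-\frac12}BA^{-\frac12}\big)^{t}A^{\frac r2},$$ and correspondingly $A\sharp_{s,1-t}B=A^{\frac s2}(A^{-\frac12}BA^{-\frac12})^{1-t}A^{\frac s2}$. These formulas apply directly when $A$ and $B$ are positive definite; for general positive semi-definite $A,B$ the expressions $A\sharp_{r,t}B$, $A\sharp_{s,1-t}B$ and $A^{r+s-1}B$ are understood by continuity,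 that is, as limits as $\epsilon\to0^+$ of the same expressions with $A,B$ replaced by $A+\epsilon I_n,\,B+\epsilon I_n$ (where these limits exist), $I_n$ being the identity matrix. *)

theory Defs
  imports
    Complex_Main
    "Jordan_Normal_Form.Char_Poly"
    "Jordan_Normal_Form.Schur_Decomposition"
begin

definition pos_semidef :: "nat \<Rightarrow> complex mat \<Rightarrow> bool" where
  "pos_semidef n A \<longleftrightarrow> A \<in> carrier_mat n n \<and> mat_adjoint A = A \<and>
     (\<forall>v \<in> carrier_vec n. 0 \<le> Re ((A *\<^sub>v v) \<bullet>c v))"

definition pos_def :: "nat \<Rightarrow> complex mat \<Rightarrow> bool" where
  "pos_def n A \<longleftrightarrow> A \<in> carrier_mat n n \<and> mat_adjoint A = A \<and>
     (\<forall>v \<in> carrier_vec n. v \<noteq> 0\<^sub>v n \<longrightarrow> 0 < Re ((A *\<^sub>v v) \<bullet>c v))"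

text \<open>Functional calculus for \<^term>\<open>\<lambda>c. c powr x\<close>:
  if \<open>A = U diag(d) U*\<close> with \<open>U\<close> unitary and \<open>d \<ge> 0\<close>, then \<open>A^x = U diag(d^x) U*\<close>, which does not
  depend on the choice of \<open>U\<close> and \<open>d\<close>. Since \<open>0 powr x = 0\<close>, this is the usual power for positive
  definite \<open>A\<close> and all real \<open>x\<close>, and for positive semi-definite \<open>A\<close> and \<open>x > 0\<close>.\<close>

definition mat_powr :: "complex mat \<Rightarrow> real \<Rightarrow> complex mat" where
  "mat_powr A x = (THE P. \<exists>U d. let n = dim_row A in
     U \<in> carrier_mat n n \<and> mat_adjoint U * U = 1\<^sub>m n \<and>
     (\<forall>i<n. 0 \<le> d i) \<and>
     A = U * mat_diag n (\<lambda>i. complex_of_real (d i)) * mat_adjoint U \<and>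
     P = U * mat_diag n (\<lambda>i. complex_of_real (d i powr x)) * mat_adjoint U)"

text \<open>The eigenvalues with multiplicity in decreasing order. This is meaningful only for matrices
  all of whose eigenvalues are real; otherwise no such list exists.\<close>

definition eigs :: "complex mat \<Rightarrow> real list" where
  "eigs X = (THE es. sorted_wrt (\<ge>) es \<and>
     char_poly X = (\<Prod>e\<leftarrow>es. [:- complex_of_real e, 1:]))"

definition list_powr :: "real list \<Rightarrow> real \<Rightarrow> real list" where
  "list_powr v p = map (\<lambda>c. c powr p) v"

text \<open>Log-majorization, for lists with nonnegative entries in decreasing order.\<close>

definition log_majorized :: "real list \<Rightarrow> real list \<Rightarrow> bool" (infix "\<prec>\<^sub>l\<^sub>o\<^sub>g" 50) where
  "x \<prec>\<^sub>l\<^sub>o\<^sub>g y \<longleftrightarrow> length x = length y \<and>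
     (\<forall>k. 1 \<le> k \<and> k < length x \<longrightarrow> (\<Prod>i<k. x ! i) \<le> (\<Prod>i<k. y ! i)) \<and>
     (\<Prod>i<length x. x ! i) = (\<Prod>i<length y. y ! i)"

definition sharp_formula :: "real \<Rightarrow> real \<Rightarrow> complex mat \<Rightarrow> complex mat \<Rightarrow> complex mat" where
  "sharp_formula r t A B =
     mat_powr A (r / 2) * mat_powr (mat_powr A (- 1 / 2) * B * mat_powr A (- 1 / 2)) t
       * mat_powr A (r / 2)"

definition powr_times_formula :: "real \<Rightarrow> complex mat \<Rightarrow> complex mat \<Rightarrow> complex mat" where
  "powr_times_formula q A B = mat_powr A q * B"

text \<open>Extension by continuity of an expression \<open>F A B\<close> from positive definite to positive
  semi-definite arguments: the (entrywise) limit of \<open>F (A + \<epsilon>I) (B + \<epsilon>I)\<close> as \<open>\<epsilon>\<close> tends to 0 from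
  the right. The value is meaningful only under \<open>ext_defined\<close>.\<close>

definition regularized ::
  "nat \<Rightarrow> (complex mat \<Rightarrow> complex mat \<Rightarrow> complex mat) \<Rightarrow> complex mat \<Rightarrow> complex mat \<Rightarrow> real \<Rightarrow> complex mat"
  where
  "regularized n F A B \<epsilon> =
     F (A + complex_of_real \<epsilon> \<cdot>\<^sub>m 1\<^sub>m n) (B + complex_of_real \<epsilon> \<cdot>\<^sub>m 1\<^sub>m n)"

definition ext_defined ::
  "nat \<Rightarrow> (complex mat \<Rightarrow> complex mat \<Rightarrow> complex mat) \<Rightarrow> complex mat \<Rightarrow> complex mat \<Rightarrow> bool" where
  "ext_defined n F A B \<longleftrightarrow> (pos_def n A \<and> pos_def n B) \<or>
     (\<forall>i<n. \<forall>j<n. \<exists>l. ((\<lambda>\<epsilon>. regularized n F A B \<epsilon> $$ (i, j)) \<longlongrightarrow> l) (at_right 0))"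

definition ext_value ::
  "nat \<Rightarrow> (complex mat \<Rightarrow> complex mat \<Rightarrow> complex mat) \<Rightarrow> complex mat \<Rightarrow> complex mat \<Rightarrow> complex mat" where
  "ext_value n F A B = (if pos_def n A \<and> pos_def n B then F A B
     else mat n n (\<lambda>(i, j). Lim (at_right 0) (\<lambda>\<epsilon>. regularized n F A B \<epsilon> $$ (i, j))))"

abbreviation sharp_defined :: "nat \<Rightarrow> real \<Rightarrow> real \<Rightarrow> complex mat \<Rightarrow> complex mat \<Rightarrow> bool" where
  "sharp_defined n r t \<equiv> ext_defined n (sharp_formula r t)"

abbreviation sharp :: "nat \<Rightarrow> real \<Rightarrow> real \<Rightarrow> complex mat \<Rightarrow> complex mat \<Rightarrow> complex mat" where
  "sharp n r t \<equiv> ext_value n (sharp_formula r t)"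

abbreviation powr_times_defined :: "nat \<Rightarrow> real \<Rightarrow> complex mat \<Rightarrow> complex mat \<Rightarrow> bool" where
  "powr_times_defined n q \<equiv> ext_defined n (powr_times_formula q)"

abbreviation powr_times :: "nat \<Rightarrow> real \<Rightarrow> complex mat \<Rightarrow> complex mat \<Rightarrow> complex mat" where
  "powr_times n q \<equiv> ext_value n (powr_times_formula q)"

end

theory Submission
  imports Defs
begin

text \<open>Suppose first that \<open>A\<close> and \<open>B\<close> are positive definite. Put \<open>C = A^(-1/2) B A^(-1/2)\<close>,
  \<open>D = A^(r+s)\<close> and \<open>a = r/(r+s)\<close>, which lies between 0 and 1 because \<open>r\<close> and \<open>s\<close> have the same
  sign. The two factors become powers of \<open>X = D^(a/2) C^t D^(a/2)\<close> and
  \<open>Y = D^((1-a)/2) C^(1-t) D^((1-a)/2)\<close>, and \<open>A^(r+s-1) B\<close> is similar to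
  \<open>Z = D^(1/2) C D^(1/2)\<close>. The signs of \<open>r\<close> and \<open>s\<close> have disappeared.

  For the largest eigenvalue, scale so that \<open>Z \<le> I\<close>, that is, \<open>C \<le> D^(-1)\<close>. Write
  \<open>X = K K*\<close> with \<open>K = D^(a/2) C^(t/2)\<close>; then \<open>X^p = K (K* K)^(p-1) K*\<close>, and three uses of the
  Loewner-Heinz inequality give \<open>X^p \<le> D^(a-\<tau>)\<close> with \<open>\<tau> = t p - a (p-1)\<close>
  (\<open>furuta_type_inequality\<close>). The bounds on \<open>t\<close> say precisely that \<open>0 \<le> \<tau> \<le> 1\<close>, and \<open>p \<le> 2\<close>
  makes \<open>p - 1\<close> an admissible exponent. Exchanging \<open>a, t\<close> with \<open>1-a, 1-t\<close> replaces \<open>\<tau>\<close> by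
  \<open>1-\<tau>\<close>, so \<open>Y^p \<le> D^(\<tau>-a)\<close>, the inverse of the bound for \<open>X^p\<close>. Hence no eigenvalue of
  \<open>X^p Y^p\<close> exceeds 1 (\<open>top_eigenvalue_bound_one\<close>).

  For products of the \<open>k\<close> largest eigenvalues, pass to the \<open>k\<close>-th compound matrices, the matrices
  of \<open>k \<times> k\<close> minors. By the Cauchy-Binet formula, taking compounds is multiplicative; it also
  respects adjoints and diagonal matrices, hence real powers, and the largest eigenvalue of the
  compound is the product of the \<open>k\<close> largest eigenvalues. So the bound for the largest eigenvalue
  of the compounds is the required one (\<open>prod_top_eigenvalues_le\<close>). For \<open>k = n\<close> equality
  holds because determinants are multiplicative.

  Semi-definite \<open>A\<close> and \<open>B\<close> are approximated by \<open>A + \<epsilon> I\<close> and \<open>B + \<epsilon> I\<close>. The unitary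
  matrices that diagonalise the two factors, and all eigenvalues involved, stay bounded. Along a
  subsequence they converge, the limits are the corresponding data of the limit matrices, and the
  inequalities persist (\<open>log_majorization_limit\<close>).\<close>

section \<open>Adjoints, quadratic forms and unitary matrices\<close>

notation mat_adjoint ("_\<^sup>\<dagger>" [1000] 1000)

lemma adjoint_index:
  "i < dim_col A \<Longrightarrow> j < dim_row A \<Longrightarrow> A\<^sup>\<dagger> $$ (i, j) = conjugate (A $$ (j, i))"
  unfolding mat_adjoint_def mat_of_rows_def by simp

lemma adjoint_dims [simp]: "dim_row (A\<^sup>\<dagger>) = dim_col A" "dim_col (A\<^sup>\<dagger>) = dim_row A"
  unfolding mat_adjoint_def by auto

lemma adjoint_carrier [simp]: "A \<in> carrier_mat n m \<Longrightarrow> A\<^sup>\<dagger> \<in> carrier_mat m n"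
  by auto

text \<open>The following rules restate dimension-dependent facts for square matrices only. Then a single
  dimension occurs in the side conditions, so it can be fixed by one instantiation when they are
  used as rewrite rules.\<close>

lemma square_mult_carrier [simp]:
  "A \<in> carrier_mat n n \<Longrightarrow> B \<in> carrier_mat n n \<Longrightarrow> A * B \<in> carrier_mat n n"
  by (rule mult_carrier_mat)

lemma square_adjoint_carrier [simp]: "A \<in> carrier_mat n n \<Longrightarrow> A\<^sup>\<dagger> \<in> carrier_mat n n"
  by auto

lemma square_mult_vec_carrier [simp]:
  "A \<in> carrier_mat n n \<Longrightarrow> v \<in> carrier_vec n \<Longrightarrow> A *\<^sub>v v \<in> carrier_vec n"
  by (rule mult_mat_vec_carrier)

lemma square_mult_one [simp]:
  fixes A :: "complex mat"
  shows "A \<in> carrier_mat n n \<Longrightarrow> A * 1\<^sub>m n = A" "A \<in> carrier_mat n n \<Longrightarrow> 1\<^sub>m n * A = A"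
  by simp_all

lemma square_mult_zero_vec [simp]:
  fixes A :: "complex mat"
  shows "A \<in> carrier_mat n n \<Longrightarrow> A *\<^sub>v 0\<^sub>v n = 0\<^sub>v n"
  by (intro eq_vecI) auto

lemma square_mult_smult_vec:
  fixes A :: "complex mat"
  shows "A \<in> carrier_mat n n \<Longrightarrow> v \<in> carrier_vec n \<Longrightarrow> A *\<^sub>v (c \<cdot>\<^sub>v v) = c \<cdot>\<^sub>v (A *\<^sub>v v)"
  by (rule mult_mat_vec)

lemma square_assoc:
  "A \<in> carrier_mat n n \<Longrightarrow> B \<in> carrier_mat n n \<Longrightarrow> C \<in> carrier_mat n n \<Longrightarrow>
    A * B * C = A * (B * C)"
  by (rule assoc_mult_mat)

lemma square_assoc_vec:
  "A \<in> carrier_mat n n \<Longrightarrow> B \<in> carrier_mat n n \<Longrightarrow> v \<in> carrier_vec n \<Longrightarrow>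
    (A * B) *\<^sub>v v = A *\<^sub>v (B *\<^sub>v v)"
  by (rule assoc_mult_mat_vec)

lemma adjoint_adjoint [simp]: "(A\<^sup>\<dagger>)\<^sup>\<dagger> = A"
  by (rule eq_matI) (auto simp: adjoint_index)

lemma adjoint_mult:
  fixes A :: "complex mat"
  assumes "A \<in> carrier_mat n m" "B \<in> carrier_mat m k"
  shows "(A * B)\<^sup>\<dagger> = B\<^sup>\<dagger> * A\<^sup>\<dagger>"
  using assms
  by (intro eq_matI) (auto simp: adjoint_index scalar_prod_def intro!: sum.cong)

lemma adjoint_one [simp]: "(1\<^sub>m n :: complex mat)\<^sup>\<dagger> = 1\<^sub>m n"
  by (rule eq_matI) (auto simp: adjoint_index)

abbreviation rdiag :: "nat \<Rightarrow> (nat \<Rightarrow> real) \<Rightarrow> complex mat" where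
  "rdiag n d \<equiv> mat_diag n (\<lambda>i. complex_of_real (d i))"

lemma adjoint_rdiag [simp]: "(rdiag n d)\<^sup>\<dagger> = rdiag n d"
  by (rule eq_matI) (auto simp: adjoint_index mat_diag_def)

lemma rdiag_cong: "(\<And>i. i < n \<Longrightarrow> d i = e i) \<Longrightarrow> rdiag n d = rdiag n e"
  by (rule eq_matI) (auto simp: mat_diag_def)

lemma cinner_adjoint:
  fixes A :: "complex mat"
  assumes "A \<in> carrier_mat n m" "v \<in> carrier_vec m" "w \<in> carrier_vec n"
  shows "(A *\<^sub>v v) \<bullet>c w = v \<bullet>c (A\<^sup>\<dagger> *\<^sub>v w)"
proof -
  have "(A *\<^sub>v v) \<bullet>c w = (\<Sum>i<n. \<Sum>j<m. A $$ (i, j) * v $ j * cnj (w $ i))"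
    using assms by (auto simp: scalar_prod_def sum_distrib_right atLeast0LessThan intro!: sum.cong)
  also have "\<dots> = (\<Sum>j<m. \<Sum>i<n. A $$ (i, j) * v $ j * cnj (w $ i))"
    by (rule sum.swap)
  also have "\<dots> = v \<bullet>c (A\<^sup>\<dagger> *\<^sub>v w)"
    using assms
    by (auto simp: scalar_prod_def sum_distrib_left atLeast0LessThan adjoint_index intro!: sum.cong)
  finally show ?thesis .
qed

lemma cinner_commute:
  fixes v w :: "complex vec"
  assumes "v \<in> carrier_vec n" "w \<in> carrier_vec n"
  shows "v \<bullet>c w = cnj (w \<bullet>c v)"
  using assms by (auto simp: scalar_prod_def mult.commute intro!: sum.cong)

lemma Re_cinner_self:
  fixes v :: "complex vec"
  assumes "v \<in> carrier_vec n"
  shows "Re (v \<bullet>c v) = (\<Sum>i<n. (cmod (v $ i))\<^sup>2)"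
  using assms
  by (simp add: scalar_prod_def atLeast0LessThan cmod_power2 sum.distrib flip: power2_eq_square)

lemma cinner_self_pos:
  fixes v :: "complex vec"
  assumes "v \<in> carrier_vec n" "v \<noteq> 0\<^sub>v n"
  shows "0 < Re (v \<bullet>c v)"
proof -
  obtain i where "i < n" "v $ i \<noteq> 0"
    using assms by (metis carrier_vecD eq_vecI index_zero_vec(1) index_zero_vec(2))
  then show ?thesis
    unfolding Re_cinner_self[OF assms(1)]
    by (intro sum_pos2[of _ i]) auto
qed

text \<open>This form of the Cauchy-Schwarz inequality avoids square roots. It suffices where both squared
  norms on the right-hand side obey the same bound.\<close>

lemma two_Re_cinner_le:
  fixes v w :: "complex vec"
  assumes "v \<in> carrier_vec n" "w \<in> carrier_vec n"
  shows "2 * Re (v \<bullet>c w) \<le> Re (v \<bullet>c v) + Re (w \<bullet>c w)"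
proof -
  have *: "2 * (a * c + b * d) \<le> (a\<^sup>2 + b\<^sup>2) + (c\<^sup>2 + d\<^sup>2)" for a b c d :: real
    using sum_squares_ge_zero[of "a - c" "b - d"] by (simp add: algebra_simps power2_eq_square)
  have "2 * Re (v \<bullet>c w) = (\<Sum>i<n. 2 * (Re (v $ i) * Re (w $ i) + Im (v $ i) * Im (w $ i)))"
    using assms by (simp add: scalar_prod_def atLeast0LessThan sum_distrib_left)
  also have "\<dots> \<le> (\<Sum>i<n. (cmod (v $ i))\<^sup>2 + (cmod (w $ i))\<^sup>2)"
    unfolding cmod_power2 by (intro sum_mono *)
  finally show ?thesis
    using assms by (simp add: Re_cinner_self sum.distrib)
qed

definition qform :: "complex mat \<Rightarrow> complex vec \<Rightarrow> real" where
  "qform A v = Re ((A *\<^sub>v v) \<bullet>c v)"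

lemma qform_rdiag:
  assumes "v \<in> carrier_vec n"
  shows "qform (rdiag n d) v = (\<Sum>i<n. d i * (cmod (v $ i))\<^sup>2)"
proof -
  have "(rdiag n d *\<^sub>v v) $ i = complex_of_real (d i) * v $ i" if "i < n" for i
  proof -
    have "(rdiag n d *\<^sub>v v) $ i = (\<Sum>j<n. if i = j then complex_of_real (d j) * v $ j else 0)"
      using assms that
      by (simp add: mat_diag_def scalar_prod_def atLeast0LessThan if_distrib[of "\<lambda>x. x * _"] cong: if_cong)
    also have "\<dots> = complex_of_real (d i) * v $ i"
      using that by simp
    finally show ?thesis .
  qed
  moreover have "dim_vec (rdiag n d *\<^sub>v v) = n"
    by (simp add: mat_diag_def)
  ultimately show ?thesis
    using assms
    by (simp add: qform_def scalar_prod_def atLeast0LessThan cmod_power2 algebra_simps sum.distrib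
        del: index_mult_mat_vec flip: power2_eq_square)
qed

text \<open>Both sides are \<open>\<langle>A K v, K v\<rangle>\<close>.\<close>

lemma qform_congruence:
  assumes "A \<in> carrier_mat n n" "K \<in> carrier_mat n m" "v \<in> carrier_vec m"
  shows "qform (K\<^sup>\<dagger> * A * K) v = qform A (K *\<^sub>v v)"
proof -
  have "(K\<^sup>\<dagger> * A * K) *\<^sub>v v = K\<^sup>\<dagger> *\<^sub>v (A *\<^sub>v (K *\<^sub>v v))"
    using assms
    by (simp add: assoc_mult_mat_vec[of "K\<^sup>\<dagger>" m n "A * K" m v] assoc_mult_mat_vec[of A n n K m v]
        assoc_mult_mat[of "K\<^sup>\<dagger>" m n A n K m])
  then show ?thesis
    unfolding qform_def
    using assms cinner_adjoint[of "K\<^sup>\<dagger>" m n "A *\<^sub>v (K *\<^sub>v v)" v] by simp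
qed

text \<open>On Hermitian matrices this is the Loewner order.\<close>

definition loewner_le :: "nat \<Rightarrow> complex mat \<Rightarrow> complex mat \<Rightarrow> bool" where
  "loewner_le n A B \<longleftrightarrow> (\<forall>v \<in> carrier_vec n. qform A v \<le> qform B v)"

lemma loewner_le_trans: "loewner_le n A B \<Longrightarrow> loewner_le n B C \<Longrightarrow> loewner_le n A C"
  unfolding loewner_le_def by fastforce

lemma loewner_le_refl: "loewner_le n A A"
  by (simp add: loewner_le_def)

lemma loewner_le_congruence:
  assumes "A \<in> carrier_mat n n" "B \<in> carrier_mat n n" "K \<in> carrier_mat n m" "loewner_le n A B"
  shows "loewner_le m (K\<^sup>\<dagger> * A * K) (K\<^sup>\<dagger> * B * K)"
  using assms unfolding loewner_le_def by (simp add: qform_congruence)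

definition unitary :: "nat \<Rightarrow> complex mat \<Rightarrow> bool" where
  "unitary n U \<longleftrightarrow> U \<in> carrier_mat n n \<and> U\<^sup>\<dagger> * U = 1\<^sub>m n"

lemma unitary_carrier: "unitary n U \<Longrightarrow> U \<in> carrier_mat n n"
  by (simp add: unitary_def)

lemma unitary_left: "unitary n U \<Longrightarrow> U\<^sup>\<dagger> * U = 1\<^sub>m n"
  by (simp add: unitary_def)

lemma unitary_right: "unitary n U \<Longrightarrow> U * U\<^sup>\<dagger> = 1\<^sub>m n"
  unfolding unitary_def using mat_mult_left_right_inverse[of "U\<^sup>\<dagger>" n U] by auto

lemma unitary_mult:
  assumes "unitary n U" "unitary n V"
  shows "unitary n (U * V)"
proof -
  have c: "U \<in> carrier_mat n n" "V \<in> carrier_mat n n" using assms by (auto simp: unitary_def)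
  have "(U * V)\<^sup>\<dagger> * (U * V) = V\<^sup>\<dagger> * ((U\<^sup>\<dagger> * U) * V)"
    using c by (simp add: adjoint_mult[of _ n n _ n] square_assoc[where n = n])
  then show ?thesis using assms c by (simp add: unitary_def)
qed

lemma left_cancel:
  fixes P Q M :: "complex mat"
  assumes "P \<in> carrier_mat n n" "Q \<in> carrier_mat n n" "M \<in> carrier_mat n n" "P * Q = 1\<^sub>m n"
  shows "P * (Q * M) = M"
  using assms by (simp add: square_assoc[where n = n, symmetric])

text \<open>The entries of \<open>d\<close> are the eigenvalues of \<open>A\<close> and the columns of \<open>U\<close> form an orthonormal
  eigenbasis.\<close>

definition spectral_form :: "nat \<Rightarrow> complex mat \<Rightarrow> complex mat \<Rightarrow> (nat \<Rightarrow> real) \<Rightarrow> bool" where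
  "spectral_form n A U d \<longleftrightarrow> unitary n U \<and> A = U * rdiag n d * U\<^sup>\<dagger>"

lemma spectral_form_carrier: "spectral_form n A U d \<Longrightarrow> A \<in> carrier_mat n n"
  unfolding spectral_form_def unitary_def by auto

lemma spectral_form_hermitian:
  assumes "spectral_form n A U d"
  shows "A\<^sup>\<dagger> = A"
proof -
  have U: "U \<in> carrier_mat n n" using assms by (simp add: spectral_form_def unitary_def)
  show ?thesis
    using assms U
    by (simp add: spectral_form_def adjoint_mult[of _ n n _ n] square_assoc[where n = n])
qed

lemma spectral_form_mult:
  assumes "spectral_form n A U d" "spectral_form n B U e"
  shows "spectral_form n (A * B) U (\<lambda>i. d i * e i)"
proof -
  have U: "U \<in> carrier_mat n n" "U\<^sup>\<dagger> * U = 1\<^sub>m n"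
    using assms by (auto simp: spectral_form_def unitary_def)
  have "A * B = U * (rdiag n d * ((U\<^sup>\<dagger> * (U * (rdiag n e * U\<^sup>\<dagger>)))))"
    using assms U(1) by (simp add: spectral_form_def square_assoc[where n = n])
  also have "\<dots> = U * ((rdiag n d * rdiag n e) * U\<^sup>\<dagger>)"
    using U by (simp add: left_cancel[where n = n] square_assoc[where n = n] del: mat_diag_diag)
  finally show ?thesis
    using assms U by (simp add: spectral_form_def square_assoc[where n = n])
qed

text \<open>In the coordinates given by the eigenbasis, the form is a weighted sum of squares.\<close>

lemma spectral_form_qform:
  assumes "spectral_form n A U d" "v \<in> carrier_vec n"
  shows "qform A v = (\<Sum>i<n. d i * (cmod ((U\<^sup>\<dagger> *\<^sub>v v) $ i))\<^sup>2)"
proof -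
  have U: "U \<in> carrier_mat n n" using assms by (auto simp: spectral_form_def unitary_def)
  have "qform A v = qform (U\<^sup>\<dagger>\<^sup>\<dagger> * rdiag n d * U\<^sup>\<dagger>) v"
    using assms by (simp add: spectral_form_def)
  also have "\<dots> = qform (rdiag n d) (U\<^sup>\<dagger> *\<^sub>v v)"
    using U assms by (intro qform_congruence[of _ n]) auto
  finally show ?thesis using U assms by (simp add: qform_rdiag)
qed

section \<open>The spectral theorem for Hermitian matrices\<close>

text \<open>Complete \<open>v\<close> to a basis, apply Gram-Schmidt, which leaves the first vector unchanged, and
  normalise.\<close>

lemma unitary_with_first_column:
  fixes v :: "complex vec"
  assumes v: "v \<in> carrier_vec n" and v0: "v \<noteq> 0\<^sub>v n"
  shows "\<exists>W c. unitary n W \<and> (\<forall>i<n. W $$ (i, 0) = c * v $ i)"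
proof -
  interpret cof_vec_space n "TYPE(complex)" .
  note b = basis_completion[OF v v0]
  define ws where "ws = gram_schmidt n (basis_completion v)"
  note g = gram_schmidt_result[OF b(2) b(4) b(5) ws_def]
  have len: "length ws = n"
    using g(4) b(6) by simp
  obtain vs where "basis_completion v = v # vs"
    using b(6,7) v v0 by (cases "basis_completion v") auto
  then have hd: "hd ws = v"
    using gram_schmidt_hd[OF v, of vs] by (simp add: ws_def)
  have car: "ws ! j \<in> carrier_vec n" if "j < n" for j
    using g(3) len that by (metis nth_mem subsetD)
  have orth: "ws ! j \<bullet>c ws ! i = 0 \<longleftrightarrow> i \<noteq> j" if "i < n" "j < n" for i j
    using corthogonalD[OF g(2)] that len by auto
  define N where "N j = Re (ws ! j \<bullet>c ws ! j)" for j
  have N: "ws ! j \<bullet>c ws ! j = complex_of_real (N j)" "0 < N j" if "j < n" for j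
  proof -
    have "Im (ws ! j \<bullet>c ws ! j) = 0"
      using cinner_commute[OF car car, OF that that] by (metis complex_cnj_cancel_iff complex_is_Real_iff Reals_cnj_iff)
    then show "ws ! j \<bullet>c ws ! j = complex_of_real (N j)"
      by (simp add: N_def complex_eq_iff)
    have "ws ! j \<noteq> 0\<^sub>v n"
      using orth[OF that that] car[OF that] by auto
    then show "0 < N j"
      unfolding N_def using cinner_self_pos[OF car[OF that]] by blast
  qed
  define W where "W = mat n n (\<lambda>(i, j). ws ! j $ i / complex_of_real (sqrt (N j)))"
  have "W\<^sup>\<dagger> * W = 1\<^sub>m n"
  proof (rule eq_matI)
    fix i j assume "i < dim_row (1\<^sub>m n :: complex mat)" "j < dim_col (1\<^sub>m n :: complex mat)"
    then have ij: "i < n" "j < n" by auto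
    have "(W\<^sup>\<dagger> * W) $$ (i, j) = (\<Sum>l<n. cnj (W $$ (l, i)) * W $$ (l, j))"
      using ij by (auto simp: W_def scalar_prod_def adjoint_index atLeast0LessThan)
    also have "\<dots> = (\<Sum>l<n. ws ! j $ l * cnj (ws ! i $ l) / complex_of_real (sqrt (N i) * sqrt (N j)))"
      using ij by (intro sum.cong) (auto simp: W_def)
    also have "\<dots> = (ws ! j \<bullet>c ws ! i) / complex_of_real (sqrt (N i) * sqrt (N j))"
      using car[OF ij(1)] car[OF ij(2)]
      by (simp add: scalar_prod_def atLeast0LessThan sum_divide_distrib)
    also have "\<dots> = 1\<^sub>m n $$ (i, j)"
      using ij N[OF ij(1)] orth[OF ij]
      by (cases "i = j") (auto simp flip: of_real_mult)
    finally show "(W\<^sup>\<dagger> * W) $$ (i, j) = 1\<^sub>m n $$ (i, j)" .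
  qed (auto simp: W_def)
  moreover have "W \<in> carrier_mat n n" by (simp add: W_def)
  moreover have "W $$ (i, 0) = (1 / complex_of_real (sqrt (N 0))) * v $ i" if "i < n" for i
  proof -
    have "ws ! 0 = v" using hd len that by (cases ws) auto
    then show ?thesis using that by (simp add: W_def)
  qed
  ultimately show ?thesis unfolding unitary_def by blast
qed

lemma block_diag_mult:
  fixes E F M N :: "complex mat"
  assumes "E \<in> carrier_mat 1 1" "F \<in> carrier_mat 1 1" "M \<in> carrier_mat m m" "N \<in> carrier_mat m m"
  shows "four_block_mat E (0\<^sub>m 1 m) (0\<^sub>m m 1) M * four_block_mat F (0\<^sub>m 1 m) (0\<^sub>m m 1) N =
    four_block_mat (E * F) (0\<^sub>m 1 m) (0\<^sub>m m 1) (M * N)"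
proof -
  note z = zero_carrier_mat[of 1 m] zero_carrier_mat[of m 1]
  have "E * 0\<^sub>m 1 m + 0\<^sub>m 1 m * N = 0\<^sub>m 1 m" "0\<^sub>m m 1 * F + M * 0\<^sub>m m 1 = 0\<^sub>m m 1"
    "E * F + 0\<^sub>m 1 m * 0\<^sub>m m 1 = E * F" "0\<^sub>m m 1 * 0\<^sub>m 1 m + M * N = M * N"
    using assms by (auto intro!: eq_matI)
  then show ?thesis
    using mult_four_block_mat[OF assms(1) z assms(3) assms(2) z assms(4)] by simp
qed

text \<open>Induction on the list of roots of the characteristic polynomial. A unitary matrix whose first
  column is an eigenvector for the first root splits off a block of size one, because a Hermitian
  matrix with first column \<open>(e, 0, ..., 0)\<close> also has first row \<open>(e, 0, ..., 0)\<close>. The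
  remaining block is Hermitian and its characteristic polynomial has the remaining roots. Thus
  the eigenvalues appear on the diagonal in the given order, so that they can be sorted
  beforehand.\<close>

lemma spectral_theorem_hermitian:
  assumes "A \<in> carrier_mat n n" "A\<^sup>\<dagger> = A" "char_poly A = (\<Prod>a\<leftarrow>es. [:- a, 1:])"
  shows "\<exists>U. unitary n U \<and> A = U * mat_diag n (\<lambda>i. es ! i) * U\<^sup>\<dagger>"
  using assms
proof (induction es arbitrary: n A)
  case Nil
  then have "n = 0"
    using degree_monic_char_poly[of A n] by simp
  with Nil show ?case
    by (intro exI[of _ "1\<^sub>m n"]) (auto simp: unitary_def mat_diag_def intro!: eq_matI)
next
  case (Cons e es)
  note A = Cons.prems(1)
  have mon: "monic (\<Prod>a\<leftarrow>es. [:- a, 1:])"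
    by (rule monic_prod_list) auto
  have "degree (char_poly A) = Suc (degree (\<Prod>a\<leftarrow>es. [:- a, 1:]))"
    unfolding Cons.prems(3) using mon by (subst list.map, subst prod_list.Cons, subst degree_mult_eq) auto
  then obtain m where n: "n = Suc m"
    using degree_monic_char_poly[OF A] by auto
  have "eigenvalue A e"
    unfolding eigenvalue_root_char_poly[OF A] Cons.prems(3) by simp
  then obtain v where v: "v \<in> carrier_vec n" "v \<noteq> 0\<^sub>v n" "A *\<^sub>v v = e \<cdot>\<^sub>v v"
    using A by (auto simp: eigenvalue_def eigenvector_def)
  obtain W c where W: "unitary n W" "\<And>i. i < n \<Longrightarrow> W $$ (i, 0) = c * v $ i"
    using unitary_with_first_column[OF v(1,2)] by blast
  note Wc = unitary_carrier[OF W(1)]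
  define B where "B = W\<^sup>\<dagger> * (A * W)"
  have B: "B \<in> carrier_mat n n" using A Wc by (simp add: B_def)
  have BH: "B\<^sup>\<dagger> = B"
    using A Wc Cons.prems(2) by (simp add: B_def adjoint_mult[of _ n n _ n] square_assoc[where n = n])
  have col0: "B $$ (i, 0) = (if i = 0 then e else 0)" if i: "i < n" for i
  proof -
    have AW: "(A * W) $$ (l, 0) = e * W $$ (l, 0)" if l: "l < n" for l
    proof -
      have "(A * W) $$ (l, 0) = c * (A *\<^sub>v v) $ l"
        using A Wc W(2) v(1) l n
        by (auto simp: scalar_prod_def sum_distrib_left algebra_simps intro!: sum.cong)
      then show ?thesis using v(1) l by (simp add: v(3) W(2))
    qed
    have "B $$ (i, 0) = (\<Sum>l<n. cnj (W $$ (l, i)) * (e * W $$ (l, 0)))"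
      using A Wc i n AW
      by (auto simp: B_def scalar_prod_def adjoint_index atLeast0LessThan intro!: sum.cong
          simp del: index_mult_mat(1)) (auto simp: scalar_prod_def adjoint_index atLeast0LessThan)
    also have "\<dots> = e * (W\<^sup>\<dagger> * W) $$ (i, 0)"
      using Wc i n by (auto simp: scalar_prod_def adjoint_index atLeast0LessThan sum_distrib_left
          algebra_simps intro!: sum.cong)
    finally show ?thesis using i n by (simp add: unitary_left[OF W(1)])
  qed
  have row0: "B $$ (0, i) = (if i = 0 then e else 0)" if i: "i < n" for i
  proof (cases "i = 0")
    case False
    have "B $$ (0, i) = B\<^sup>\<dagger> $$ (0, i)" by (simp add: BH)
    also have "\<dots> = conjugate (B $$ (i, 0))"
      using i n B by (intro adjoint_index) auto
    finally show ?thesis using False col0[OF i] by simp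
  qed (use col0 n in auto)
  define C where "C = mat m m (\<lambda>(i, j). B $$ (Suc i, Suc j))"
  have C: "C \<in> carrier_mat m m" by (simp add: C_def)
  define e1 where "e1 = mat 1 1 (\<lambda>_. e)"
  have B_block: "B = four_block_mat e1 (0\<^sub>m 1 m) (0\<^sub>m m 1) C"
    using B n col0 row0 by (intro eq_matI) (auto simp: C_def e1_def)
  have "C\<^sup>\<dagger> = C"
  proof (rule eq_matI)
    fix i j assume ij: "i < dim_row C" "j < dim_col C"
    then have "B\<^sup>\<dagger> $$ (Suc i, Suc j) = conjugate (B $$ (Suc j, Suc i))"
      using B n by (intro adjoint_index) (auto simp: C_def)
    then show "C\<^sup>\<dagger> $$ (i, j) = C $$ (i, j)"
      using ij unfolding BH by (simp add: C_def adjoint_index)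
  qed (auto simp: C_def)
  moreover have "char_poly C = (\<Prod>a\<leftarrow>es. [:- a, 1:])"
  proof -
    have "similar_mat A B"
    proof -
      have "A = W * B * W\<^sup>\<dagger>"
      proof -
        have "W * B * W\<^sup>\<dagger> = (W * (W\<^sup>\<dagger> * (A * (W * W\<^sup>\<dagger>))))"
          using A Wc by (simp add: B_def square_assoc[where n = n])
        also have "\<dots> = A"
          using A Wc unitary_right[OF W(1)] by (simp add: left_cancel[where n = n])
        finally show ?thesis by simp
      qed
      then show ?thesis
        using A B Wc unitary_right[OF W(1)] unitary_left[OF W(1)]
        unfolding similar_mat_def similar_mat_wit_def Let_def
        by (intro exI[of _ W] exI[of _ "W\<^sup>\<dagger>"]) auto
    qed
    then have "char_poly A = char_poly B" by (rule char_poly_similar)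
    also have "\<dots> = char_poly e1 * char_poly C"
      unfolding B_block using C by (intro char_poly_four_block_zeros_col) (auto simp: e1_def)
    also have "char_poly e1 = [:- e, 1:]"
      by (subst char_poly_upper_triangular[of _ 1]) (auto simp: e1_def diag_mat_def)
    finally show ?thesis
      unfolding Cons.prems(3) by (simp del: mult_pCons_left)
  qed
  ultimately obtain V where V: "unitary m V" "C = V * mat_diag m (\<lambda>i. es ! i) * V\<^sup>\<dagger>"
    using Cons.IH[OF C] by blast
  note Vc = unitary_carrier[OF V(1)]
  define V1 where "V1 = four_block_mat (1\<^sub>m 1) (0\<^sub>m 1 m) (0\<^sub>m m 1) V"
  have V1c: "V1 \<in> carrier_mat n n"
    using four_block_carrier_mat[of "1\<^sub>m 1" 1 1 V m m] Vc n by (simp add: V1_def)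
  have V1H: "V1\<^sup>\<dagger> = four_block_mat (1\<^sub>m 1) (0\<^sub>m 1 m) (0\<^sub>m m 1) (V\<^sup>\<dagger>)"
    using Vc n by (intro eq_matI) (auto simp: V1_def adjoint_index)
  have one: "four_block_mat (1\<^sub>m 1) (0\<^sub>m 1 m) (0\<^sub>m m 1) (1\<^sub>m m) = (1\<^sub>m n :: complex mat)"
    using n by (intro eq_matI) auto
  have V1: "unitary n V1"
    unfolding unitary_def V1H
    using V1c Vc unitary_left[OF V(1)] one
    by (simp add: V1_def block_diag_mult[where m = m] del: One_nat_def)
  have D: "mat_diag n (\<lambda>i. (e # es) ! i) = four_block_mat e1 (0\<^sub>m 1 m) (0\<^sub>m m 1) (mat_diag m (\<lambda>i. es ! i))"
    using n by (intro eq_matI) (auto simp: mat_diag_def e1_def nth_Cons')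
  have e1c: "e1 \<in> carrier_mat 1 1" by (simp add: e1_def)
  have "V1 * mat_diag n (\<lambda>i. (e # es) ! i) * V1\<^sup>\<dagger> = B"
    unfolding B_block D V1H unfolding V1_def V(2)
    using Vc e1c by (simp add: block_diag_mult[where m = m] del: One_nat_def)
  moreover have "W * V1 * X * (W * V1)\<^sup>\<dagger> = W * (V1 * X * V1\<^sup>\<dagger> * W\<^sup>\<dagger>)" if "X \<in> carrier_mat n n" for X
    using Wc V1c that by (simp add: adjoint_mult[of _ n n _ n] square_assoc[where n = n])
  ultimately have "W * V1 * mat_diag n (\<lambda>i. (e # es) ! i) * (W * V1)\<^sup>\<dagger> = W * (B * W\<^sup>\<dagger>)"
    by (metis mat_diag_dim)
  also have "\<dots> = (W * (W\<^sup>\<dagger> * (A * (W * W\<^sup>\<dagger>))))"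
    using A Wc by (simp add: B_def square_assoc[where n = n])
  also have "\<dots> = A"
    using A Wc unitary_right[OF W(1)] by (simp add: left_cancel[where n = n])
  finally show ?case
    using unitary_mult[OF W(1) V1] by metis
qed

text \<open>Diagonalising in an arbitrary order shows that the diagonal equals its own adjoint, so the
  roots of the characteristic polynomial are real. Diagonalising again, with the sorted roots,
  gives decreasing eigenvalues.\<close>

lemma hermitian_spectral_form:
  assumes A: "A \<in> carrier_mat n n" and H: "A\<^sup>\<dagger> = A"
  shows "\<exists>U d. spectral_form n A U d \<and> (\<forall>i j. i \<le> j \<longrightarrow> j < n \<longrightarrow> d j \<le> d i)"
proof -
  obtain as where as: "char_poly A = (\<Prod>a\<leftarrow>as. [:- a, 1:])" "length as = n"
    using char_poly_factorized[OF A] by blast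
  obtain U where U: "unitary n U" "A = U * mat_diag n (\<lambda>i. as ! i) * U\<^sup>\<dagger>"
    using spectral_theorem_hermitian[OF A H as(1)] by blast
  note Uc = unitary_carrier[OF U(1)]
  define D where "D = mat_diag n (\<lambda>i. as ! i)"
  have D: "D \<in> carrier_mat n n" by (simp add: D_def)
  have "U\<^sup>\<dagger> * A * U = U\<^sup>\<dagger> * (U * (D * (U\<^sup>\<dagger> * U)))"
    using Uc D by (simp add: U(2) D_def[symmetric] square_assoc[where n = n])
  also have "\<dots> = D"
    using Uc D unitary_left[OF U(1)] by (simp add: left_cancel[where n = n])
  finally have "D = U\<^sup>\<dagger> * A * U" ..
  then have "D\<^sup>\<dagger> = D"
    using Uc A H by (simp add: adjoint_mult[of _ n n _ n] square_assoc[where n = n])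
  then have "cnj (as ! i) = as ! i" if "i < n" for i
    using adjoint_index[of i D i] that by (simp add: D_def mat_diag_def)
  then have re: "as = map complex_of_real (map Re as)"
    using as(2) by (intro nth_equalityI) (auto simp: complex_eq_iff)
  define rs where "rs = rev (sort (map Re as))"
  have "mset (map complex_of_real rs) = mset (map complex_of_real (map Re as))"
    by (simp add: rs_def multiset.map_comp)
  then have "mset (map complex_of_real rs) = mset as"
    by (metis re)
  then have "mset (map (\<lambda>a. [:- a, 1:]) (map complex_of_real rs)) = mset (map (\<lambda>a. [:- a, 1:]) as)"
    by (metis mset_map)
  then have "char_poly A = (\<Prod>a\<leftarrow>map complex_of_real rs. [:- a, 1:])"
    unfolding as(1) prod_mset_prod_list[symmetric] by simp
  from spectral_theorem_hermitian[OF A H this] obtain V where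
    V: "unitary n V" "A = V * mat_diag n (\<lambda>i. map complex_of_real rs ! i) * V\<^sup>\<dagger>"
    by blast
  have len: "length rs = n" using as(2) by (simp add: rs_def)
  have "mat_diag n (\<lambda>i. map complex_of_real rs ! i) = rdiag n (\<lambda>i. rs ! i)"
    using len by (intro eq_matI) (auto simp: mat_diag_def)
  moreover have "rs ! j \<le> rs ! i" if "i \<le> j" "j < n" for i j
    using that as(2) by (auto simp: rs_def rev_nth intro!: sorted_nth_mono)
  ultimately show ?thesis
    using V unfolding spectral_form_def by (intro exI[of _ V] exI[of _ "\<lambda>i. rs ! i"]) auto
qed

lemma spectral_form_eigenvector:
  assumes S: "spectral_form n A U d" and i: "i < n"
  defines "v \<equiv> U *\<^sub>v unit_vec n i"
  shows "v \<in> carrier_vec n" "v \<noteq> 0\<^sub>v n" "A *\<^sub>v v = complex_of_real (d i) \<cdot>\<^sub>v v" "qform A v = d i"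
proof -
  have U: "U \<in> carrier_mat n n" "U\<^sup>\<dagger> * U = 1\<^sub>m n"
    using S by (auto simp: spectral_form_def unitary_def)
  have e: "unit_vec n i \<in> carrier_vec n" by simp
  show v: "v \<in> carrier_vec n" using U by (simp add: v_def)
  have Uv: "U\<^sup>\<dagger> *\<^sub>v v = unit_vec n i"
    using U e by (simp add: v_def square_assoc_vec[where n = n, symmetric])
  show "v \<noteq> 0\<^sub>v n"
  proof
    assume "v = 0\<^sub>v n"
    then have "unit_vec n i = (0\<^sub>v n :: complex vec)" using Uv U by auto
    then show False using i by (metis index_unit_vec(1) index_zero_vec(1) zero_neq_one)
  qed
  have De: "rdiag n d *\<^sub>v unit_vec n i = complex_of_real (d i) \<cdot>\<^sub>v unit_vec n i"
    using i by (intro eq_vecI) (auto simp: mat_diag_def)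
  have "A *\<^sub>v v = U *\<^sub>v (rdiag n d *\<^sub>v (U\<^sup>\<dagger> *\<^sub>v v))"
    using S U v by (simp add: spectral_form_def square_assoc_vec[where n = n])
  then show "A *\<^sub>v v = complex_of_real (d i) \<cdot>\<^sub>v v"
    unfolding Uv De using U e by (simp add: v_def square_mult_smult_vec[where n = n])
  show "qform A v = d i"
    unfolding spectral_form_qform[OF S v] Uv
    using i by (simp add: if_distrib[of "\<lambda>x. x\<^sup>2"] if_distrib[of cmod] if_distrib[of "\<lambda>x. _ * x"] cong: if_cong)
qed

text \<open>The \<open>i\<close>-th eigenvalue is the value of the quadratic form at the \<open>i\<close>-th eigenvector.\<close>

lemma pos_def_spectral_form:
  assumes "pos_def n A"
  shows "\<exists>U d. spectral_form n A U d \<and> (\<forall>i j. i \<le> j \<longrightarrow> j < n \<longrightarrow> d j \<le> d i) \<and> (\<forall>i<n. 0 < d i)"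
proof -
  obtain U d where S: "spectral_form n A U d" "\<forall>i j. i \<le> j \<longrightarrow> j < n \<longrightarrow> d j \<le> d i"
    using hermitian_spectral_form[of A n] assms by (auto simp: pos_def_def)
  have "0 < d i" if "i < n" for i
    using spectral_form_eigenvector[OF S(1) that] assms
    by (metis pos_def_def qform_def)
  with S show ?thesis by blast
qed

lemma spectral_form_pos_def:
  assumes S: "spectral_form n A U d" and d: "\<And>i. i < n \<Longrightarrow> 0 < d i"
  shows "pos_def n A"
  unfolding pos_def_def
proof (intro conjI ballI impI)
  show "A \<in> carrier_mat n n" "A\<^sup>\<dagger> = A"
    using S by (auto simp: spectral_form_carrier spectral_form_hermitian)
  fix v :: "complex vec" assume v: "v \<in> carrier_vec n" "v \<noteq> 0\<^sub>v n"
  have U: "U \<in> carrier_mat n n" "U * U\<^sup>\<dagger> = 1\<^sub>m n"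
    using S by (auto simp: spectral_form_def unitary_carrier unitary_right)
  have "v = U *\<^sub>v (U\<^sup>\<dagger> *\<^sub>v v)"
    using U v by (simp add: square_assoc_vec[where n = n, symmetric])
  then have "U\<^sup>\<dagger> *\<^sub>v v \<noteq> 0\<^sub>v n"
    using U(1) v(2) by auto
  then obtain i where i: "i < n" "(U\<^sup>\<dagger> *\<^sub>v v) $ i \<noteq> 0"
    using U(1) v(1) by (metis carrier_vecD eq_vecI index_zero_vec(1) index_zero_vec(2) square_adjoint_carrier square_mult_vec_carrier)
  have "0 < qform A v"
    unfolding spectral_form_qform[OF S v(1)]
    using i d by (intro sum_pos2[of _ i]) (auto simp: less_imp_le)
  then show "0 < Re ((A *\<^sub>v v) \<bullet>c v)" by (simp add: qform_def)
qed

section \<open>Real powers\<close>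

text \<open>Functional calculus is well defined. The matrix \<open>W = V* U\<close> intertwines the two diagonals,
  \<open>W diag(d) = diag(e) W\<close>. Entrywise, \<open>W_ij d_j = e_i W_ij\<close>, so \<open>d_j = e_i\<close> wherever
  \<open>W_ij\<close> is nonzero, and \<open>W\<close> also intertwines \<open>diag(f d)\<close> and \<open>diag(f e)\<close>.\<close>

lemma spectral_form_apply_fun:
  fixes f :: "real \<Rightarrow> real"
  assumes A: "spectral_form n A U d" and B: "spectral_form n A V e"
  shows "U * rdiag n (\<lambda>i. f (d i)) * U\<^sup>\<dagger> = V * rdiag n (\<lambda>i. f (e i)) * V\<^sup>\<dagger>"
proof -
  have U: "U \<in> carrier_mat n n" "U\<^sup>\<dagger> * U = 1\<^sub>m n" "U * U\<^sup>\<dagger> = 1\<^sub>m n"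
    and V: "V \<in> carrier_mat n n" "V\<^sup>\<dagger> * V = 1\<^sub>m n" "V * V\<^sup>\<dagger> = 1\<^sub>m n"
    using A B by (auto simp: spectral_form_def unitary_carrier unitary_left unitary_right)
  define W where "W = V\<^sup>\<dagger> * U"
  have W: "W \<in> carrier_mat n n" using U V by (simp add: W_def)
  have "W * rdiag n d = V\<^sup>\<dagger> * (U * (rdiag n d * (U\<^sup>\<dagger> * U)))"
    using U V by (simp add: W_def square_assoc[where n = n])
  also have "\<dots> = V\<^sup>\<dagger> * (A * U)"
    using A U(1) by (simp add: spectral_form_def square_assoc[where n = n])
  also have "\<dots> = V\<^sup>\<dagger> * (V * (rdiag n e * (V\<^sup>\<dagger> * U)))"
    using B U(1) V(1) by (simp add: spectral_form_def square_assoc[where n = n])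
  also have "\<dots> = rdiag n e * W"
    using U V by (simp add: W_def left_cancel[where n = n])
  finally have comm: "W * rdiag n d = rdiag n e * W" .
  have "W * rdiag n (\<lambda>i. f (d i)) = rdiag n (\<lambda>i. f (e i)) * W"
  proof (rule eq_matI)
    fix i j assume "i < dim_row (rdiag n (\<lambda>i. f (e i)) * W)" "j < dim_col (rdiag n (\<lambda>i. f (e i)) * W)"
    then have ij: "i < n" "j < n" using W by (auto simp: mat_diag_def)
    have "W $$ (i, j) * complex_of_real (d j) = complex_of_real (e i) * W $$ (i, j)"
      using arg_cong[OF comm, of "\<lambda>M. M $$ (i, j)"] ij W
      by (simp add: mat_diag_mult_left[OF W] mat_diag_mult_right[OF W])
    then have "W $$ (i, j) = 0 \<or> d j = e i"
      by (metis mult.commute mult_cancel_left of_real_eq_iff)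
    then show "(W * rdiag n (\<lambda>i. f (d i))) $$ (i, j) = (rdiag n (\<lambda>i. f (e i)) * W) $$ (i, j)"
      using ij W by (auto simp: mat_diag_mult_left[OF W] mat_diag_mult_right[OF W])
  qed (use W in \<open>auto simp: mat_diag_def\<close>)
  then have "V * (W * rdiag n (\<lambda>i. f (d i)) * U\<^sup>\<dagger>) = V * (rdiag n (\<lambda>i. f (e i)) * W * U\<^sup>\<dagger>)"
    by simp
  then have "V * (V\<^sup>\<dagger> * (U * (rdiag n (\<lambda>i. f (d i)) * U\<^sup>\<dagger>))) =
      V * (rdiag n (\<lambda>i. f (e i)) * (V\<^sup>\<dagger> * (U * U\<^sup>\<dagger>)))"
    using U(1) V(1) by (simp add: W_def square_assoc[where n = n])
  then show ?thesis
    using U V by (simp add: left_cancel[where n = n] square_assoc[where n = n])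
qed

lemma spectral_form_mat_powr:
  assumes S: "spectral_form n A U d" and d: "\<And>i. i < n \<Longrightarrow> 0 \<le> d i"
  shows "spectral_form n (mat_powr A x) U (\<lambda>i. d i powr x)"
proof -
  have dim: "dim_row A = n" using spectral_form_carrier[OF S] by auto
  have "mat_powr A x = U * rdiag n (\<lambda>i. d i powr x) * U\<^sup>\<dagger>"
    unfolding mat_powr_def Let_def dim
  proof (rule the_equality)
    show "\<exists>V e. V \<in> carrier_mat n n \<and> V\<^sup>\<dagger> * V = 1\<^sub>m n \<and> (\<forall>i<n. 0 \<le> e i) \<and>
        A = V * rdiag n e * V\<^sup>\<dagger> \<and>
        U * rdiag n (\<lambda>i. d i powr x) * U\<^sup>\<dagger> = V * rdiag n (\<lambda>i. e i powr x) * V\<^sup>\<dagger>"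
      using S d by (intro exI[of _ U] exI[of _ d]) (simp add: spectral_form_def unitary_def)
  next
    fix P
    assume "\<exists>V e. V \<in> carrier_mat n n \<and> V\<^sup>\<dagger> * V = 1\<^sub>m n \<and> (\<forall>i<n. 0 \<le> e i) \<and>
        A = V * rdiag n e * V\<^sup>\<dagger> \<and> P = V * rdiag n (\<lambda>i. e i powr x) * V\<^sup>\<dagger>"
    then obtain V e where "spectral_form n A V e" "P = V * rdiag n (\<lambda>i. e i powr x) * V\<^sup>\<dagger>"
      unfolding spectral_form_def unitary_def by blast
    then show "P = U * rdiag n (\<lambda>i. d i powr x) * U\<^sup>\<dagger>"
      using spectral_form_apply_fun[OF S, of V e "\<lambda>c. c powr x"] by simp
  qed
  then show ?thesis using S by (simp add: spectral_form_def)
qed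

lemma spectral_form_cong:
  assumes "spectral_form n A U d" "\<And>i. i < n \<Longrightarrow> d i = e i"
  shows "spectral_form n A U e"
  using assms rdiag_cong[of n d e] by (simp add: spectral_form_def)

lemma spectral_form_unique: "spectral_form n A U d \<Longrightarrow> spectral_form n B U d \<Longrightarrow> A = B"
  by (simp add: spectral_form_def)

lemma spectral_form_one: "unitary n U \<Longrightarrow> spectral_form n (1\<^sub>m n) U (\<lambda>_. 1)"
  by (simp add: spectral_form_def unitary_right unitary_carrier)

lemma spectral_form_smult:
  assumes "spectral_form n A U d"
  shows "spectral_form n (complex_of_real c \<cdot>\<^sub>m A) U (\<lambda>i. c * d i)"
proof -
  have U: "U \<in> carrier_mat n n" using assms by (simp add: spectral_form_def unitary_carrier)
  have "complex_of_real c \<cdot>\<^sub>m (U * rdiag n d * U\<^sup>\<dagger>) = U * (complex_of_real c \<cdot>\<^sub>m rdiag n d) * U\<^sup>\<dagger>"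
    using U by (simp add: mult_smult_distrib[of _ n n _ n] mult_smult_assoc_mat[of _ n n _ n])
  also have "complex_of_real c \<cdot>\<^sub>m rdiag n d = rdiag n (\<lambda>i. c * d i)"
    by (rule eq_matI) (auto simp: mat_diag_def)
  finally show ?thesis using assms by (simp add: spectral_form_def)
qed

text \<open>All powers of a positive definite matrix are diagonal in one common eigenbasis. The algebra of
  real powers below is reduced by this to scalars.\<close>

lemma pos_def_powers:
  assumes "pos_def n A"
  obtains U d where "\<And>i. i < n \<Longrightarrow> 0 < d i" "spectral_form n A U d" 
    "\<And>x. spectral_form n (mat_powr A x) U (\<lambda>i. d i powr x)"
  using pos_def_spectral_form[OF assms] spectral_form_mat_powr[of n A]
  by (metis less_imp_le)

lemma pos_def_carrier: "pos_def n A \<Longrightarrow> A \<in> carrier_mat n n"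
  and pos_def_hermitian: "pos_def n A \<Longrightarrow> A\<^sup>\<dagger> = A"
  and pos_def_qform: "pos_def n A \<Longrightarrow> v \<in> carrier_vec n \<Longrightarrow> v \<noteq> 0\<^sub>v n \<Longrightarrow> 0 < qform A v"
  by (auto simp: pos_def_def qform_def)

context
  fixes n :: nat and A :: "complex mat"
  assumes pd: "pos_def n A"
begin

lemma mat_powr_pos_def: "pos_def n (mat_powr A x)"
  by (rule pos_def_powers[OF pd]) (metis powr_gt_zero spectral_form_pos_def less_irrefl)

lemma mat_powr_carrier: "mat_powr A x \<in> carrier_mat n n"
  using mat_powr_pos_def by (rule pos_def_carrier)

lemma mat_powr_hermitian: "(mat_powr A x)\<^sup>\<dagger> = mat_powr A x"
  using mat_powr_pos_def by (rule pos_def_hermitian)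

lemma mat_powr_mult: "mat_powr A x * mat_powr A y = mat_powr A (x + y)"
proof (rule pos_def_powers[OF pd])
  fix U d assume d: "\<And>i. i < n \<Longrightarrow> 0 < d i" and S: "\<And>x. spectral_form n (mat_powr A x) U (\<lambda>i. d i powr x)"
  show ?thesis
    using spectral_form_mult[OF S S, of x y] S[of "x + y"] spectral_form_unique
    by (fastforce simp: powr_add)
qed

lemma mat_powr_mult_left:
  "M \<in> carrier_mat n n \<Longrightarrow> mat_powr A x * (mat_powr A y * M) = mat_powr A (x + y) * M"
  by (simp add: square_assoc[where n = n, symmetric] mat_powr_carrier mat_powr_mult)

lemma mat_powr_mult_vec:
  "v \<in> carrier_vec n \<Longrightarrow> mat_powr A x *\<^sub>v (mat_powr A y *\<^sub>v v) = mat_powr A (x + y) *\<^sub>v v"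
  by (simp add: square_assoc_vec[where n = n, symmetric] mat_powr_carrier mat_powr_mult)

lemma mat_powr_zero: "mat_powr A 0 = 1\<^sub>m n"
proof (rule pos_def_powers[OF pd])
  fix U d assume d: "\<And>i. i < n \<Longrightarrow> 0 < d i" and S: "\<And>x. spectral_form n (mat_powr A x) U (\<lambda>i. d i powr x)"
  have "spectral_form n (mat_powr A 0) U (\<lambda>i. 1)"
    by (rule spectral_form_cong[OF S]) (use d in force)
  then show ?thesis
    using spectral_form_one spectral_form_unique by (metis spectral_form_def)
qed

lemma mat_powr_one: "mat_powr A 1 = A"
proof (rule pos_def_powers[OF pd])
  fix U d assume d: "\<And>i. i < n \<Longrightarrow> 0 < d i" and S: "\<And>x. spectral_form n (mat_powr A x) U (\<lambda>i. d i powr x)"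
    and A: "spectral_form n A U d"
  have "spectral_form n (mat_powr A 1) U d"
    by (rule spectral_form_cong[OF S]) (use d in force)
  then show ?thesis using A spectral_form_unique by blast
qed

lemma mat_powr_powr: "mat_powr (mat_powr A x) y = mat_powr A (x * y)"
proof (rule pos_def_powers[OF pd])
  fix U d assume d: "\<And>i. i < n \<Longrightarrow> 0 < d i" and S: "\<And>x. spectral_form n (mat_powr A x) U (\<lambda>i. d i powr x)"
  have "spectral_form n (mat_powr (mat_powr A x) y) U (\<lambda>i. (d i powr x) powr y)"
    by (rule spectral_form_mat_powr[OF S]) simp
  then show ?thesis
    using S[of "x * y"] spectral_form_unique by (fastforce simp: powr_powr)
qed

lemma mat_powr_smult:
  assumes "c > 0"
  shows "mat_powr (complex_of_real c \<cdot>\<^sub>m A) x = complex_of_real (c powr x) \<cdot>\<^sub>m mat_powr A x"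
proof (rule pos_def_powers[OF pd])
  fix U d assume d: "\<And>i. i < n \<Longrightarrow> 0 < d i" and S: "\<And>x. spectral_form n (mat_powr A x) U (\<lambda>i. d i powr x)"
    and A: "spectral_form n A U d"
  have "spectral_form n (mat_powr (complex_of_real c \<cdot>\<^sub>m A) x) U (\<lambda>i. (c * d i) powr x)"
    by (rule spectral_form_mat_powr[OF spectral_form_smult[OF A]]) (use d assms in \<open>simp add: less_imp_le\<close>)
  then have "spectral_form n (mat_powr (complex_of_real c \<cdot>\<^sub>m A) x) U (\<lambda>i. c powr x * d i powr x)"
    by (rule spectral_form_cong) (use d assms in \<open>simp add: powr_mult less_imp_le\<close>)
  then show ?thesis
    using spectral_form_smult[OF S] spectral_form_unique by blast
qed

end

lemma pos_def_smult:
  assumes "pos_def n A" "c > 0"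
  shows "pos_def n (complex_of_real c \<cdot>\<^sub>m A)"
  using pos_def_spectral_form[OF assms(1)] spectral_form_smult spectral_form_pos_def assms(2)
  by (metis mult_pos_pos)

lemma pos_def_congruence:
  assumes A: "pos_def n A" and K: "K \<in> carrier_mat n n" and L: "L \<in> carrier_mat n n" "L * K = 1\<^sub>m n"
  shows "pos_def n (K\<^sup>\<dagger> * A * K)"
  unfolding pos_def_def
proof (intro conjI ballI impI)
  note Ac = pos_def_carrier[OF A]
  show "K\<^sup>\<dagger> * A * K \<in> carrier_mat n n" "(K\<^sup>\<dagger> * A * K)\<^sup>\<dagger> = K\<^sup>\<dagger> * A * K"
    using Ac K pos_def_hermitian[OF A]
    by (simp_all add: adjoint_mult[of _ n n _ n] square_assoc[where n = n])
  fix v :: "complex vec" assume v: "v \<in> carrier_vec n" "v \<noteq> 0\<^sub>v n"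
  have "v = L *\<^sub>v (K *\<^sub>v v)"
    using K L v by (simp add: square_assoc_vec[where n = n, symmetric])
  then have "K *\<^sub>v v \<noteq> 0\<^sub>v n" using L(1) v(2) by auto
  then show "0 < Re ((K\<^sup>\<dagger> * A * K *\<^sub>v v) \<bullet>c v)"
    using pos_def_qform[OF A] qform_congruence[OF Ac K v(1)] K v(1)
    by (simp add: qform_def)
qed

lemma powr_congruence_pos_def:
  assumes "pos_def n A" "pos_def n B"
  shows "pos_def n (mat_powr A x * B * mat_powr A x)"
  using pos_def_congruence[OF assms(2) mat_powr_carrier[OF assms(1), of x] mat_powr_carrier[OF assms(1), of "- x"]]
  by (simp add: assms mat_powr_mult[where n = n] mat_powr_zero[where n = n] mat_powr_hermitian[where n = n])

section \<open>The Loewner order and the Loewner-Heinz inequality\<close>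

lemma loewner_le_powr_congruence:
  assumes "loewner_le n B C" "B \<in> carrier_mat n n" "C \<in> carrier_mat n n" "pos_def n A"
  shows "loewner_le n (mat_powr A x * B * mat_powr A x) (mat_powr A x * C * mat_powr A x)"
  using loewner_le_congruence[OF assms(2,3) mat_powr_carrier[OF assms(4)] assms(1), of x]
  by (simp add: mat_powr_hermitian[OF assms(4)])

text \<open>The hypothesis bounds the generalised eigenvalues of the pair \<open>(A, B)\<close>. They are the
  eigenvalues of \<open>H = B^(-1/2) A B^(-1/2)\<close>, so \<open>H \<le> I\<close>, and congruence by \<open>B^(1/2)\<close> gives
  \<open>A \<le> B\<close>. This turns order relations between inverses and powers into statements about single
  vectors.\<close>

lemma loewner_le_if_eigenvalues_le:
  assumes A: "A \<in> carrier_mat n n" "A\<^sup>\<dagger> = A" and B: "pos_def n B"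
    and ev: "\<And>l v. v \<in> carrier_vec n \<Longrightarrow> v \<noteq> 0\<^sub>v n \<Longrightarrow> A *\<^sub>v v = complex_of_real l \<cdot>\<^sub>v (B *\<^sub>v v) \<Longrightarrow> l \<le> 1"
  shows "loewner_le n A B"
proof -
  define R where "R = mat_powr B (1 / 2)"
  define S where "S = mat_powr B (- 1 / 2)"
  have RS: "R \<in> carrier_mat n n" "S \<in> carrier_mat n n" "R\<^sup>\<dagger> = R" "S\<^sup>\<dagger> = S" "R * S = 1\<^sub>m n"
    "S * R = 1\<^sub>m n" "R * R = B"
    by (simp_all add: R_def S_def mat_powr_carrier[OF B] mat_powr_hermitian[OF B] mat_powr_mult[OF B]
        mat_powr_zero[OF B] mat_powr_one[OF B])
  define H where "H = S * A * S"
  have H: "H \<in> carrier_mat n n" "H\<^sup>\<dagger> = H"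
    using A RS by (simp_all add: H_def adjoint_mult[of _ n n _ n] square_assoc[where n = n])
  obtain U d where Ud: "spectral_form n H U d"
    using hermitian_spectral_form[OF H] by blast
  have "d i \<le> 1" if i: "i < n" for i
  proof -
    define w where "w = U *\<^sub>v unit_vec n i"
    note w = spectral_form_eigenvector[OF Ud i, folded w_def]
    have SR: "R *\<^sub>v (S *\<^sub>v w) = w"
      using RS w by (simp add: square_assoc_vec[where n = n, symmetric])
    have "A *\<^sub>v (S *\<^sub>v w) = (R * (S * A)) *\<^sub>v (S *\<^sub>v w)"
      using RS A by (simp add: left_cancel[where n = n])
    also have "\<dots> = R *\<^sub>v (H *\<^sub>v w)"
      using RS A w by (simp add: H_def square_assoc_vec[where n = n])
    also have "\<dots> = complex_of_real (d i) \<cdot>\<^sub>v (R *\<^sub>v w)"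
      using RS w by (simp add: square_mult_smult_vec[where n = n])
    also have "R *\<^sub>v w = B *\<^sub>v (S *\<^sub>v w)"
      using RS(1,2) w SR by (simp add: RS(7)[symmetric] square_assoc_vec[where n = n])
    finally have "A *\<^sub>v (S *\<^sub>v w) = complex_of_real (d i) \<cdot>\<^sub>v (B *\<^sub>v (S *\<^sub>v w))" .
    moreover have "S *\<^sub>v w \<noteq> 0\<^sub>v n"
      using SR w RS(1) by auto
    ultimately show ?thesis
      using ev[of "S *\<^sub>v w" "d i"] RS w by simp
  qed
  then have "loewner_le n H (1\<^sub>m n)"
    unfolding loewner_le_def
    using spectral_form_qform[OF Ud] spectral_form_qform[OF spectral_form_one, of n U] Ud
      mult_right_mono[of _ 1 "(cmod _)\<^sup>2"]
    by (auto simp: spectral_form_def intro!: sum_mono)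
  then have "loewner_le n (R * H * R) (R * 1\<^sub>m n * R)"
    using loewner_le_congruence[OF H(1) one_carrier_mat RS(1)] RS by simp
  moreover have "R * H * R = A"
    using RS A by (simp add: H_def square_assoc[where n = n] left_cancel[where n = n])
  ultimately show ?thesis using RS by simp
qed

lemma cinner_self_qform:
  assumes "K \<in> carrier_mat n n" "v \<in> carrier_vec n"
  shows "Re ((K *\<^sub>v v) \<bullet>c (K *\<^sub>v v)) = qform (K\<^sup>\<dagger> * K) v"
  using qform_congruence[of "1\<^sub>m n" n K n v] assms by (simp add: qform_def)

lemma qform_eq_of_vec_eq:
  assumes "A *\<^sub>v v = complex_of_real l \<cdot>\<^sub>v (B *\<^sub>v v)" "B \<in> carrier_mat n n" "v \<in> carrier_vec n"
  shows "qform A v = l * qform B v"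
  using assms by (simp add: qform_def)

text \<open>If \<open>F^(-1) v = l C^(-1) v\<close> and \<open>w = C^(-1) v\<close>, then \<open>C w = l F w\<close>; pairing with \<open>w\<close> and
  using \<open>C \<le> F\<close> yields \<open>l \<le> 1\<close>.\<close>

lemma loewner_le_inverse:
  assumes C: "pos_def n C" and F: "pos_def n F" and le: "loewner_le n C F"
  shows "loewner_le n (mat_powr F (- 1)) (mat_powr C (- 1))"
proof (rule loewner_le_if_eigenvalues_le)
  fix l v assume v: "v \<in> carrier_vec n" "v \<noteq> 0\<^sub>v n"
    and eq: "mat_powr F (- 1) *\<^sub>v v = complex_of_real l \<cdot>\<^sub>v (mat_powr C (- 1) *\<^sub>v v)"
  define w where "w = mat_powr C (- 1) *\<^sub>v v"
  have w: "w \<in> carrier_vec n" using v mat_powr_carrier[OF C] by (simp add: w_def)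
  have Cw: "C *\<^sub>v w = v"
    using mat_powr_mult_vec[OF C v(1), of 1 "- 1"] v by (simp add: w_def mat_powr_one[OF C] mat_powr_zero[OF C])
  have w0: "w \<noteq> 0\<^sub>v n" using Cw v pos_def_carrier[OF C] by auto
  have "C *\<^sub>v w = F *\<^sub>v (mat_powr F (- 1) *\<^sub>v v)"
    using mat_powr_mult_vec[OF F v(1), of 1 "- 1"] v by (simp add: Cw mat_powr_one[OF F] mat_powr_zero[OF F])
  also have "\<dots> = complex_of_real l \<cdot>\<^sub>v (F *\<^sub>v w)"
    unfolding eq w_def[symmetric] using w pos_def_carrier[OF F] by (simp add: square_mult_smult_vec[where n = n])
  finally have "qform C w = l * qform F w"
    using qform_eq_of_vec_eq pos_def_carrier[OF F] w by blast
  then have "l * qform F w \<le> 1 * qform F w"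
    using le w unfolding loewner_le_def by (metis mult_1)
  then show "l \<le> 1"
    using pos_def_qform[OF F w w0] by (simp add: mult_le_cancel_right)
qed (simp_all add: mat_powr_carrier[OF F] mat_powr_hermitian[OF F] mat_powr_pos_def[OF C])

text \<open>This is Pedersen's argument. Let \<open>m = (x+y)/2\<close>, \<open>A^m v = l B^m v\<close> and
  \<open>u = B^((y-x)/2) v\<close>. Then \<open>l \<langle>B^y v, v\<rangle> = \<langle>A^m v, u\<rangle> = \<langle>A^(y/2) v, A^(x/2) u\<rangle>\<close>. The squared
  norms of the two vectors in the last inner product are at most \<open>\<langle>B^y v, v\<rangle>\<close> and
  \<open>\<langle>B^x u, u\<rangle>\<close>, and these two numbers are equal by the choice of \<open>u\<close>. Hence \<open>l \<le> 1\<close>.\<close>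

lemma loewner_heinz_midpoint:
  assumes A: "pos_def n A" and B: "pos_def n B"
    and x: "loewner_le n (mat_powr A x) (mat_powr B x)"
    and y: "loewner_le n (mat_powr A y) (mat_powr B y)"
  shows "loewner_le n (mat_powr A ((x + y) / 2)) (mat_powr B ((x + y) / 2))"
proof (rule loewner_le_if_eigenvalues_le)
  define m where "m = (x + y) / 2"
  fix l v assume v: "v \<in> carrier_vec n" "v \<noteq> 0\<^sub>v n"
    and "mat_powr A ((x + y) / 2) *\<^sub>v v = complex_of_real l \<cdot>\<^sub>v (mat_powr B ((x + y) / 2) *\<^sub>v v)"
  then have eq: "mat_powr A m *\<^sub>v v = complex_of_real l \<cdot>\<^sub>v (mat_powr B m *\<^sub>v v)" by (simp add: m_def)
  \<comment> \<open>The exponent is chosen so that \<open>B^(x/2) u = B^(y/2) v\<close>.\<close>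
  define u where "u = mat_powr B ((y - x) / 2) *\<^sub>v v"
  note car = mat_powr_carrier[OF A] mat_powr_carrier[OF B]
  have u: "u \<in> carrier_vec n" using v car by (simp add: u_def)
  have self: "Re ((mat_powr M (z / 2) *\<^sub>v w) \<bullet>c (mat_powr M (z / 2) *\<^sub>v w)) = qform (mat_powr M z) w"
    if "pos_def n M" "w \<in> carrier_vec n" for M z w
    using that by (simp add: cinner_self_qform[where n = n] mat_powr_carrier mat_powr_hermitian[where n = n] mat_powr_mult[where n = n])
  have split: "(mat_powr M z *\<^sub>v v) \<bullet>c u = (mat_powr M a *\<^sub>v v) \<bullet>c (mat_powr M b *\<^sub>v u)"
    if M: "pos_def n M" and z: "z = a + b" for M z a b
  proof -
    have "(mat_powr M z *\<^sub>v v) \<bullet>c u = (mat_powr M b *\<^sub>v (mat_powr M a *\<^sub>v v)) \<bullet>c u"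
      using v M by (simp add: mat_powr_mult_vec[where n = n] z add.commute)
    also have "\<dots> = (mat_powr M a *\<^sub>v v) \<bullet>c (mat_powr M b *\<^sub>v u)"
      using v u M mat_powr_carrier[OF M]
      by (subst cinner_adjoint[of _ n n]) (auto simp: mat_powr_hermitian[where n = n])
    finally show ?thesis .
  qed
  have "l * qform (mat_powr B y) v = Re ((mat_powr A m *\<^sub>v v) \<bullet>c u)"
  proof -
    have "(mat_powr B m *\<^sub>v v) \<bullet>c u = (mat_powr B (y / 2) *\<^sub>v v) \<bullet>c (mat_powr B (x / 2) *\<^sub>v u)"
      by (rule split[OF B]) (simp add: m_def field_simps)
    also have "mat_powr B (x / 2) *\<^sub>v u = mat_powr B (y / 2) *\<^sub>v v"
      using v by (simp add: u_def mat_powr_mult_vec[OF B]) (simp add: field_simps)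
    finally have "Re ((mat_powr B m *\<^sub>v v) \<bullet>c u) = qform (mat_powr B y) v"
      by (simp add: self[OF B v(1)])
    moreover have "(complex_of_real l \<cdot>\<^sub>v (mat_powr B m *\<^sub>v v)) \<bullet>c u = l * ((mat_powr B m *\<^sub>v v) \<bullet>c u)"
      using u v car[of m] by (subst smult_scalar_prod_distrib[of _ n]) auto
    ultimately show ?thesis
      unfolding eq by simp
  qed
  also have "(mat_powr A m *\<^sub>v v) \<bullet>c u = (mat_powr A (y / 2) *\<^sub>v v) \<bullet>c (mat_powr A (x / 2) *\<^sub>v u)"
    by (rule split[OF A]) (simp add: m_def field_simps)
  also have "2 * Re \<dots> \<le> qform (mat_powr A y) v + qform (mat_powr A x) u"
    using two_Re_cinner_le[of "mat_powr A (y / 2) *\<^sub>v v" n "mat_powr A (x / 2) *\<^sub>v u"] u v car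
    by (simp add: self[OF A])
  also have "\<dots> \<le> qform (mat_powr B y) v + qform (mat_powr B x) u"
    using x y u v by (simp add: loewner_le_def add_mono)
  also have "qform (mat_powr B x) u = qform (mat_powr B y) v"
  proof -
    have "mat_powr B (x / 2) *\<^sub>v u = mat_powr B (y / 2) *\<^sub>v v"
      using v by (simp add: u_def mat_powr_mult_vec[OF B]) (simp add: field_simps)
    then show ?thesis using self[OF B u, of x] self[OF B v(1), of y] by simp
  qed
  finally have "l * qform (mat_powr B y) v \<le> 1 * qform (mat_powr B y) v" by simp
  then show "l \<le> 1"
    using pos_def_qform[OF mat_powr_pos_def[OF B] v] by (simp add: mult_le_cancel_right)
qed (simp_all add: mat_powr_carrier[OF A] mat_powr_hermitian[OF A] mat_powr_pos_def[OF B])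

text \<open>Around a missing point there would be a largest gap of the closed set, with end points in the
  set, but the midpoint of the gap belongs to the set too.\<close>

lemma closed_midpoint_set_interval:
  fixes S :: "real set"
  assumes closed: "closed S" and S: "0 \<in> S" "1 \<in> S"
    and mid: "\<And>x y. x \<in> S \<Longrightarrow> y \<in> S \<Longrightarrow> (x + y) / 2 \<in> S"
    and x: "0 \<le> x" "x \<le> 1"
  shows "x \<in> S"
proof (rule ccontr)
  assume "x \<notin> S"
  have c: "compact (S \<inter> {0..x})" "compact (S \<inter> {x..1})"
    using compact_Int_closed[OF compact_Icc closed] by (simp_all only: Int_commute[of S])
  have ne: "S \<inter> {0..x} \<noteq> {}" "S \<inter> {x..1} \<noteq> {}"
    using S x by auto
  obtain a where a': "a \<in> S \<inter> {0..x}" "\<And>y. y \<in> S \<inter> {0..x} \<Longrightarrow> y \<le> a"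
    using compact_attains_sup[OF c(1) ne(1)] by blast
  obtain b where b': "b \<in> S \<inter> {x..1}" "\<And>y. y \<in> S \<inter> {x..1} \<Longrightarrow> b \<le> y"
    using compact_attains_inf[OF c(2) ne(2)] by blast
  have a: "a \<in> S" "a \<le> x" "\<And>y. y \<in> S \<Longrightarrow> 0 \<le> y \<Longrightarrow> y \<le> x \<Longrightarrow> y \<le> a"
    and b: "b \<in> S" "x \<le> b" "\<And>y. y \<in> S \<Longrightarrow> x \<le> y \<Longrightarrow> y \<le> 1 \<Longrightarrow> b \<le> y"
    and bounds: "0 \<le> a" "b \<le> 1"
    using a' b' by auto
  have "a \<noteq> x" "b \<noteq> x" using a(1) b(1) \<open>x \<notin> S\<close> by auto
  then have "a < x" "x < b" using a(2) b(2) by simp_all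
  moreover have "(a + b) / 2 \<in> S" using mid a b by blast
  ultimately show False
    using a(3)[of "(a + b) / 2"] b(3)[of "(a + b) / 2"] bounds
    by (cases "(a + b) / 2 \<le> x") auto
qed

lemma continuous_on_qform_mat_powr:
  assumes "pos_def n A" "v \<in> carrier_vec n"
  shows "continuous_on UNIV (\<lambda>x. qform (mat_powr A x) v)"
proof (rule pos_def_powers[OF assms(1)])
  fix U d assume d: "\<And>i. i < n \<Longrightarrow> 0 < d i"
    and S: "\<And>x. spectral_form n (mat_powr A x) U (\<lambda>i. d i powr x)"
  show ?thesis
    unfolding spectral_form_qform[OF S assms(2)]
    using d by (fastforce intro!: continuous_intros)
qed

text \<open>The exponents for which the inequality holds form a closed set which contains 0 and 1 and is
  closed under midpoints.\<close>

lemma loewner_heinz: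
  assumes A: "pos_def n A" and B: "pos_def n B" and le: "loewner_le n A B"
    and x: "0 \<le> x" "x \<le> 1"
  shows "loewner_le n (mat_powr A x) (mat_powr B x)"
proof -
  define S where "S = {y. loewner_le n (mat_powr A y) (mat_powr B y)}"
  have "S = (\<Inter>v\<in>carrier_vec n. {y. qform (mat_powr A y) v \<le> qform (mat_powr B y) v})"
    by (auto simp: S_def loewner_le_def)
  then have "closed S"
    using A B by (auto intro!: closed_INT closed_Collect_le continuous_on_qform_mat_powr)
  then have "x \<in> S"
  proof (rule closed_midpoint_set_interval)
    show "0 \<in> S" "1 \<in> S"
      using le by (simp_all add: S_def mat_powr_zero[OF A] mat_powr_zero[OF B] mat_powr_one[OF A]
          mat_powr_one[OF B] loewner_le_refl)
  qed (use x loewner_heinz_midpoint[OF A B] in \<open>auto simp: S_def\<close>)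
  then show ?thesis by (simp add: S_def)
qed

section \<open>The largest eigenvalue\<close>

text \<open>From \<open>K* K = U diag(d) U*\<close> one gets the polar decomposition of \<open>K\<close>: the matrix
  \<open>V = K U diag(d)^(-1/2)\<close> is unitary and \<open>K K* = V diag(d) V*\<close>. The two outer factors
  \<open>d^(-1/2)\<close> account for the exponent \<open>p - 1\<close>.\<close>

lemma mat_powr_gram:
  assumes K: "K \<in> carrier_mat n n" and L: "L \<in> carrier_mat n n" "L * K = 1\<^sub>m n"
  shows "mat_powr (K * K\<^sup>\<dagger>) p = K * mat_powr (K\<^sup>\<dagger> * K) (p - 1) * K\<^sup>\<dagger>"
proof -
  have one: "pos_def n (1\<^sub>m n)"
    by (auto simp: pos_def_def cinner_self_pos)
  have pd: "pos_def n (K\<^sup>\<dagger> * K)"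
    using pos_def_congruence[OF one K L] K by simp
  obtain U d where d: "\<And>i. i < n \<Longrightarrow> 0 < d i" and S: "spectral_form n (K\<^sup>\<dagger> * K) U d"
    and P: "\<And>x. spectral_form n (mat_powr (K\<^sup>\<dagger> * K) x) U (\<lambda>i. d i powr x)"
    by (rule pos_def_powers[OF pd]) (rule that)
  have U: "U \<in> carrier_mat n n" "U\<^sup>\<dagger> * U = 1\<^sub>m n" "U * U\<^sup>\<dagger> = 1\<^sub>m n"
    using S by (auto simp: spectral_form_def unitary_carrier unitary_left unitary_right)
  have half: "c powr (- 1 / 2) * (c powr x * c powr (- 1 / 2)) = c powr (x - 1)" if "c > 0" for c x :: real
  proof -
    have "c powr (- 1 / 2) * (c powr x * c powr (- 1 / 2)) = c powr (- 1 / 2 + (x + - 1 / 2))"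
      by (simp only: powr_add)
    also have "- 1 / 2 + (x + - 1 / 2) = x - 1" by linarith
    finally show ?thesis .
  qed
  \<comment> \<open>The inverse of the modulus of \<open>K\<close> in the eigenbasis of \<open>K* K\<close>.\<close>
  define R where "R = rdiag n (\<lambda>i. d i powr (- 1 / 2))"
  have R: "R \<in> carrier_mat n n" "R\<^sup>\<dagger> = R" by (simp_all add: R_def)
  define V where "V = K * U * R"
  have V: "V \<in> carrier_mat n n" using K U R by (simp add: V_def)
  have KK: "K\<^sup>\<dagger> * (K * M) = U * (rdiag n d * (U\<^sup>\<dagger> * M))" if "M \<in> carrier_mat n n" for M
  proof -
    have "K\<^sup>\<dagger> * (K * M) = (K\<^sup>\<dagger> * K) * M"
      using K that by (simp add: square_assoc[where n = n])
    also have "K\<^sup>\<dagger> * K = U * rdiag n d * U\<^sup>\<dagger>"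
      using S by (simp add: spectral_form_def)
    finally show ?thesis
      using U(1) that by (simp add: square_assoc[where n = n])
  qed
  have "V\<^sup>\<dagger> * V = R * (U\<^sup>\<dagger> * (K\<^sup>\<dagger> * (K * (U * R))))"
    using K U(1) R by (simp add: V_def adjoint_mult[of _ n n _ n] square_assoc[where n = n])
  also have "\<dots> = R * (U\<^sup>\<dagger> * (U * (rdiag n d * (U\<^sup>\<dagger> * (U * R)))))"
    using U(1) R by (simp add: KK)
  also have "\<dots> = R * (rdiag n d * R)"
    using U R by (simp add: left_cancel[where n = n])
  also have "\<dots> = rdiag n (\<lambda>i. 1)"
  proof -
    have "d i powr (- 1 / 2) * (d i * d i powr (- 1 / 2)) = 1" if "i < n" for i
      using half[OF d[OF that], of 1] d[OF that] by simp
    then have "rdiag n (\<lambda>i. d i powr (- 1 / 2) * (d i * d i powr (- 1 / 2))) = rdiag n (\<lambda>i. 1)"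
      by (rule rdiag_cong)
    then show ?thesis by (simp add: R_def)
  qed
  finally have "unitary n V" using V by (simp add: unitary_def)
  moreover have conj: "V * rdiag n (\<lambda>i. d i powr x) * V\<^sup>\<dagger> = K * mat_powr (K\<^sup>\<dagger> * K) (x - 1) * K\<^sup>\<dagger>" for x
  proof -
    have "V * rdiag n (\<lambda>i. d i powr x) * V\<^sup>\<dagger> =
        K * (U * ((R * (rdiag n (\<lambda>i. d i powr x) * R)) * (U\<^sup>\<dagger> * K\<^sup>\<dagger>)))"
      using K U(1) R by (simp add: V_def adjoint_mult[of _ n n _ n] square_assoc[where n = n])
    also have "R * (rdiag n (\<lambda>i. d i powr x) * R) = rdiag n (\<lambda>i. d i powr (x - 1))"
    proof -
      have "d i powr (- 1 / 2) * (d i powr x * d i powr (- 1 / 2)) = d i powr (x - 1)" if "i < n" for i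
        using half[OF d[OF that]] .
      then have "rdiag n (\<lambda>i. d i powr (- 1 / 2) * (d i powr x * d i powr (- 1 / 2))) =
          rdiag n (\<lambda>i. d i powr (x - 1))" by (intro rdiag_cong)
      then show ?thesis by (simp add: R_def)
    qed
    finally show ?thesis
      using P[of "x - 1"] K U(1) by (simp add: spectral_form_def square_assoc[where n = n])
  qed
  moreover have "K * K\<^sup>\<dagger> = V * rdiag n d * V\<^sup>\<dagger>"
  proof -
    have "rdiag n d = rdiag n (\<lambda>i. d i powr 1)"
      using d by (intro rdiag_cong) (simp add: less_imp_le)
    then show ?thesis
      using conj[of 1] K by (simp add: mat_powr_zero[OF pd])
  qed
  ultimately have "spectral_form n (K * K\<^sup>\<dagger>) V d"
    by (simp add: spectral_form_def)
  from spectral_form_mat_powr[OF this, of p] d conj[of p] show ?thesis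
    by (simp add: spectral_form_def less_imp_le)
qed

text \<open>With \<open>K = D^(a/2) C^(t/2)\<close> the left-hand side is \<open>(K K*)^p = K (K* K)^(p-1) K*\<close>. The
  hypothesis gives \<open>D \<le> C^(-1)\<close>, hence \<open>D^a \<le> C^(-a)\<close>, \<open>K* K \<le> C^(t-a)\<close> and
  \<open>(K* K)^(p-1) \<le> C^((t-a)(p-1))\<close>. The exponents of \<open>C\<close> add up to
  \<open>\<tau> = t + (t-a)(p-1)\<close>, and \<open>C^\<tau> \<le> D^(-\<tau>)\<close> removes \<open>C\<close> altogether.\<close>

lemma furuta_type_inequality:
  assumes C: "pos_def n C" and D: "pos_def n D" and le: "loewner_le n C (mat_powr D (- 1))"
    and p: "1 \<le> p" "p \<le> 2" and a: "0 \<le> a" "a \<le> 1"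
    and tau: "\<tau> = t * p - a * (p - 1)" "0 \<le> \<tau>" "\<tau> \<le> 1"
  shows "loewner_le n (mat_powr (mat_powr D (a / 2) * mat_powr C t * mat_powr D (a / 2)) p)
    (mat_powr D (a - \<tau>))"
proof -
  note car = mat_powr_carrier[OF C] mat_powr_carrier[OF D]
  note herm = mat_powr_hermitian[OF C] mat_powr_hermitian[OF D]
  define K where "K = mat_powr D (a / 2) * mat_powr C (t / 2)"
  define L where "L = mat_powr C (- t / 2) * mat_powr D (- a / 2)"
  have K: "K \<in> carrier_mat n n" "L \<in> carrier_mat n n" using car by (simp_all add: K_def L_def)
  have LK: "L * K = 1\<^sub>m n"
    using car by (simp add: K_def L_def square_assoc[where n = n] mat_powr_mult_left[OF D]
        mat_powr_mult[OF C] mat_powr_zero[OF C] mat_powr_zero[OF D])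
  have KH: "K\<^sup>\<dagger> = mat_powr C (t / 2) * mat_powr D (a / 2)"
    using car herm by (simp add: K_def adjoint_mult[of _ n n _ n])
  have KK: "K * K\<^sup>\<dagger> = mat_powr D (a / 2) * mat_powr C t * mat_powr D (a / 2)"
    unfolding KH using car by (simp add: K_def square_assoc[where n = n] mat_powr_mult_left[OF C])
  have KK': "K\<^sup>\<dagger> * K = mat_powr C (t / 2) * mat_powr D a * mat_powr C (t / 2)"
    unfolding KH using car by (simp add: K_def square_assoc[where n = n] mat_powr_mult_left[OF D])
  have D_le: "loewner_le n (mat_powr D a) (mat_powr C (- a))"
  proof -
    have "loewner_le n (mat_powr (mat_powr D (- 1)) (- 1)) (mat_powr C (- 1))"
      by (rule loewner_le_inverse[OF C mat_powr_pos_def[OF D] le])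
    then have "loewner_le n D (mat_powr C (- 1))"
      by (simp add: mat_powr_powr[OF D] mat_powr_one[OF D])
    from loewner_heinz[OF D mat_powr_pos_def[OF C] this a] show ?thesis
      by (simp add: mat_powr_powr[OF C])
  qed
  have "loewner_le n (K\<^sup>\<dagger> * K) (mat_powr C (t - a))"
    using loewner_le_powr_congruence[OF D_le car(2) car(1) C, of "t / 2"] car
    by (simp add: KK' mat_powr_mult[OF C])
  from loewner_heinz[OF _ mat_powr_pos_def[OF C] this, of "p - 1"]
  have "loewner_le n (mat_powr (K\<^sup>\<dagger> * K) (p - 1)) (mat_powr C ((t - a) * (p - 1)))"
    using p powr_congruence_pos_def[OF C mat_powr_pos_def[OF D]]
    by (simp add: KK' mat_powr_powr[OF C])
  then have "loewner_le n (K * mat_powr (K\<^sup>\<dagger> * K) (p - 1) * K\<^sup>\<dagger>) (K * mat_powr C ((t - a) * (p - 1)) * K\<^sup>\<dagger>)"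
    using loewner_le_congruence[OF _ car(1), of "mat_powr (K\<^sup>\<dagger> * K) (p - 1)" "K\<^sup>\<dagger>" n] K
      mat_powr_carrier[OF powr_congruence_pos_def[OF C mat_powr_pos_def[OF D]]]
    by (simp add: KK')
  also have "K * mat_powr C ((t - a) * (p - 1)) * K\<^sup>\<dagger> = mat_powr D (a / 2) * mat_powr C \<tau> * mat_powr D (a / 2)"
  proof -
    have "t / 2 + ((t - a) * (p - 1) + t / 2) = \<tau>"
      by (simp add: tau(1) algebra_simps)
    then show ?thesis
      unfolding KH using car
      by (simp add: K_def square_assoc[where n = n] mat_powr_mult_left[OF C] add.assoc)
  qed
  finally have 1: "loewner_le n (mat_powr (K * K\<^sup>\<dagger>) p) (mat_powr D (a / 2) * mat_powr C \<tau> * mat_powr D (a / 2))"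
    by (simp add: mat_powr_gram[OF K LK])
  have "loewner_le n (mat_powr C \<tau>) (mat_powr D (- \<tau>))"
    using loewner_heinz[OF C mat_powr_pos_def[OF D] le tau(2,3)] by (simp add: mat_powr_powr[OF D])
  from loewner_le_powr_congruence[OF this car(1) car(2) D, of "a / 2"]
  have 2: "loewner_le n (mat_powr D (a / 2) * mat_powr C \<tau> * mat_powr D (a / 2)) (mat_powr D (a - \<tau>))"
    by (simp add: mat_powr_mult[OF D])
  show ?thesis
    using loewner_le_trans[OF 1 2] by (simp add: KK)
qed

text \<open>If \<open>P Q v = l v\<close> and \<open>u = Q v\<close>, then \<open>P u = l Q^(-1) u\<close>, and
  \<open>P \<le> W \<le> Q^(-1)\<close>.\<close>

lemma eigenvalue_mult_le_one:
  assumes P: "P \<in> carrier_mat n n" and Q: "pos_def n Q" and W: "pos_def n W"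
    and PW: "loewner_le n P W" and QW: "loewner_le n Q (mat_powr W (- 1))"
    and v: "v \<in> carrier_vec n" "v \<noteq> 0\<^sub>v n" and eq: "(P * Q) *\<^sub>v v = complex_of_real l \<cdot>\<^sub>v v"
  shows "l \<le> 1"
proof -
  note Qc = pos_def_carrier[OF Q]
  define u where "u = Q *\<^sub>v v"
  have u: "u \<in> carrier_vec n" using Qc v by (simp add: u_def)
  have Qu: "mat_powr Q (- 1) *\<^sub>v u = v"
    using mat_powr_mult_vec[OF Q v(1), of "- 1" 1] v by (simp add: u_def mat_powr_one[OF Q] mat_powr_zero[OF Q])
  have u0: "u \<noteq> 0\<^sub>v n"
    using Qu v mat_powr_carrier[OF Q] by auto
  have "P *\<^sub>v u = complex_of_real l \<cdot>\<^sub>v (mat_powr Q (- 1) *\<^sub>v u)"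
    unfolding Qu using eq P Qc v by (simp add: u_def square_assoc_vec[where n = n])
  then have "qform P u = l * qform (mat_powr Q (- 1)) u"
    using qform_eq_of_vec_eq mat_powr_carrier[OF Q] u by blast
  moreover have "loewner_le n W (mat_powr Q (- 1))"
    using loewner_le_inverse[OF Q mat_powr_pos_def[OF W] QW]
    by (simp add: mat_powr_powr[OF W] mat_powr_one[OF W])
  then have "loewner_le n P (mat_powr Q (- 1))"
    using PW loewner_le_trans by blast
  ultimately have "l * qform (mat_powr Q (- 1)) u \<le> 1 * qform (mat_powr Q (- 1)) u"
    using u unfolding loewner_le_def by (metis mult_1)
  then show ?thesis
    using pos_def_qform[OF mat_powr_pos_def[OF Q] u u0] by (simp add: mult_le_cancel_right)
qed

text \<open>The bounds for the two factors, \<open>D^(a-\<tau>)\<close> and \<open>D^((1-a)-(1-\<tau>))\<close>, are inverse to each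
  other.\<close>

lemma top_eigenvalue_bound_one:
  assumes C: "pos_def n C" and D: "pos_def n D" and le: "loewner_le n C (mat_powr D (- 1))"
    and p: "1 \<le> p" "p \<le> 2" and a: "0 \<le> a" "a \<le> 1"
    and t: "a * (p - 1) \<le> t * p" "t * p \<le> a * (p - 1) + 1"
    and v: "v \<in> carrier_vec n" "v \<noteq> 0\<^sub>v n"
    and eq: "(mat_powr (mat_powr D (a / 2) * mat_powr C t * mat_powr D (a / 2)) p *
      mat_powr (mat_powr D ((1 - a) / 2) * mat_powr C (1 - t) * mat_powr D ((1 - a) / 2)) p) *\<^sub>v v =
      complex_of_real l \<cdot>\<^sub>v v"
  shows "l \<le> 1"
proof (rule eigenvalue_mult_le_one[OF _ _ _ _ _ v eq])
  define \<tau> where "\<tau> = t * p - a * (p - 1)"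
  have pdX: "pos_def n (mat_powr D x * mat_powr C y * mat_powr D x)" for x y
    by (rule powr_congruence_pos_def[OF D mat_powr_pos_def[OF C]])
  show "mat_powr (mat_powr D (a / 2) * mat_powr C t * mat_powr D (a / 2)) p \<in> carrier_mat n n"
    by (rule mat_powr_carrier[OF pdX])
  show "pos_def n (mat_powr (mat_powr D ((1 - a) / 2) * mat_powr C (1 - t) * mat_powr D ((1 - a) / 2)) p)"
    by (rule mat_powr_pos_def[OF pdX])
  show "pos_def n (mat_powr D (a - \<tau>))"
    by (rule mat_powr_pos_def[OF D])
  show "loewner_le n (mat_powr (mat_powr D (a / 2) * mat_powr C t * mat_powr D (a / 2)) p) (mat_powr D (a - \<tau>))"
    by (rule furuta_type_inequality[OF C D le p a]) (use t in \<open>auto simp: \<tau>_def\<close>)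
  have "loewner_le n (mat_powr (mat_powr D ((1 - a) / 2) * mat_powr C (1 - t) * mat_powr D ((1 - a) / 2)) p)
      (mat_powr D ((1 - a) - (1 - \<tau>)))"
    by (rule furuta_type_inequality[OF C D le p]) (use t a in \<open>auto simp: \<tau>_def algebra_simps\<close>)
  then show "loewner_le n (mat_powr (mat_powr D ((1 - a) / 2) * mat_powr C (1 - t) * mat_powr D ((1 - a) / 2)) p)
      (mat_powr (mat_powr D (a - \<tau>)) (- 1))"
    by (simp add: mat_powr_powr[OF D])
qed

section \<open>The Cauchy-Binet formula\<close>

text \<open>The \<open>k\<close>-element subsets of \<open>{..<n}\<close>, each represented by its increasing enumeration, so that
  minors get a definite sign.\<close>

definition increasing_lists :: "nat \<Rightarrow> nat \<Rightarrow> nat list set" where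
  "increasing_lists n k = {I. length I = k \<and> sorted_wrt (<) I \<and> set I \<subseteq> {..<n}}"

lemma finite_increasing_lists: "finite (increasing_lists n k)"
  by (rule finite_subset[OF _ finite_lists_length_eq[of "{..<n}" k]]) (auto simp: increasing_lists_def)

lemma increasing_listsD:
  assumes "I \<in> increasing_lists n k"
  shows "length I = k" "sorted_wrt (<) I" "distinct I" "set I \<subseteq> {..<n}" "\<And>a. a < k \<Longrightarrow> I ! a < n"
  using assms by (auto simp: increasing_lists_def strict_sorted_iff dest: nth_mem)

lemma increasing_lists_nth_ge:
  assumes "I \<in> increasing_lists n k" "a < k"
  shows "a \<le> I ! a"
  using assms(2)
proof (induction a)
  case (Suc a)
  then have "I ! a < I ! Suc a"
    using increasing_listsD[OF assms(1)] by (auto intro: sorted_wrt_nth_less)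
  with Suc show ?case by simp
qed simp

lemma increasing_lists_eqI:
  assumes "I \<in> increasing_lists n k" "J \<in> increasing_lists n k" "set I = set J"
  shows "I = J"
  using assms by (auto simp: increasing_lists_def intro: strict_sorted_equal)

definition minor_mat :: "'a mat \<Rightarrow> nat list \<Rightarrow> nat list \<Rightarrow> 'a mat" where
  "minor_mat M I J = mat (length I) (length J) (\<lambda>(a, b). M $$ (I ! a, J ! b))"

lemma minor_mat_carrier: "minor_mat M I J \<in> carrier_mat (length I) (length J)"
  by (simp add: minor_mat_def)

lemma det_rows_noninjective:
  fixes r :: "nat \<Rightarrow> 'a :: comm_ring_1 vec"
  assumes "\<not> inj_on f {0..<k}" "\<And>a. a < k \<Longrightarrow> r (f a) \<in> carrier_vec k"
  shows "det (mat\<^sub>r k k (\<lambda>a. r (f a))) = 0"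
proof -
  obtain a b where ab: "a < k" "b < k" "a \<noteq> b" "f a = f b"
    using assms(1) by (auto simp: inj_on_def)
  show ?thesis
    by (rule det_identical_rows[of _ k a b]) (use ab assms in auto)
qed

text \<open>An injective choice of \<open>k\<close> indices is a \<open>k\<close>-subset together with an ordering of it. The
  functions in \<open>F\<close> are the identity outside \<open>{0..<k}\<close>, as in the expansion of a determinant whose
  rows are sums.\<close>

lemma bij_betw_factor_injection:
  fixes n k :: nat
  defines "P \<equiv> {p. p permutes {0..<k}}"
  defines "F \<equiv> {f. (\<forall>i\<in>{0..<k}. f i \<in> {0..<n}) \<and> (\<forall>i. i \<notin> {0..<k} \<longrightarrow> f i = i) \<and> inj_on f {0..<k}}"
  shows "bij_betw (\<lambda>(S, p) a. if a < k then S ! p a else a) (increasing_lists n k \<times> P) F"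
  unfolding bij_betw_def
proof
  let ?g = "\<lambda>(S, p) a. if a < k then S ! p a else a"
  have p_less: "p a < k" if "p \<in> P" "a < k" for p a
    using permutes_in_image[of p "{0..<k}" a] that by (auto simp: P_def)
  have image: "(\<lambda>a. if a < k then S ! p a else a) ` {0..<k} = set S" if "S \<in> increasing_lists n k" "p \<in> P" for S p
  proof -
    have "(\<lambda>a. if a < k then S ! p a else a) ` {0..<k} = (!) S ` (p ` {0..<k})"
      by (auto simp: image_iff)
    also have "p ` {0..<k} = {0..<k}"
      using that by (simp add: P_def permutes_image)
    also have "(!) S ` {0..<k} = set S"
      using increasing_listsD(1)[OF that(1)] by (auto simp: set_conv_nth)
    finally show ?thesis .
  qed
  show "inj_on ?g (increasing_lists n k \<times> P)"
  proof (rule inj_onI, clarify)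
    fix S p T q
    assume S: "S \<in> increasing_lists n k" "p \<in> P" and T: "T \<in> increasing_lists n k" "q \<in> P"
      and eq: "(\<lambda>a. if a < k then S ! p a else a) = (\<lambda>a. if a < k then T ! q a else a)"
    have ST: "S = T"
      using image[OF S] image[OF T] increasing_lists_eqI[OF S(1) T(1)] unfolding eq by simp
    have "p a = q a" for a
    proof (cases "a < k")
      case True
      then have "S ! p a = S ! q a" using fun_cong[OF eq, of a] ST by simp
      then show ?thesis
        using p_less[OF S(2) True] p_less[OF T(2) True] increasing_listsD(1,3)[OF S(1)]
        by (simp add: nth_eq_iff_index_eq)
    next
      case False
      then show ?thesis using S T by (simp add: P_def permutes_def)
    qed
    then show "S = T \<and> p = q" using ST by blast
  qed
  show "?g ` (increasing_lists n k \<times> P) = F"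
  proof (intro equalityI subsetI)
    fix f assume "f \<in> ?g ` (increasing_lists n k \<times> P)"
    then obtain S p where S: "S \<in> increasing_lists n k" "p \<in> P" and f: "f = (\<lambda>a. if a < k then S ! p a else a)"
      by auto
    have "inj_on f {0..<k}"
    proof (rule inj_onI)
      fix a b assume ab: "a \<in> {0..<k}" "b \<in> {0..<k}" "f a = f b"
      then have "p a = p b"
        using f p_less[OF S(2)] increasing_listsD[OF S(1)] by (simp add: nth_eq_iff_index_eq)
      then show "a = b" using permutes_inj[of p "{0..<k}"] S(2) by (auto simp: P_def dest: injD)
    qed
    then show "f \<in> F"
      using f p_less[OF S(2)] increasing_listsD(5)[OF S(1)] by (auto simp: F_def)
  next
    fix f assume f: "f \<in> F"
    then have inj: "inj_on f {0..<k}" by (simp add: F_def)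
    define S where "S = sorted_list_of_set (f ` {0..<k})"
    have S: "S \<in> increasing_lists n k" "set S = f ` {0..<k}"
      using f inj by (auto simp: increasing_lists_def S_def F_def card_image)
    have "\<exists>b. b < k \<and> S ! b = f a" if "a < k" for a
    proof -
      have "f a \<in> set S" using that S(2) by simp
      then show ?thesis using increasing_listsD(1)[OF S(1)] by (auto simp: in_set_conv_nth)
    qed
    then have "\<forall>a. \<exists>b. a < k \<longrightarrow> b < k \<and> S ! b = f a" by blast
    from choice[OF this] obtain q where q: "\<And>a. a < k \<Longrightarrow> q a < k \<and> S ! q a = f a" by blast
    define p where "p a = (if a < k then q a else a)" for a
    have "inj_on p {0..<k}"
    proof (rule inj_onI)
      fix a b assume ab: "a \<in> {0..<k}" "b \<in> {0..<k}" "p a = p b"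
      then have "f a = f b" using q[of a] q[of b] by (simp add: p_def)
      then show "a = b" using ab inj by (simp add: inj_on_eq_iff)
    qed
    moreover have "p ` {0..<k} \<subseteq> {0..<k}" using q by (auto simp: p_def)
    ultimately have "bij_betw p {0..<k} {0..<k}"
      by (simp add: bij_betw_def endo_inj_surj)
    then have "p permutes {0..<k}" by (rule bij_imp_permutes) (auto simp: p_def)
    then have "(S, p) \<in> increasing_lists n k \<times> P" using S by (simp add: P_def)
    moreover have "f = ?g (S, p)"
      using q f by (auto simp: p_def F_def)
    ultimately show "f \<in> ?g ` (increasing_lists n k \<times> P)" by blast
  qed
qed

text \<open>Each row of the minor of \<open>A B\<close> is a combination of rows of \<open>B\<close>. Expanding the determinant by
  multilinearity gives a sum over all choices \<open>f\<close> of one row of \<open>B\<close> for each index.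
  Choices with a repetition contribute nothing; the others are a subset \<open>S\<close> followed by a
  permutation, and summing over the permutations reassembles the minor of \<open>A\<close> with columns
  \<open>S\<close>.\<close>

theorem cauchy_binet:
  fixes A B :: "'a :: comm_ring_1 mat"
  assumes A: "A \<in> carrier_mat m n" and B: "B \<in> carrier_mat n l"
    and I: "length I = k" "set I \<subseteq> {..<m}" and J: "length J = k" "set J \<subseteq> {..<l}"
  shows "det (minor_mat (A * B) I J) =
    (\<Sum>S\<in>increasing_lists n k. det (minor_mat A I S) * det (minor_mat B S J))"
proof -
  have Ia: "I ! a < m" if "a < k" for a using I that nth_mem by fastforce
  have Ja: "J ! a < l" if "a < k" for a using J that nth_mem by fastforce
  \<comment> \<open>The row \<open>c\<close> of \<open>B\<close>, restricted to the columns \<open>J\<close>.\<close>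
  define r where "r c = vec k (\<lambda>b. B $$ (c, J ! b))" for c
  have r: "r c \<in> carrier_vec k" for c by (simp add: r_def)
  define G where "G f = (\<Prod>a\<in>{0..<k}. A $$ (I ! a, f a)) * det (mat\<^sub>r k k (\<lambda>a. r (f a)))" for f
  define F where "F = {f. (\<forall>i\<in>{0..<k}. f i \<in> {0..<n}) \<and> (\<forall>i. i \<notin> {0..<k} \<longrightarrow> f i = i)}"
  define F' where "F' = {f. (\<forall>i\<in>{0..<k}. f i \<in> {0..<n}) \<and> (\<forall>i. i \<notin> {0..<k} \<longrightarrow> f i = i) \<and> inj_on f {0..<k}}"
  define P where "P = {p. p permutes {0..<k}}"
  have finF: "finite F"
    unfolding F_def by (rule finite_bounded_functions) auto
  have "minor_mat (A * B) I J =
      mat\<^sub>r k k (\<lambda>a. finsum_vec TYPE('a) k (\<lambda>c. A $$ (I ! a, c) \<cdot>\<^sub>v r c) {0..<n})"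
  proof (rule eq_matI)
    fix a b
    assume "a < dim_row (mat\<^sub>r k k (\<lambda>a. finsum_vec TYPE('a) k (\<lambda>c. A $$ (I ! a, c) \<cdot>\<^sub>v r c) {0..<n}))"
      "b < dim_col (mat\<^sub>r k k (\<lambda>a. finsum_vec TYPE('a) k (\<lambda>c. A $$ (I ! a, c) \<cdot>\<^sub>v r c) {0..<n}))"
    then have ab: "a < k" "b < k" by auto
    show "minor_mat (A * B) I J $$ (a, b) =
        mat\<^sub>r k k (\<lambda>a. finsum_vec TYPE('a) k (\<lambda>c. A $$ (I ! a, c) \<cdot>\<^sub>v r c) {0..<n}) $$ (a, b)"
      using ab A B I J Ia Ja
      by (simp add: minor_mat_def index_finsum_vec r r_def scalar_prod_def)
  qed (use I J in \<open>auto simp: minor_mat_def\<close>)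
  then have "det (minor_mat (A * B) I J) = (\<Sum>f\<in>F. det (mat\<^sub>r k k (\<lambda>a. A $$ (I ! a, f a) \<cdot>\<^sub>v r (f a))))"
    unfolding F_def using r by (simp only:) (rule det_linear_rows_sum, auto)
  also have "\<dots> = (\<Sum>f\<in>F. G f)"
    unfolding G_def using r by (intro sum.cong refl det_rows_mul) auto
  also have "\<dots> = (\<Sum>f\<in>F'. G f)"
  proof (rule sum.mono_neutral_right[OF finF])
    show "\<forall>f\<in>F - F'. G f = 0"
    proof
      fix f assume "f \<in> F - F'"
      then have "\<not> inj_on f {0..<k}" unfolding F_def F'_def by blast
      from det_rows_noninjective[OF this, of r] r show "G f = 0" by (simp add: G_def)
    qed
  qed (auto simp: F_def F'_def)
  also have "\<dots> = (\<Sum>(S, p)\<in>increasing_lists n k \<times> P. G (\<lambda>a. if a < k then S ! p a else a))"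
    using sum.reindex_bij_betw[OF bij_betw_factor_injection[of k n], of G]
    by (simp add: F'_def P_def case_prod_unfold)
  also have "\<dots> = (\<Sum>S\<in>increasing_lists n k. \<Sum>p\<in>P. G (\<lambda>a. if a < k then S ! p a else a))"
    by (rule sum.cartesian_product[symmetric])
  also have "\<dots> = (\<Sum>S\<in>increasing_lists n k. det (minor_mat A I S) * det (minor_mat B S J))"
  proof (rule sum.cong[OF refl])
    fix S assume S: "S \<in> increasing_lists n k"
    note Sd = increasing_listsD[OF S]
    have "G (\<lambda>a. if a < k then S ! p a else a) =
        (signof p * (\<Prod>a = 0..<k. minor_mat A I S $$ (a, p a))) * det (minor_mat B S J)" if p: "p \<in> P" for p
    proof -
      have pa: "p a < k" if "a < k" for a
        using permutes_in_image[of p "{0..<k}" a] p that by (auto simp: P_def)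
      have "mat\<^sub>r k k (\<lambda>a. r (if a < k then S ! p a else a)) = mat k k (\<lambda>(a, b). minor_mat B S J $$ (p a, b))"
        using pa Sd(1) J(1) by (intro eq_matI) (auto simp: r_def minor_mat_def)
      moreover have "det (mat k k (\<lambda>(a, b). minor_mat B S J $$ (p a, b))) = signof p * det (minor_mat B S J)"
        using p Sd(1) J(1) minor_mat_carrier[of B S J] by (intro det_permute_rows) (auto simp: P_def)
      moreover have "(\<Prod>a\<in>{0..<k}. A $$ (I ! a, if a < k then S ! p a else a)) =
          (\<Prod>a = 0..<k. minor_mat A I S $$ (a, p a))"
        using pa Sd(1) I(1) by (intro prod.cong) (auto simp: minor_mat_def)
      ultimately show ?thesis by (simp add: G_def)
    qed
    then have "(\<Sum>p\<in>P. G (\<lambda>a. if a < k then S ! p a else a)) =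
        (\<Sum>p\<in>P. (signof p * (\<Prod>a = 0..<k. minor_mat A I S $$ (a, p a))) * det (minor_mat B S J))"
      by (rule sum.cong[OF refl])
    also have "\<dots> = det (minor_mat A I S) * det (minor_mat B S J)"
      using minor_mat_carrier[of A I S] I(1) Sd(1)
      by (simp add: det_def'[of _ k] P_def sum_distrib_right)
    finally show "(\<Sum>p\<in>P. G (\<lambda>a. if a < k then S ! p a else a)) = det (minor_mat A I S) * det (minor_mat B S J)" .
  qed
  finally show ?thesis .
qed

section \<open>Compound matrices\<close>

definition compound_dim :: "nat \<Rightarrow> nat \<Rightarrow> nat" where
  "compound_dim n k = card (increasing_lists n k)"

text \<open>An arbitrary enumeration of the \<open>k\<close>-subsets, since the rows and columns of compound matrices
  are indexed by natural numbers. Another enumeration permutes rows and columns alike.\<close>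

definition nth_increasing :: "nat \<Rightarrow> nat \<Rightarrow> nat \<Rightarrow> nat list" where
  "nth_increasing n k = (SOME f. bij_betw f {..<compound_dim n k} (increasing_lists n k))"

lemma nth_increasing_bij: "bij_betw (nth_increasing n k) {..<compound_dim n k} (increasing_lists n k)"
  unfolding nth_increasing_def compound_dim_def
  using ex_bij_betw_nat_finite[OF finite_increasing_lists, of n k]
  unfolding atLeast0LessThan by (rule someI_ex)

lemma nth_increasing_in: "i < compound_dim n k \<Longrightarrow> nth_increasing n k i \<in> increasing_lists n k"
  using nth_increasing_bij by (metis bij_betwE lessThan_iff)

definition compound :: "nat \<Rightarrow> nat \<Rightarrow> 'a :: comm_ring_1 mat \<Rightarrow> 'a mat" where
  "compound n k M = mat (compound_dim n k) (compound_dim n k)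
     (\<lambda>(i, j). det (minor_mat M (nth_increasing n k i) (nth_increasing n k j)))"

lemma compound_carrier [simp]: "compound n k M \<in> carrier_mat (compound_dim n k) (compound_dim n k)"
  by (simp add: compound_def)

lemma compound_mult:
  assumes "A \<in> carrier_mat n n" "B \<in> carrier_mat n n"
  shows "compound n k (A * B) = compound n k A * compound n k B"
proof (rule eq_matI)
  fix i j assume "i < dim_row (compound n k A * compound n k B)" "j < dim_col (compound n k A * compound n k B)"
  then have ij: "i < compound_dim n k" "j < compound_dim n k" by (auto simp: compound_def)
  note I = increasing_listsD[OF nth_increasing_in[OF ij(1)]]
  note J = increasing_listsD[OF nth_increasing_in[OF ij(2)]]
  have "compound n k (A * B) $$ (i, j) = (\<Sum>S\<in>increasing_lists n k.
      det (minor_mat A (nth_increasing n k i) S) * det (minor_mat B S (nth_increasing n k j)))"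
    using ij cauchy_binet[OF assms I(1,4) J(1,4)] by (simp add: compound_def)
  also have "\<dots> = (\<Sum>s<compound_dim n k. compound n k A $$ (i, s) * compound n k B $$ (s, j))"
    unfolding sum.reindex_bij_betw[OF nth_increasing_bij, symmetric]
    using ij by (simp add: compound_def)
  also have "\<dots> = (compound n k A * compound n k B) $$ (i, j)"
    using ij by (simp add: scalar_prod_def compound_def atLeast0LessThan)
  finally show "compound n k (A * B) $$ (i, j) = (compound n k A * compound n k B) $$ (i, j)" .
qed (auto simp: compound_def)

lemma det_adjoint:
  fixes M :: "complex mat"
  assumes "M \<in> carrier_mat n n"
  shows "det (M\<^sup>\<dagger>) = cnj (det M)"
proof -
  interpret cnj: comm_ring_hom cnj by unfold_locales auto
  have "M\<^sup>\<dagger> = map_mat cnj (transpose_mat M)"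
    by (rule eq_matI) (auto simp: adjoint_index)
  then show ?thesis
    using assms by (simp add: cnj.hom_det det_transpose)
qed

lemma compound_adjoint:
  fixes M :: "complex mat"
  assumes "M \<in> carrier_mat n n"
  shows "compound n k (M\<^sup>\<dagger>) = (compound n k M)\<^sup>\<dagger>"
proof (rule eq_matI)
  fix i j assume "i < dim_row ((compound n k M)\<^sup>\<dagger>)" "j < dim_col ((compound n k M)\<^sup>\<dagger>)"
  then have ij: "i < compound_dim n k" "j < compound_dim n k" by (auto simp: compound_def)
  note I = increasing_listsD[OF nth_increasing_in[OF ij(1)]]
  note J = increasing_listsD[OF nth_increasing_in[OF ij(2)]]
  have "minor_mat (M\<^sup>\<dagger>) (nth_increasing n k i) (nth_increasing n k j) =
      (minor_mat M (nth_increasing n k j) (nth_increasing n k i))\<^sup>\<dagger>"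
    using I J assms by (intro eq_matI) (auto simp: minor_mat_def adjoint_index)
  moreover have "det ((minor_mat M (nth_increasing n k j) (nth_increasing n k i))\<^sup>\<dagger>) =
      cnj (det (minor_mat M (nth_increasing n k j) (nth_increasing n k i)))"
    using minor_mat_carrier[of M "nth_increasing n k j" "nth_increasing n k i"]
    unfolding I(1) J(1) by (rule det_adjoint)
  ultimately show "compound n k (M\<^sup>\<dagger>) $$ (i, j) = (compound n k M)\<^sup>\<dagger> $$ (i, j)"
    using ij by (simp add: compound_def adjoint_index)
qed (auto simp: compound_def)

text \<open>If \<open>I\<close> and \<open>J\<close> differ, then \<open>I\<close> has an element outside \<open>J\<close>, which yields a zero row.\<close>

lemma det_minor_diag:
  fixes d :: "nat \<Rightarrow> 'a :: comm_ring_1"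
  assumes I: "I \<in> increasing_lists n k" and J: "J \<in> increasing_lists n k"
  shows "det (minor_mat (mat_diag n d) I J) = (if I = J then \<Prod>a<k. d (I ! a) else 0)"
proof (cases "I = J")
  case True
  note Id = increasing_listsD[OF I]
  have entries: "minor_mat (mat_diag n d) I I $$ (a, b) = (if a = b then d (I ! a) else 0)" if "a < k" "b < k" for a b
    using that Id by (auto simp: minor_mat_def mat_diag_def nth_eq_iff_index_eq)
  have "upper_triangular (minor_mat (mat_diag n d) I I)"
    using Id entries by (auto simp: upper_triangular_def minor_mat_def)
  then have "det (minor_mat (mat_diag n d) I I) = prod_list (diag_mat (minor_mat (mat_diag n d) I I))"
    using minor_mat_carrier by (rule det_upper_triangular)
  also have "\<dots> = (\<Prod>a<k. d (I ! a))"
    using Id entries by (simp add: diag_mat_def prod.list_conv_set_nth minor_mat_def atLeast0LessThan)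
  finally show ?thesis using True by simp
next
  case False
  note Id = increasing_listsD[OF I] and Jd = increasing_listsD[OF J]
  have "\<not> set I \<subseteq> set J"
  proof
    assume "set I \<subseteq> set J"
    moreover have "card (set I) = card (set J)"
      using Id Jd by (simp add: distinct_card)
    ultimately have "set I = set J" by (simp add: card_subset_eq)
    then show False using False increasing_lists_eqI[OF I J] by blast
  qed
  then obtain a where a: "a < k" "I ! a \<notin> set J"
    using Id by (metis in_set_conv_nth subsetI)
  have zero: "minor_mat (mat_diag n d) I J $$ (a, b) = 0" if "b < k" for b
    using that a Id Jd by (auto simp: minor_mat_def mat_diag_def)
  have "(\<Prod>i = 0..<k. minor_mat (mat_diag n d) I J $$ (i, p i)) = 0" if p: "p permutes {0..<k}" for p
  proof (rule prod_zero)
    have "p a < k" using permutes_in_image[OF p, of a] a by simp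
    then show "\<exists>i\<in>{0..<k}. minor_mat (mat_diag n d) I J $$ (i, p i) = 0"
      using zero[of "p a"] a(1) by (intro bexI[of _ a]) auto
  qed simp
  then have "det (minor_mat (mat_diag n d) I J) = 0"
    using minor_mat_carrier[of "mat_diag n d" I J] Id(1) Jd(1) by (simp add: det_def'[of _ k])
  then show ?thesis using False by simp
qed

lemma compound_diag:
  "compound n k (mat_diag n d) = mat_diag (compound_dim n k) (\<lambda>i. \<Prod>a<k. d (nth_increasing n k i ! a))"
proof (rule eq_matI)
  fix i j
  assume "i < dim_row (mat_diag (compound_dim n k) (\<lambda>i. \<Prod>a<k. d (nth_increasing n k i ! a)))"
    "j < dim_col (mat_diag (compound_dim n k) (\<lambda>i. \<Prod>a<k. d (nth_increasing n k i ! a)))"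
  then have ij: "i < compound_dim n k" "j < compound_dim n k" by (auto simp: mat_diag_def)
  have "nth_increasing n k i = nth_increasing n k j \<longleftrightarrow> i = j"
    using nth_increasing_bij ij by (metis bij_betw_def inj_on_eq_iff lessThan_iff)
  then show "compound n k (mat_diag n d) $$ (i, j) =
      mat_diag (compound_dim n k) (\<lambda>i. \<Prod>a<k. d (nth_increasing n k i ! a)) $$ (i, j)"
    using ij det_minor_diag[OF nth_increasing_in[OF ij(1)] nth_increasing_in[OF ij(2)], of d]
    by (auto simp: compound_def mat_diag_def)
qed (auto simp: compound_def mat_diag_def)

lemma compound_one: "compound n k (1\<^sub>m n) = 1\<^sub>m (compound_dim n k)"
  using compound_diag[of n k "\<lambda>_. 1"] by simp

lemma compound_unitary: "unitary n U \<Longrightarrow> unitary (compound_dim n k) (compound n k U)"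
  unfolding unitary_def by (metis compound_adjoint compound_carrier compound_mult compound_one square_adjoint_carrier)

lemma compound_spectral_form:
  assumes "spectral_form n A U d"
  shows "spectral_form (compound_dim n k) (compound n k A) (compound n k U)
    (\<lambda>i. \<Prod>a<k. d (nth_increasing n k i ! a))"
proof -
  have U: "U \<in> carrier_mat n n" using assms by (simp add: spectral_form_def unitary_carrier)
  have "compound n k A = compound n k U * compound n k (rdiag n d) * (compound n k U)\<^sup>\<dagger>"
    using assms U by (simp add: spectral_form_def compound_mult compound_adjoint)
  then show ?thesis
    using assms by (simp add: spectral_form_def compound_unitary compound_diag)
qed

lemma compound_pos_def:
  assumes "pos_def n A"
  shows "pos_def (compound_dim n k) (compound n k A)"
proof (rule pos_def_powers[OF assms])
  fix U d assume d: "\<And>i. i < n \<Longrightarrow> 0 < d i" and S: "spectral_form n A U d"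
  show ?thesis
  proof (rule spectral_form_pos_def[OF compound_spectral_form[OF S]], rule prod_pos)
    fix i a assume "i < compound_dim n k" "a \<in> {..<k}"
    then show "0 < d (nth_increasing n k i ! a)"
      using d nth_increasing_in increasing_listsD(5) by blast
  qed
qed

text \<open>Both sides are diagonal in the same basis, and a product of powers is the power of the
  product.\<close>

lemma compound_mat_powr:
  assumes "pos_def n A"
  shows "compound n k (mat_powr A x) = mat_powr (compound n k A) x"
proof (rule pos_def_powers[OF assms])
  fix U d assume d: "\<And>i. i < n \<Longrightarrow> 0 < d i" and S: "spectral_form n A U d"
    and P: "\<And>x. spectral_form n (mat_powr A x) U (\<lambda>i. d i powr x)"
  let ?N = "compound_dim n k"
  let ?e = "\<lambda>i. \<Prod>a<k. d (nth_increasing n k i ! a)"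
  have pos: "0 < d (nth_increasing n k i ! a)" if "i < ?N" "a < k" for i a
    using d that nth_increasing_in increasing_listsD(5) by blast
  have "spectral_form ?N (mat_powr (compound n k A) x) (compound n k U) (\<lambda>i. ?e i powr x)"
    by (rule spectral_form_mat_powr[OF compound_spectral_form[OF S]]) (auto intro!: less_imp_le[OF prod_pos] pos)
  moreover have "spectral_form ?N (compound n k (mat_powr A x)) (compound n k U) (\<lambda>i. ?e i powr x)"
    by (rule spectral_form_cong[OF compound_spectral_form[OF P]])
      (auto simp: prod_powr_distrib pos less_imp_le)
  ultimately show ?thesis using spectral_form_unique by blast
qed

section \<open>Eigenvalue lists\<close>

lemma mset_eq_of_linear_factors:
  fixes as bs :: "'a :: field list"
  assumes "(\<Prod>a\<leftarrow>as. [:- a, 1:]) = (\<Prod>a\<leftarrow>bs. [:- a, 1:])"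
  shows "mset as = mset bs"
  using assms
proof (induction as arbitrary: bs)
  case Nil
  then have "degree (\<Prod>a\<leftarrow>bs. [:- a, 1:]) = 0" by simp
  then show ?case using degree_linear_factors[of uminus bs] by simp
next
  case (Cons a as)
  have "poly (\<Prod>a\<leftarrow>bs. [:- a, 1:]) a = 0"
    using Cons.prems[symmetric] by simp
  then have a: "a \<in> set bs"
    by (auto simp: poly_prod_list prod_list_zero_iff)
  have "mset bs = mset (a # remove1 a bs)"
    using a by simp
  then have "mset (map (\<lambda>a. [:- a, 1:]) bs) = mset (map (\<lambda>a. [:- a, 1:]) (a # remove1 a bs))"
    by (simp only: mset_map)
  then have "(\<Prod>a\<leftarrow>bs. [:- a, 1:]) = (\<Prod>a\<leftarrow>a # remove1 a bs. [:- a, 1:])"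
    by (simp only: prod_mset_prod_list[symmetric])
  then have "(\<Prod>a\<leftarrow>as. [:- a, 1:]) = (\<Prod>a\<leftarrow>remove1 a bs. [:- a, 1:])"
    using Cons.prems by (simp del: mult_pCons_left)
  from Cons.IH[OF this] a show ?case by simp
qed

lemma eigs_eqI:
  assumes "sorted_wrt (\<ge>) es" "char_poly X = (\<Prod>e\<leftarrow>es. [:- complex_of_real e, 1:])"
  shows "eigs X = es"
  unfolding eigs_def
proof (rule the_equality)
  fix fs assume fs: "sorted_wrt (\<ge>) fs \<and> char_poly X = (\<Prod>e\<leftarrow>fs. [:- complex_of_real e, 1:])"
  then have "mset (map complex_of_real fs) = mset (map complex_of_real es)"
    using assms(2) by (intro mset_eq_of_linear_factors) (simp add: o_def)
  then have "image_mset Re (mset (map complex_of_real fs)) = image_mset Re (mset (map complex_of_real es))"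
    by simp
  then have "mset (rev fs) = mset (rev es)"
    by (simp add: multiset.map_comp o_def)
  moreover have "sorted (rev fs)" "sorted (rev es)"
    using fs assms(1) by (simp_all add: sorted_wrt_rev)
  ultimately have "rev fs = rev es"
    by (metis properties_for_sort)
  then show "fs = es" by simp
qed (use assms in simp)

text \<open>Here \<open>S\<close> is an arbitrary invertible matrix with inverse \<open>T\<close>, as needed for a product of two
  positive definite matrices, which need not be Hermitian.\<close>

definition similar_to_rdiag :: "nat \<Rightarrow> complex mat \<Rightarrow> complex mat \<Rightarrow> complex mat \<Rightarrow> (nat \<Rightarrow> real) \<Rightarrow> bool" where
  "similar_to_rdiag n M S T d \<longleftrightarrow> S \<in> carrier_mat n n \<and> T \<in> carrier_mat n n \<and> S * T = 1\<^sub>m n \<and> T * S = 1\<^sub>m n \<and>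
     M = S * rdiag n d * T"

lemma spectral_form_similar: "spectral_form n A U d \<Longrightarrow> similar_to_rdiag n A U (U\<^sup>\<dagger>) d"
  by (auto simp: spectral_form_def similar_to_rdiag_def unitary_left unitary_right unitary_carrier)

lemma similar_to_rdiag_conj:
  assumes "similar_to_rdiag n M S T d" "P \<in> carrier_mat n n" "Q \<in> carrier_mat n n" "P * Q = 1\<^sub>m n"
  shows "similar_to_rdiag n (P * M * Q) (P * S) (T * Q) d"
proof -
  have QP: "Q * P = 1\<^sub>m n"
    by (rule mat_mult_left_right_inverse[OF assms(2-4)])
  have ST: "S \<in> carrier_mat n n" "T \<in> carrier_mat n n" "S * T = 1\<^sub>m n" "T * S = 1\<^sub>m n"
    and M: "M = S * rdiag n d * T"
    using assms by (auto simp: similar_to_rdiag_def)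
  have "P * S * (T * Q) = P * (S * (T * Q))" "T * Q * (P * S) = T * (Q * (P * S))"
    "P * M * Q = P * S * rdiag n d * (T * Q)"
    using ST assms(2,3) by (simp_all add: M square_assoc[where n = n])
  then show ?thesis
    unfolding similar_to_rdiag_def
    using ST assms(2-4) QP by (simp add: left_cancel[where n = n])
qed

lemma similar_to_rdiag_char_poly:
  assumes "similar_to_rdiag n M S T d"
  shows "char_poly M = (\<Prod>e\<leftarrow>map d [0..<n]. [:- complex_of_real e, 1:])"
proof -
  have "similar_mat M (rdiag n d)"
    using assms unfolding similar_mat_def similar_mat_wit_def similar_to_rdiag_def Let_def
    by (intro exI[of _ S] exI[of _ T]) auto
  then have "char_poly M = char_poly (rdiag n d)" by (rule char_poly_similar)
  also have "\<dots> = (\<Prod>a\<leftarrow>diag_mat (rdiag n d). [:- a, 1:])"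
    by (rule char_poly_upper_triangular[of _ n]) (auto simp: upper_triangular_def mat_diag_def)
  also have "diag_mat (rdiag n d) = map complex_of_real (map d [0..<n])"
    by (simp add: diag_mat_def mat_diag_def)
  finally show ?thesis by (simp add: o_def)
qed

lemma similar_to_rdiag_det:
  assumes "similar_to_rdiag n M S T d"
  shows "det M = complex_of_real (\<Prod>i<n. d i)"
proof -
  have "det S * det T = 1"
    using assms by (metis det_mult det_one similar_to_rdiag_def)
  moreover have "det (rdiag n d) = complex_of_real (\<Prod>i<n. d i)"
    by (subst det_upper_triangular[of _ n])
      (auto simp: upper_triangular_def mat_diag_def diag_mat_def prod.list_conv_set_nth atLeast0LessThan)
  ultimately show ?thesis
    using assms by (simp add: similar_to_rdiag_def det_mult[of _ n])
qed

text \<open>The product \<open>P Q = Q^(-1/2) (Q^(1/2) P Q^(1/2)) Q^(1/2)\<close> is similar to a positive definite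
  matrix.\<close>

lemma pos_def_mult_similar:
  assumes P: "pos_def n P" and Q: "pos_def n Q"
  obtains S T e where "similar_to_rdiag n (P * Q) S T e"
    "\<And>i j. i \<le> j \<Longrightarrow> j < n \<Longrightarrow> e j \<le> e i" "\<And>i. i < n \<Longrightarrow> 0 < e i"
proof -
  define R where "R = mat_powr Q (1 / 2)"
  define R' where "R' = mat_powr Q (- 1 / 2)"
  have R: "R \<in> carrier_mat n n" "R' \<in> carrier_mat n n" "R' * R = 1\<^sub>m n" "R * R = Q"
    by (simp_all add: R_def R'_def mat_powr_carrier[OF Q] mat_powr_mult[OF Q] mat_powr_zero[OF Q] mat_powr_one[OF Q])
  obtain U e where U: "spectral_form n (R * P * R) U e"
    "\<forall>i j. i \<le> j \<longrightarrow> j < n \<longrightarrow> e j \<le> e i" "\<forall>i<n. 0 < e i"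
    using pos_def_spectral_form[OF powr_congruence_pos_def[OF Q P, of "1 / 2"]] by (auto simp: R_def)
  have "R' * (R * P * R) * R = P * Q"
    using R(1-3) pos_def_carrier[OF P]
    by (simp add: R(4)[symmetric] square_assoc[where n = n] left_cancel[where n = n])
  then show thesis
    using that similar_to_rdiag_conj[OF spectral_form_similar[OF U(1)] R(2,1,3)] U(2,3) by auto
qed

lemma smult_smult_mat:
  fixes A :: "complex mat"
  shows "c \<cdot>\<^sub>m (d \<cdot>\<^sub>m A) = (c * d) \<cdot>\<^sub>m A"
  by (rule eq_matI) auto

lemma square_smult_vec:
  fixes A :: "complex mat"
  assumes "A \<in> carrier_mat n n" "v \<in> carrier_vec n"
  shows "(c \<cdot>\<^sub>m A) *\<^sub>v v = c \<cdot>\<^sub>v (A *\<^sub>v v)"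
  using assms by (intro eq_vecI) auto

lemma qform_smult:
  assumes "A \<in> carrier_mat n n" "v \<in> carrier_vec n"
  shows "qform (complex_of_real c \<cdot>\<^sub>m A) v = c * qform A v"
proof -
  have "(complex_of_real c \<cdot>\<^sub>m A) *\<^sub>v v = complex_of_real c \<cdot>\<^sub>v (A *\<^sub>v v)"
    using assms by (simp add: square_smult_vec[where n = n])
  then show ?thesis using assms by (simp add: qform_def)
qed

section \<open>Log-majorization for positive definite matrices\<close>

lemma square_smult_mult:
  fixes A B :: "complex mat"
  assumes "A \<in> carrier_mat n n" "B \<in> carrier_mat n n"
  shows "(c \<cdot>\<^sub>m A) * B = c \<cdot>\<^sub>m (A * B)" "A * (c \<cdot>\<^sub>m B) = c \<cdot>\<^sub>m (A * B)"
  using assms by (simp_all add: mult_smult_distrib[of _ n n _ n] mult_smult_assoc_mat[of _ n n _ n])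

text \<open>The normalised case applies to \<open>C/\<mu>\<close>. Replacing \<open>C\<close> by \<open>c C\<close> multiplies the two factors by
  \<open>c^(t p)\<close> and \<open>c^((1-t) p)\<close>, hence the product by \<open>c^p\<close>.\<close>

lemma top_eigenvalue_bound:
  assumes C: "pos_def n C" and D: "pos_def n D"
    and mu: "\<mu> > 0" "loewner_le n (mat_powr D (1 / 2) * C * mat_powr D (1 / 2)) (complex_of_real \<mu> \<cdot>\<^sub>m 1\<^sub>m n)"
    and p: "1 \<le> p" "p \<le> 2" and a: "0 \<le> a" "a \<le> 1"
    and t: "a * (p - 1) \<le> t * p" "t * p \<le> a * (p - 1) + 1"
    and v: "v \<in> carrier_vec n" "v \<noteq> 0\<^sub>v n"
    and eq: "(mat_powr (mat_powr D (a / 2) * mat_powr C t * mat_powr D (a / 2)) p *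
      mat_powr (mat_powr D ((1 - a) / 2) * mat_powr C (1 - t) * mat_powr D ((1 - a) / 2)) p) *\<^sub>v v =
      complex_of_real l \<cdot>\<^sub>v v"
  shows "l \<le> \<mu> powr p"
proof -
  note car = mat_powr_carrier[OF C] mat_powr_carrier[OF D] pos_def_carrier[OF C]
  \<comment> \<open>Scaling by \<open>1/\<mu>\<close> turns the hypothesis into \<open>c C \<le> D^(-1)\<close>.\<close>
  define c where "c = 1 / \<mu>"
  have c: "c > 0" using mu by (simp add: c_def)
  define C' where "C' = complex_of_real c \<cdot>\<^sub>m C"
  have C': "pos_def n C'" unfolding C'_def by (rule pos_def_smult[OF C c])
  have "loewner_le n C (complex_of_real \<mu> \<cdot>\<^sub>m mat_powr D (- 1))"
  proof -
    have "loewner_le n (mat_powr D (- 1 / 2) * (mat_powr D (1 / 2) * C * mat_powr D (1 / 2)) * mat_powr D (- 1 / 2))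
        (mat_powr D (- 1 / 2) * (complex_of_real \<mu> \<cdot>\<^sub>m 1\<^sub>m n) * mat_powr D (- 1 / 2))"
      by (rule loewner_le_powr_congruence[OF mu(2) _ _ D]) (use car in auto)
    moreover have "mat_powr D (- 1 / 2) * (mat_powr D (1 / 2) * C * mat_powr D (1 / 2)) * mat_powr D (- 1 / 2) = C"
      using car by (simp add: square_assoc[where n = n] mat_powr_mult_left[OF D] mat_powr_mult[OF D] mat_powr_zero[OF D])
    moreover have "mat_powr D (- 1 / 2) * (complex_of_real \<mu> \<cdot>\<^sub>m 1\<^sub>m n) * mat_powr D (- 1 / 2) =
        complex_of_real \<mu> \<cdot>\<^sub>m mat_powr D (- 1)"
      using car by (simp add: square_smult_mult[where n = n] mat_powr_mult[OF D])
    ultimately show ?thesis by simp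
  qed
  then have "qform C v \<le> \<mu> * qform (mat_powr D (- 1)) v" if "v \<in> carrier_vec n" for v
    using that car by (simp add: loewner_le_def qform_smult[where n = n])
  then have "c * qform C v \<le> qform (mat_powr D (- 1)) v" if "v \<in> carrier_vec n" for v
    using that mu by (simp add: c_def field_simps)
  then have le: "loewner_le n C' (mat_powr D (- 1))"
    using car by (simp add: loewner_le_def C'_def qform_smult[where n = n])
  have scale: "mat_powr (mat_powr D x * mat_powr C' y * mat_powr D x) p =
      complex_of_real ((c powr y) powr p) \<cdot>\<^sub>m mat_powr (mat_powr D x * mat_powr C y * mat_powr D x) p" for x y
  proof -
    have "mat_powr D x * mat_powr C' y * mat_powr D x =
        complex_of_real (c powr y) \<cdot>\<^sub>m (mat_powr D x * mat_powr C y * mat_powr D x)"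
      using car by (simp add: C'_def mat_powr_smult[OF C c] square_smult_mult[where n = n])
    then show ?thesis
      using mat_powr_smult[OF powr_congruence_pos_def[OF D mat_powr_pos_def[OF C]], of "c powr y"] c
      by simp
  qed
  define X where "X = mat_powr (mat_powr D (a / 2) * mat_powr C t * mat_powr D (a / 2)) p"
  define Y where "Y = mat_powr (mat_powr D ((1 - a) / 2) * mat_powr C (1 - t) * mat_powr D ((1 - a) / 2)) p"
  have XY: "X \<in> carrier_mat n n" "Y \<in> carrier_mat n n"
    unfolding X_def Y_def by (intro mat_powr_carrier powr_congruence_pos_def mat_powr_pos_def C D)+
  have "(c powr t) powr p * (c powr (1 - t)) powr p = c powr p"
  proof -
    have "(c powr t) powr p * (c powr (1 - t)) powr p = (c powr t * c powr (1 - t)) powr p"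
      by (simp add: powr_mult)
    also have "c powr t * c powr (1 - t) = c" using c by (simp flip: powr_add)
    finally show ?thesis .
  qed
  then have "complex_of_real ((c powr (1 - t)) powr p) * complex_of_real ((c powr t) powr p) = complex_of_real (c powr p)"
    by (metis mult.commute of_real_mult)
  then have "(mat_powr (mat_powr D (a / 2) * mat_powr C' t * mat_powr D (a / 2)) p *
      mat_powr (mat_powr D ((1 - a) / 2) * mat_powr C' (1 - t) * mat_powr D ((1 - a) / 2)) p) =
      complex_of_real (c powr p) \<cdot>\<^sub>m (X * Y)"
    unfolding scale X_def[symmetric] Y_def[symmetric]
    using XY by (simp add: square_smult_mult[where n = n] smult_smult_mat)
  moreover have "(complex_of_real (c powr p) \<cdot>\<^sub>m (X * Y)) *\<^sub>v v = complex_of_real (c powr p) \<cdot>\<^sub>v ((X * Y) *\<^sub>v v)"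
    using XY v by (intro square_smult_vec[of _ n]) auto
  moreover have "(X * Y) *\<^sub>v v = complex_of_real l \<cdot>\<^sub>v v"
    using eq by (simp add: X_def Y_def)
  ultimately have "(mat_powr (mat_powr D (a / 2) * mat_powr C' t * mat_powr D (a / 2)) p *
      mat_powr (mat_powr D ((1 - a) / 2) * mat_powr C' (1 - t) * mat_powr D ((1 - a) / 2)) p) *\<^sub>v v =
      complex_of_real (c powr p * l) \<cdot>\<^sub>v v"
    by (simp add: smult_smult_assoc)
  from top_eigenvalue_bound_one[OF C' D le p a t v this]
  show ?thesis using mu by (simp add: c_def powr_divide field_simps)
qed

lemma similar_to_rdiag_compound:
  assumes "similar_to_rdiag n M S T d"
  shows "similar_to_rdiag (compound_dim n k) (compound n k M) (compound n k S) (compound n k T)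
    (\<lambda>i. \<Prod>a<k. d (nth_increasing n k i ! a))"
proof -
  have ST: "S \<in> carrier_mat n n" "T \<in> carrier_mat n n" "S * T = 1\<^sub>m n" "T * S = 1\<^sub>m n"
    and M: "M = S * rdiag n d * T"
    using assms by (auto simp: similar_to_rdiag_def)
  have "compound n k S * compound n k T = 1\<^sub>m (compound_dim n k)"
    "compound n k T * compound n k S = 1\<^sub>m (compound_dim n k)"
    using ST by (metis compound_mult compound_one)+
  moreover have "compound n k M = compound n k S * compound n k (rdiag n d) * compound n k T"
    using ST by (simp add: M compound_mult)
  ultimately show ?thesis
    by (simp add: similar_to_rdiag_def compound_diag)
qed

lemma similar_to_rdiag_eigenvector:
  assumes "similar_to_rdiag n M S T d" "i < n"
  obtains v where "v \<in> carrier_vec n" "v \<noteq> 0\<^sub>v n" "M *\<^sub>v v = complex_of_real (d i) \<cdot>\<^sub>v v"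
proof
  have ST: "S \<in> carrier_mat n n" "T \<in> carrier_mat n n" "T * S = 1\<^sub>m n" and M: "M = S * rdiag n d * T"
    using assms by (auto simp: similar_to_rdiag_def)
  have e: "unit_vec n i \<in> carrier_vec n" by simp
  have Tv: "T *\<^sub>v (S *\<^sub>v unit_vec n i) = unit_vec n i"
    using ST e by (simp add: square_assoc_vec[where n = n, symmetric])
  show "S *\<^sub>v unit_vec n i \<in> carrier_vec n" using ST by simp
  show "S *\<^sub>v unit_vec n i \<noteq> 0\<^sub>v n"
  proof
    assume "S *\<^sub>v unit_vec n i = 0\<^sub>v n"
    then have "unit_vec n i = (0\<^sub>v n :: complex vec)" using Tv ST by auto
    then show False using assms(2) by (metis index_unit_vec(1) index_zero_vec(1) zero_neq_one)
  qed
  have De: "rdiag n d *\<^sub>v unit_vec n i = complex_of_real (d i) \<cdot>\<^sub>v unit_vec n i"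
    using assms(2) by (intro eq_vecI) (auto simp: mat_diag_def)
  have "M *\<^sub>v (S *\<^sub>v unit_vec n i) = S *\<^sub>v (rdiag n d *\<^sub>v (T *\<^sub>v (S *\<^sub>v unit_vec n i)))"
    using ST e by (simp add: M square_assoc_vec[where n = n])
  then show "M *\<^sub>v (S *\<^sub>v unit_vec n i) = complex_of_real (d i) \<cdot>\<^sub>v (S *\<^sub>v unit_vec n i)"
    unfolding Tv De using ST e by (simp add: square_mult_smult_vec[where n = n])
qed

lemma first_increasing_list:
  assumes "k \<le> n"
  obtains i where "i < compound_dim n k" "nth_increasing n k i = [0..<k]"
proof -
  have "[0..<k] \<in> increasing_lists n k"
    using assms by (auto simp: increasing_lists_def)
  then have "[0..<k] \<in> nth_increasing n k ` {..<compound_dim n k}"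
    using nth_increasing_bij by (metis bij_betw_imp_surj_on)
  then show thesis using that by auto
qed

text \<open>The bound for the largest eigenvalue is applied to the compounds of \<open>C\<close> and \<open>D\<close>. The
  eigenvalues of the compound of \<open>Z\<close> are the products of \<open>z\<close> over \<open>k\<close>-subsets; the subset
  \<open>{0..<k}\<close> gives the largest one, because the \<open>a\<close>-th element of an increasing list is at least
  \<open>a\<close>. The same subset contributes the eigenvalue \<open>e 0 * ... * e (k-1)\<close> on the left.\<close>

lemma prod_top_eigenvalues_le:
  assumes C: "pos_def n C" and D: "pos_def n D"
    and p: "1 \<le> p" "p \<le> 2" and a: "0 \<le> a" "a \<le> 1"
    and t: "a * (p - 1) \<le> t * p" "t * p \<le> a * (p - 1) + 1"
    and XY: "similar_to_rdiag n
      (mat_powr (mat_powr D (a / 2) * mat_powr C t * mat_powr D (a / 2)) p *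
       mat_powr (mat_powr D ((1 - a) / 2) * mat_powr C (1 - t) * mat_powr D ((1 - a) / 2)) p) S T e"
    and Z: "spectral_form n (mat_powr D (1 / 2) * C * mat_powr D (1 / 2)) U z"
    and z: "\<And>i j. i \<le> j \<Longrightarrow> j < n \<Longrightarrow> z j \<le> z i" "\<And>i. i < n \<Longrightarrow> 0 < z i"
    and k: "k \<le> n"
  shows "(\<Prod>i<k. e i) \<le> (\<Prod>i<k. z i) powr p"
proof -
  let ?N = "compound_dim n k" and ?c = "compound n k"
  note car = mat_powr_carrier[OF C] mat_powr_carrier[OF D] pos_def_carrier[OF C]
  have pd: "pos_def n (mat_powr D x * mat_powr C y * mat_powr D x)" for x y
    by (rule powr_congruence_pos_def[OF D mat_powr_pos_def[OF C]])
  have comp: "?c (mat_powr (mat_powr D x * mat_powr C y * mat_powr D x) p) =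
      mat_powr (mat_powr (?c D) x * mat_powr (?c C) y * mat_powr (?c D) x) p" for x y
    using car by (simp add: compound_mat_powr[OF pd] compound_mat_powr[OF C] compound_mat_powr[OF D] compound_mult)
  obtain i where i: "i < ?N" "nth_increasing n k i = [0..<k]"
    by (rule first_increasing_list[OF k])
  have XYc: "mat_powr (mat_powr D x * mat_powr C y * mat_powr D x) p \<in> carrier_mat n n" for x y
    by (rule mat_powr_carrier[OF pd])
  obtain v where v: "v \<in> carrier_vec ?N" "v \<noteq> 0\<^sub>v ?N"
    and "?c (mat_powr (mat_powr D (a / 2) * mat_powr C t * mat_powr D (a / 2)) p *
      mat_powr (mat_powr D ((1 - a) / 2) * mat_powr C (1 - t) * mat_powr D ((1 - a) / 2)) p) *\<^sub>v v =
      complex_of_real (\<Prod>a<k. e (nth_increasing n k i ! a)) \<cdot>\<^sub>v v"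
    by (rule similar_to_rdiag_eigenvector[OF similar_to_rdiag_compound[OF XY] i(1)])
  then have eq: "(mat_powr (mat_powr (?c D) (a / 2) * mat_powr (?c C) t * mat_powr (?c D) (a / 2)) p *
      mat_powr (mat_powr (?c D) ((1 - a) / 2) * mat_powr (?c C) (1 - t) * mat_powr (?c D) ((1 - a) / 2)) p) *\<^sub>v v =
      complex_of_real (\<Prod>a<k. e a) \<cdot>\<^sub>v v"
    using XYc by (simp add: compound_mult comp i(2))
  have Zc: "?c (mat_powr D (1 / 2) * C * mat_powr D (1 / 2)) = mat_powr (?c D) (1 / 2) * ?c C * mat_powr (?c D) (1 / 2)"
    using car by (simp add: compound_mat_powr[OF D] compound_mult)
  note SZ = compound_spectral_form[OF Z, of k, unfolded Zc]
  have one: "spectral_form ?N (1\<^sub>m ?N) (?c U) (\<lambda>_. 1)"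
    using SZ by (intro spectral_form_one) (simp add: spectral_form_def)
  have top: "(\<Prod>a<k. z (nth_increasing n k j ! a)) \<le> (\<Prod>a<k. z a)" if j: "j < ?N" for j
  proof (rule prod_mono)
    fix b assume b: "b \<in> {..<k}"
    note J = nth_increasing_in[OF j]
    have "nth_increasing n k j ! b < n" "b \<le> nth_increasing n k j ! b"
      using increasing_listsD(5)[OF J] increasing_lists_nth_ge[OF J] b by auto
    then show "0 \<le> z (nth_increasing n k j ! b) \<and> z (nth_increasing n k j ! b) \<le> z b"
      using z less_imp_le by blast
  qed
  have "loewner_le ?N (mat_powr (?c D) (1 / 2) * ?c C * mat_powr (?c D) (1 / 2))
      (complex_of_real (\<Prod>i<k. z i) \<cdot>\<^sub>m 1\<^sub>m ?N)"
    unfolding loewner_le_def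
  proof
    fix w :: "complex vec" assume w: "w \<in> carrier_vec ?N"
    show "qform (mat_powr (?c D) (1 / 2) * ?c C * mat_powr (?c D) (1 / 2)) w \<le>
        qform (complex_of_real (\<Prod>i<k. z i) \<cdot>\<^sub>m 1\<^sub>m ?N) w"
      unfolding spectral_form_qform[OF SZ w] spectral_form_qform[OF spectral_form_smult[OF one] w]
      using top by (intro sum_mono mult_right_mono) auto
  qed
  moreover have "(\<Prod>i<k. z i) > 0" using z k by (intro prod_pos) auto
  ultimately show ?thesis
    using top_eigenvalue_bound[OF compound_pos_def[OF C] compound_pos_def[OF D] _ _ p a t v eq] by blast
qed

lemma pos_def_det:
  assumes "pos_def n A"
  obtains \<delta> where "\<delta> > 0" "det A = complex_of_real \<delta>" "\<And>x. det (mat_powr A x) = complex_of_real (\<delta> powr x)"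
proof (rule pos_def_powers[OF assms])
  fix U d assume d: "\<And>i. i < n \<Longrightarrow> 0 < d i" and S: "spectral_form n A U d"
    and P: "\<And>x. spectral_form n (mat_powr A x) U (\<lambda>i. d i powr x)"
  show thesis
  proof
    show "(\<Prod>i<n. d i) > 0" using d by (intro prod_pos) auto
    show "det A = complex_of_real (\<Prod>i<n. d i)"
      by (rule similar_to_rdiag_det[OF spectral_form_similar[OF S]])
    show "det (mat_powr A x) = complex_of_real ((\<Prod>i<n. d i) powr x)" for x
      unfolding prod_powr_distrib by (rule similar_to_rdiag_det[OF spectral_form_similar[OF P]])
  qed
qed

text \<open>With \<open>\<gamma> = det C\<close> and \<open>\<delta> = det D\<close>, both sides equal \<open>(\<delta> \<gamma>)^p\<close>.\<close>

lemma det_powr_product: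
  assumes C: "pos_def n C" and D: "pos_def n D"
    and XY: "similar_to_rdiag n
      (mat_powr (mat_powr D (a / 2) * mat_powr C t * mat_powr D (a / 2)) p *
       mat_powr (mat_powr D ((1 - a) / 2) * mat_powr C (1 - t) * mat_powr D ((1 - a) / 2)) p) S T e"
    and Z: "spectral_form n (mat_powr D (1 / 2) * C * mat_powr D (1 / 2)) U z"
  shows "(\<Prod>i<n. e i) = (\<Prod>i<n. z i) powr p"
proof -
  note car = mat_powr_carrier[OF C] mat_powr_carrier[OF D] pos_def_carrier[OF C]
  obtain \<gamma> where g: "\<gamma> > 0" "det C = complex_of_real \<gamma>" "\<And>x. det (mat_powr C x) = complex_of_real (\<gamma> powr x)"
    by (rule pos_def_det[OF C]) (rule that)
  obtain \<delta> where d: "\<delta> > 0" "det D = complex_of_real \<delta>" "\<And>x. det (mat_powr D x) = complex_of_real (\<delta> powr x)"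
    by (rule pos_def_det[OF D]) (rule that)
  have pd: "pos_def n (mat_powr D (x / 2) * mat_powr C y * mat_powr D (x / 2))" for x y
    by (rule powr_congruence_pos_def[OF D mat_powr_pos_def[OF C]])
  have detX: "det (mat_powr (mat_powr D (x / 2) * mat_powr C y * mat_powr D (x / 2)) p) =
      complex_of_real ((\<delta> powr x * \<gamma> powr y) powr p)" for x y
  proof -
    obtain \<xi> where x: "\<xi> > 0" "det (mat_powr D (x / 2) * mat_powr C y * mat_powr D (x / 2)) = complex_of_real \<xi>"
      "\<And>q. det (mat_powr (mat_powr D (x / 2) * mat_powr C y * mat_powr D (x / 2)) q) = complex_of_real (\<xi> powr q)"
      by (rule pos_def_det[OF pd[of x y]]) (rule that)
    have "complex_of_real \<xi> = complex_of_real (\<delta> powr (x / 2) * \<gamma> powr y * \<delta> powr (x / 2))"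
      unfolding x(2)[symmetric] using car by (simp add: det_mult[of _ n] g d)
    then have "\<xi> = \<delta> powr (x / 2) * \<delta> powr (x / 2) * \<gamma> powr y"
      unfolding of_real_eq_iff by (simp only: ac_simps)
    then have "\<xi> = \<delta> powr x * \<gamma> powr y" by (simp flip: powr_add)
    then show ?thesis using x(3) by simp
  qed
  have "complex_of_real (\<Prod>i<n. e i) =
      complex_of_real ((\<delta> powr a * \<gamma> powr t) powr p * (\<delta> powr (1 - a) * \<gamma> powr (1 - t)) powr p)"
    unfolding similar_to_rdiag_det[OF XY, symmetric]
    using mat_powr_carrier[OF pd] by (simp add: det_mult[of _ n] detX)
  then have "(\<Prod>i<n. e i) = (\<delta> powr a * \<gamma> powr t) powr p * (\<delta> powr (1 - a) * \<gamma> powr (1 - t)) powr p"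
    unfolding of_real_eq_iff .
  also have "\<dots> = ((\<delta> powr a * \<delta> powr (1 - a)) * (\<gamma> powr t * \<gamma> powr (1 - t))) powr p"
    by (simp add: powr_mult)
  also have "\<delta> powr a * \<delta> powr (1 - a) = \<delta>" using d by (simp flip: powr_add)
  also have "\<gamma> powr t * \<gamma> powr (1 - t) = \<gamma>" using g by (simp flip: powr_add)
  also have "\<delta> * \<gamma> = (\<Prod>i<n. z i)"
  proof -
    have "complex_of_real (\<Prod>i<n. z i) = complex_of_real (\<delta> powr (1 / 2) * \<gamma> * \<delta> powr (1 / 2))"
      unfolding similar_to_rdiag_det[OF spectral_form_similar[OF Z], symmetric]
      using car by (simp add: det_mult[of _ n] g d)
    then have "(\<Prod>i<n. z i) = \<delta> powr (1 / 2) * \<delta> powr (1 / 2) * \<gamma>"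
      unfolding of_real_eq_iff by (simp only: ac_simps)
    also have "\<delta> powr (1 / 2) * \<delta> powr (1 / 2) = \<delta>" using d by (simp flip: powr_add)
    finally show ?thesis ..
  qed
  finally show ?thesis .
qed

definition decreasing_spectrum :: "nat \<Rightarrow> complex mat \<Rightarrow> (nat \<Rightarrow> real) \<Rightarrow> bool" where
  "decreasing_spectrum n M e \<longleftrightarrow> (\<forall>i j. i \<le> j \<longrightarrow> j < n \<longrightarrow> e j \<le> e i) \<and> (\<forall>i<n. 0 \<le> e i) \<and>
     char_poly M = (\<Prod>x\<leftarrow>map e [0..<n]. [:- complex_of_real x, 1:])"

text \<open>The log-majorization in terms of explicit eigenvalue sequences. Since it includes that these
  are the roots of the characteristic polynomials, it also yields that the lists of
  eigenvalues exist, and it passes to limits.\<close>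

definition spectral_majorization ::
  "nat \<Rightarrow> real \<Rightarrow> complex mat \<Rightarrow> complex mat \<Rightarrow> (nat \<Rightarrow> real) \<Rightarrow> (nat \<Rightarrow> real) \<Rightarrow> bool" where
  "spectral_majorization n p M N e z \<longleftrightarrow> decreasing_spectrum n M e \<and> decreasing_spectrum n N z \<and>
     (\<forall>k\<le>n. (\<Prod>i<k. e i) \<le> (\<Prod>i<k. z i) powr p) \<and> (\<Prod>i<n. e i) = (\<Prod>i<n. z i) powr p"

lemma sharp_formula_pos_def:
  assumes "pos_def n A" "pos_def n B"
  shows "pos_def n (sharp_formula r t A B)"
  unfolding sharp_formula_def
  by (intro powr_congruence_pos_def mat_powr_pos_def assms)

text \<open>The substitution \<open>D = A^(r+s)\<close>, \<open>C = A^(-1/2) B A^(-1/2)\<close>, \<open>a = r/(r+s)\<close> reduces the claim to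
  the products in \<open>C\<close> and \<open>D\<close>; the bounds on \<open>t\<close> become
  \<open>a (p-1) \<le> t p \<le> a (p-1) + 1\<close>.\<close>

lemma pos_def_log_majorization:
  assumes A: "pos_def n A" and B: "pos_def n B"
    and p: "1 \<le> p" "p \<le> 2" and rs: "r * s > 0"
    and t: "(r * p - r) / ((r + s) * p) \<le> t" "t \<le> (r * p + s) / ((r + s) * p)"
  shows "\<exists>e z. spectral_majorization n p
    (mat_powr (sharp_formula r t A B) p * mat_powr (sharp_formula s (1 - t) A B) p)
    (powr_times_formula (r + s - 1) A B) e z"
proof -
  note car = mat_powr_carrier[OF A] pos_def_carrier[OF A] pos_def_carrier[OF B]
  define a where "a = r / (r + s)"
  define D where "D = mat_powr A (r + s)"
  define C where "C = mat_powr A (- 1 / 2) * B * mat_powr A (- 1 / 2)"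
  have D: "pos_def n D" unfolding D_def by (rule mat_powr_pos_def[OF A])
  have C: "pos_def n C" unfolding C_def by (rule powr_congruence_pos_def[OF A B])
  have rs0: "r + s \<noteq> 0" using rs by (auto simp: zero_less_mult_iff)
  have a: "0 \<le> a" "a \<le> 1"
    using rs by (auto simp: a_def zero_less_mult_iff field_simps)
  have exps: "(r + s) * (a / 2) = r / 2" "(r + s) * ((1 - a) / 2) = s / 2"
    using rs0 by (simp_all add: a_def field_simps)
  have "(r * p - r) / ((r + s) * p) = a * (p - 1) / p" "(r * p + s) / ((r + s) * p) = (a * (p - 1) + 1) / p"
    using rs0 p by (simp_all add: a_def divide_simps) (simp_all add: algebra_simps)
  then have "a * (p - 1) / p \<le> t" "t \<le> (a * (p - 1) + 1) / p"
    using t by simp_all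
  then have t': "a * (p - 1) \<le> t * p" "t * p \<le> a * (p - 1) + 1"
    using p by (simp_all add: pos_divide_le_eq pos_le_divide_eq)
  have X: "sharp_formula r t A B = mat_powr D (a / 2) * mat_powr C t * mat_powr D (a / 2)"
    unfolding sharp_formula_def D_def C_def mat_powr_powr[OF A] exps ..
  have Y: "sharp_formula s (1 - t) A B = mat_powr D ((1 - a) / 2) * mat_powr C (1 - t) * mat_powr D ((1 - a) / 2)"
    unfolding sharp_formula_def D_def C_def mat_powr_powr[OF A] exps ..
  obtain S T e where ST: "similar_to_rdiag n
      (mat_powr (mat_powr D (a / 2) * mat_powr C t * mat_powr D (a / 2)) p *
       mat_powr (mat_powr D ((1 - a) / 2) * mat_powr C (1 - t) * mat_powr D ((1 - a) / 2)) p) S T e"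
    and e: "\<And>i j. i \<le> j \<Longrightarrow> j < n \<Longrightarrow> e j \<le> e i" "\<And>i. i < n \<Longrightarrow> 0 < e i"
    by (rule pos_def_mult_similar[OF mat_powr_pos_def[OF powr_congruence_pos_def[OF D mat_powr_pos_def[OF C]]]
        mat_powr_pos_def[OF powr_congruence_pos_def[OF D mat_powr_pos_def[OF C]]]]) (rule that)
  obtain U z where U: "spectral_form n (mat_powr D (1 / 2) * C * mat_powr D (1 / 2)) U z"
    and z: "\<forall>i j. i \<le> j \<longrightarrow> j < n \<longrightarrow> z j \<le> z i" "\<forall>i<n. 0 < z i"
    using pos_def_spectral_form[OF powr_congruence_pos_def[OF D C, of "1 / 2"]] by blast
  \<comment> \<open>Conjugation by \<open>A^q\<close> makes \<open>A^(r+s-1) B\<close> Hermitian: it becomes \<open>A^q B A^q\<close>.\<close>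
  define q where "q = (r + s - 1) / 2"
  have "mat_powr A q * (mat_powr D (1 / 2) * C * mat_powr D (1 / 2)) * mat_powr A (- q) =
      powr_times_formula (r + s - 1) A B"
  proof -
    have "mat_powr A q * (mat_powr D (1 / 2) * C * mat_powr D (1 / 2)) * mat_powr A (- q) =
        mat_powr A (q + ((r + s) / 2 - 1 / 2)) * (B * mat_powr A ((r + s) / 2 - 1 / 2 - q))"
      using car by (simp add: D_def C_def mat_powr_powr[OF A] square_assoc[where n = n]
          mat_powr_mult_left[OF A] mat_powr_mult[OF A])
    also have "q + ((r + s) / 2 - 1 / 2) = r + s - 1" by (simp add: q_def field_simps)
    also have "(r + s) / 2 - 1 / 2 - q = 0" by (simp add: q_def field_simps)
    finally show ?thesis
      using car by (simp add: powr_times_formula_def mat_powr_zero[OF A])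
  qed
  then have "similar_to_rdiag n (powr_times_formula (r + s - 1) A B) (mat_powr A q * U) (U\<^sup>\<dagger> * mat_powr A (- q)) z"
    using similar_to_rdiag_conj[OF spectral_form_similar[OF U], of "mat_powr A q" "mat_powr A (- q)"] car
    by (simp add: mat_powr_mult[OF A] mat_powr_zero[OF A])
  then have "decreasing_spectrum n (powr_times_formula (r + s - 1) A B) z"
    using z by (simp add: decreasing_spectrum_def similar_to_rdiag_char_poly less_imp_le)
  moreover have "decreasing_spectrum n
      (mat_powr (mat_powr D (a / 2) * mat_powr C t * mat_powr D (a / 2)) p *
       mat_powr (mat_powr D ((1 - a) / 2) * mat_powr C (1 - t) * mat_powr D ((1 - a) / 2)) p) e"
    using e by (simp add: decreasing_spectrum_def similar_to_rdiag_char_poly[OF ST] less_imp_le)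
  moreover have "\<forall>k\<le>n. (\<Prod>i<k. e i) \<le> (\<Prod>i<k. z i) powr p"
    using prod_top_eigenvalues_le[OF C D p a t' ST U] z by simp
  moreover have "(\<Prod>i<n. e i) = (\<Prod>i<n. z i) powr p"
    by (rule det_powr_product[OF C D ST U])
  ultimately show ?thesis
    unfolding X Y spectral_majorization_def by (intro exI[of _ e] exI[of _ z] conjI)
qed

section \<open>Limits of matrices and of their spectra\<close>

text \<open>Indexing by a finite set of sequences makes it possible to treat matrix entries and eigenvalues
  alike.\<close>

lemma finite_bounded_convergent_subsequence:
  fixes F :: "(nat \<Rightarrow> real) set"
  assumes "finite F" "\<And>f. f \<in> F \<Longrightarrow> Bseq f"
  shows "\<exists>r. strict_mono r \<and> (\<forall>f\<in>F. convergent (\<lambda>m. f (r m)))"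
  using assms
proof (induction F)
  case empty
  then show ?case by (intro exI[of _ id]) (auto simp: strict_mono_def)
next
  case (insert f F)
  then obtain r where r: "strict_mono r" "\<And>g. g \<in> F \<Longrightarrow> convergent (\<lambda>m. g (r m))" by auto
  obtain q :: "nat \<Rightarrow> nat" where q: "strict_mono q" "monoseq (\<lambda>m. f (r (q m)))"
    using seq_monosub[of "\<lambda>m. f (r m)"] by blast
  have "Bseq (\<lambda>m. f (r (q m)))"
    using Bseq_subseq[of f "\<lambda>m. r (q m)"] insert.prems by simp
  then have "convergent (\<lambda>m. f (r (q m)))"
    using q(2) Bseq_monoseq_convergent by blast
  moreover have "convergent (\<lambda>m. g (r (q m)))" if "g \<in> F" for g
    using convergent_subseq_convergent[OF r(2)[OF that] q(1)] by (simp add: o_def)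
  ultimately show ?case
    using strict_mono_o[OF r(1) q(1)] by (intro exI[of _ "\<lambda>m. r (q m)"]) (auto simp: o_def)
qed

definition mat_tendsto :: "nat \<Rightarrow> (nat \<Rightarrow> complex mat) \<Rightarrow> complex mat \<Rightarrow> bool" where
  "mat_tendsto n M L \<longleftrightarrow> (\<forall>i<n. \<forall>j<n. (\<lambda>m. M m $$ (i, j)) \<longlonglongrightarrow> L $$ (i, j))"

lemma mat_tendstoD: "mat_tendsto n M L \<Longrightarrow> i < n \<Longrightarrow> j < n \<Longrightarrow> (\<lambda>m. M m $$ (i, j)) \<longlonglongrightarrow> L $$ (i, j)"
  by (simp add: mat_tendsto_def)

lemma mat_tendsto_subseq: "mat_tendsto n M L \<Longrightarrow> strict_mono r \<Longrightarrow> mat_tendsto n (\<lambda>m. M (r m)) L"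
  unfolding mat_tendsto_def
  using LIMSEQ_subseq_LIMSEQ[of "\<lambda>m. M m $$ (_, _)" _ r] by (simp add: o_def)

lemma mat_tendsto_unique:
  assumes "mat_tendsto n M L" "mat_tendsto n M L'" "L \<in> carrier_mat n n" "L' \<in> carrier_mat n n"
  shows "L = L'"
proof (rule eq_matI)
  fix i j assume "i < dim_row L'" "j < dim_col L'"
  then have "i < n" "j < n" using assms(4) by auto
  from LIMSEQ_unique[OF mat_tendstoD[OF assms(1) this] mat_tendstoD[OF assms(2) this]]
  show "L $$ (i, j) = L' $$ (i, j)" .
qed (use assms in auto)

lemma mat_tendsto_const: "mat_tendsto n (\<lambda>_. L) L"
  by (simp add: mat_tendsto_def)

lemma mat_tendsto_mult:
  assumes M: "mat_tendsto n M K" and N: "mat_tendsto n N L"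
    and car: "\<And>m. M m \<in> carrier_mat n n" "\<And>m. N m \<in> carrier_mat n n" "K \<in> carrier_mat n n" "L \<in> carrier_mat n n"
  shows "mat_tendsto n (\<lambda>m. M m * N m) (K * L)"
  unfolding mat_tendsto_def
proof (intro allI impI)
  fix i j assume ij: "i < n" "j < n"
  have prod: "(P * Q) $$ (i, j) = (\<Sum>l<n. P $$ (i, l) * Q $$ (l, j))"
    if "P \<in> carrier_mat n n" "Q \<in> carrier_mat n n" for P Q :: "complex mat"
    using that ij by (simp add: scalar_prod_def atLeast0LessThan)
  show "(\<lambda>m. (M m * N m) $$ (i, j)) \<longlonglongrightarrow> (K * L) $$ (i, j)"
    unfolding prod[OF car(1) car(2)] prod[OF car(3,4)]
    using ij M N by (intro tendsto_intros) (auto intro: mat_tendstoD)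
qed

lemma mat_tendsto_adjoint:
  assumes "mat_tendsto n M L" "\<And>m. M m \<in> carrier_mat n n" "L \<in> carrier_mat n n"
  shows "mat_tendsto n (\<lambda>m. (M m)\<^sup>\<dagger>) (L\<^sup>\<dagger>)"
  unfolding mat_tendsto_def
proof (intro allI impI)
  fix i j assume ij: "i < n" "j < n"
  have adj: "P\<^sup>\<dagger> $$ (i, j) = cnj (P $$ (j, i))" if "P \<in> carrier_mat n n" for P :: "complex mat"
    using that ij adjoint_index[of i P j] by simp
  show "(\<lambda>m. (M m)\<^sup>\<dagger> $$ (i, j)) \<longlonglongrightarrow> L\<^sup>\<dagger> $$ (i, j)"
    unfolding adj[OF assms(2)] adj[OF assms(3)]
    using ij assms(1) by (intro tendsto_cnj) (auto intro: mat_tendstoD)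
qed

lemma mat_tendsto_rdiag:
  assumes "\<And>i. i < n \<Longrightarrow> (\<lambda>m. d m i) \<longlonglongrightarrow> l i"
  shows "mat_tendsto n (\<lambda>m. rdiag n (d m)) (rdiag n l)"
  unfolding mat_tendsto_def mat_diag_def
  using assms by (auto intro!: tendsto_of_real)

text \<open>The value of the characteristic polynomial at a point is a polynomial in the entries.\<close>

lemma tendsto_poly_char_poly:
  assumes "mat_tendsto n M L" "\<And>m. M m \<in> carrier_mat n n" "L \<in> carrier_mat n n"
  shows "(\<lambda>m. poly (char_poly (M m)) x) \<longlonglongrightarrow> poly (char_poly L) x"
proof -
  have eq: "poly (char_poly P) x = (\<Sum>p | p permutes {0..<n}. signof p *
      (\<Prod>i = 0..<n. (if i = p i then x else 0) - P $$ (i, p i)))" if P: "P \<in> carrier_mat n n" for P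
  proof -
    have "(- char_matrix P x) $$ (i, p i) = (if i = p i then x else 0) - P $$ (i, p i)"
      if "i < n" "p permutes {0..<n}" for i p
      using that P permutes_in_image[of p "{0..<n}" i] by (auto simp: char_matrix_def)
    moreover have "- char_matrix P x \<in> carrier_mat n n" using P by (simp add: char_matrix_def)
    ultimately show ?thesis
      unfolding char_poly_matrix[OF P] by (auto simp: det_def' intro!: sum.cong prod.cong)
  qed
  show ?thesis
    unfolding eq[OF assms(2)] eq[OF assms(3)]
  proof (intro tendsto_sum tendsto_mult tendsto_prod tendsto_diff tendsto_const)
    fix p i assume "p \<in> {p. p permutes {0..<n}}" "i \<in> {0..<n}"
    then show "(\<lambda>m. M m $$ (i, p i)) \<longlonglongrightarrow> L $$ (i, p i)"
      using permutes_in_image[of p "{0..<n}" i] assms(1) by (intro mat_tendstoD) auto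
  qed
qed

lemma poly_linear_factors:
  "poly (\<Prod>x\<leftarrow>map e [0..<n]. [:- complex_of_real x, 1:]) y = (\<Prod>i<n. y - complex_of_real (e i))"
  by (induction n) (auto simp: algebra_simps)

text \<open>The eigenvalues are bounded because \<open>\<Prod>(1 + e_i)\<close>, the modulus of the characteristic polynomial
  at -1, converges, and each factor is at most the product. The limits of a convergent
  subsequence are the roots of the limit polynomial, since the polynomials converge pointwise.\<close>

lemma eigenvalues_convergent_subsequence:
  assumes M: "mat_tendsto n M L" "\<And>m. M m \<in> carrier_mat n n" "L \<in> carrier_mat n n"
    and cp: "\<And>m. char_poly (M m) = (\<Prod>x\<leftarrow>map (e m) [0..<n]. [:- complex_of_real x, 1:])"
    and e: "\<And>m i. i < n \<Longrightarrow> 0 \<le> e m i"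
  obtains r l where "strict_mono r" "\<And>i. i < n \<Longrightarrow> (\<lambda>m. e (r m) i) \<longlonglongrightarrow> l i"
    "char_poly L = (\<Prod>x\<leftarrow>map l [0..<n]. [:- complex_of_real x, 1:])"
proof -
  have norm_eq: "cmod (poly (char_poly (M m)) (- 1)) = (\<Prod>i<n. 1 + e m i)" for m
    unfolding cp poly_linear_factors prod_norm[symmetric]
  proof (rule prod.cong[OF refl])
    fix i assume "i \<in> {..<n}"
    then have "0 \<le> e m i" using e by simp
    moreover have "- 1 - complex_of_real (e m i) = complex_of_real (- 1 - e m i)" by simp
    then have "cmod (- 1 - complex_of_real (e m i)) = \<bar>- 1 - e m i\<bar>"
      by (simp only: norm_of_real)
    ultimately show "cmod (- 1 - complex_of_real (e m i)) = 1 + e m i" by simp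
  qed
  have "Bseq (\<lambda>m. poly (char_poly (M m)) (- 1))"
    by (rule convergent_imp_Bseq[OF convergentI[OF tendsto_poly_char_poly[OF M]]])
  then obtain K where "\<forall>m. cmod (poly (char_poly (M m)) (- 1)) \<le> K"
    by (rule BseqE)
  then have K: "(\<Prod>i<n. 1 + e m i) \<le> K" for m
    by (simp add: norm_eq)
  have "Bseq (\<lambda>m. e m i)" if i: "i < n" for i
  proof (rule BseqI')
    fix m
    have "1 + e m i \<le> (\<Prod>i<n. 1 + e m i)"
    proof -
      have "1 \<le> (\<Prod>j\<in>{..<n} - {i}. 1 + e m j)" using e by (intro prod_ge_1) auto
      then have "(1 + e m i) * 1 \<le> (1 + e m i) * (\<Prod>j\<in>{..<n} - {i}. 1 + e m j)"
        using e[OF i, of m] by (intro mult_left_mono) auto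
      also have "\<dots> = (\<Prod>i<n. 1 + e m i)" using i by (subst prod.remove[of _ i]) auto
      finally show ?thesis by simp
    qed
    then show "norm (e m i) \<le> K" using K[of m] e[OF i, of m] by simp
  qed
  then have "\<And>f. f \<in> (\<lambda>i m. e m i) ` {..<n} \<Longrightarrow> Bseq f" by auto
  from finite_bounded_convergent_subsequence[OF finite_imageI[OF finite_lessThan] this]
  obtain r where r: "strict_mono r" and "\<forall>f\<in>(\<lambda>i m. e m i) ` {..<n}. convergent (\<lambda>m. f (r m))"
    by blast
  then have conv: "convergent (\<lambda>m. e (r m) i)" if "i < n" for i
    using that by auto
  define l where "l i = lim (\<lambda>m. e (r m) i)" for i
  have l: "(\<lambda>m. e (r m) i) \<longlonglongrightarrow> l i" if "i < n" for i
    using conv[OF that] by (simp add: l_def convergent_LIMSEQ_iff)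
  have "poly (char_poly L) y = poly (\<Prod>x\<leftarrow>map l [0..<n]. [:- complex_of_real x, 1:]) y" for y
  proof (rule LIMSEQ_unique)
    show "(\<lambda>m. poly (char_poly (M (r m))) y) \<longlonglongrightarrow> poly (char_poly L) y"
      by (rule tendsto_poly_char_poly[OF mat_tendsto_subseq[OF M(1) r] M(2,3)])
    show "(\<lambda>m. poly (char_poly (M (r m))) y) \<longlonglongrightarrow> poly (\<Prod>x\<leftarrow>map l [0..<n]. [:- complex_of_real x, 1:]) y"
      unfolding cp poly_linear_factors using l by (intro tendsto_intros) auto
  qed
  then have "char_poly L = (\<Prod>x\<leftarrow>map l [0..<n]. [:- complex_of_real x, 1:])"
    by (intro poly_eq_poly_eq_iff[THEN iffD1] ext)
  from that[OF r l this] show thesis .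
qed

lemma unitary_entry_le_one:
  assumes "unitary n U" "i < n" "j < n"
  shows "cmod (U $$ (i, j)) \<le> 1"
proof -
  have U: "U \<in> carrier_mat n n" "U\<^sup>\<dagger> * U = 1\<^sub>m n" using assms by (auto simp: unitary_def)
  have "(U\<^sup>\<dagger> * U) $$ (j, j) = (\<Sum>l<n. cnj (U $$ (l, j)) * U $$ (l, j))"
    using U(1) assms by (auto simp: scalar_prod_def adjoint_index atLeast0LessThan)
  also have "\<dots> = complex_of_real (\<Sum>l<n. (cmod (U $$ (l, j)))\<^sup>2)"
    by (simp add: mult.commute flip: complex_norm_square)
  finally have "complex_of_real (\<Sum>l<n. (cmod (U $$ (l, j)))\<^sup>2) = complex_of_real 1"
    using U assms by simp
  then have "(\<Sum>l<n. (cmod (U $$ (l, j)))\<^sup>2) = 1" unfolding of_real_eq_iff .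
  moreover have "(cmod (U $$ (i, j)))\<^sup>2 \<le> (\<Sum>l<n. (cmod (U $$ (l, j)))\<^sup>2)"
    using assms by (intro member_le_sum) auto
  ultimately show ?thesis by (simp add: power_le_one_iff abs_square_le_1)
qed

text \<open>Eigenvalues and entries of unitary matrices are bounded, so along a subsequence the whole
  diagonalisation converges, to a diagonalisation of the limit. Powers are then
  limits of diagonal powers, since \<open>c \<mapsto> c^p\<close> is continuous on \<open>[0, \<infinity>)\<close> for
  \<open>p > 0\<close>.\<close>

lemma mat_powr_convergent_subsequence:
  assumes X: "mat_tendsto n X L" "L \<in> carrier_mat n n" and pd: "\<And>m. pos_def n (X m)" and p: "p > 0"
  obtains r where "strict_mono r" "mat_tendsto n (\<lambda>m. mat_powr (X (r m)) p) (mat_powr L p)"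
    "mat_powr L p \<in> carrier_mat n n"
proof -
  define P where "P m W = (spectral_form n (X m) (fst W) (snd W) \<and> (\<forall>i<n. 0 < snd W i))" for m W
  have "\<forall>m. \<exists>W. P m W"
  proof
    fix m
    obtain U d where "spectral_form n (X m) U d" "\<forall>i<n. 0 < d i"
      using pos_def_spectral_form[OF pd[of m]] by blast
    then have "P m (U, d)" by (simp add: P_def)
    then show "\<exists>W. P m W" by blast
  qed
  from choice[OF this] obtain W where W: "\<And>m. P m (W m)" by blast
  define U where "U m = fst (W m)" for m
  define d where "d m = snd (W m)" for m
  have S: "spectral_form n (X m) (U m) (d m)" for m
    using W by (simp add: P_def U_def d_def)
  have d: "0 < d m i" if "i < n" for m i
    using W that by (simp add: P_def d_def)
  have d0: "0 \<le> d m i" if "i < n" for m i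
    using d[OF that] by (rule less_imp_le)
  have Xc: "X m \<in> carrier_mat n n" for m using pd by (rule pos_def_carrier)
  have cp: "char_poly (X m) = (\<Prod>x\<leftarrow>map (d m) [0..<n]. [:- complex_of_real x, 1:])" for m
    by (rule similar_to_rdiag_char_poly[OF spectral_form_similar[OF S]])
  obtain r l where r: "strict_mono r" and l: "\<And>i. i < n \<Longrightarrow> (\<lambda>m. d (r m) i) \<longlonglongrightarrow> l i"
    by (rule eigenvalues_convergent_subsequence[OF X(1) Xc X(2) cp], erule d0) (rule that)
  have U: "unitary n (U m)" for m using S by (simp add: spectral_form_def)
  define F where "F = (\<lambda>(i, j) m. Re (U (r m) $$ (i, j))) ` ({..<n} \<times> {..<n}) \<union>
    (\<lambda>(i, j) m. Im (U (r m) $$ (i, j))) ` ({..<n} \<times> {..<n})"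
  have "Bseq f" if "f \<in> F" for f
  proof (rule BseqI'[of _ 1])
    fix m
    from \<open>f \<in> F\<close> obtain i j where "i < n" "j < n"
      and "f = (\<lambda>m. Re (U (r m) $$ (i, j))) \<or> f = (\<lambda>m. Im (U (r m) $$ (i, j)))"
      by (auto simp: F_def)
    then have "i < n" "j < n" "norm (f m) \<le> cmod (U (r m) $$ (i, j))"
      by (auto simp: abs_Re_le_cmod abs_Im_le_cmod)
    then show "norm (f m) \<le> 1"
      using unitary_entry_le_one[OF U, of i j "r m"] by linarith
  qed
  moreover have "finite F" by (simp add: F_def)
  ultimately obtain q where q: "strict_mono q" "\<forall>f\<in>F. convergent (\<lambda>m. f (q m))"
    using finite_bounded_convergent_subsequence by blast
  define R where "R m = r (q m)" for m
  have R: "strict_mono R" using strict_mono_o[OF r q(1)] by (simp add: R_def[abs_def] o_def)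
  have conv: "convergent (\<lambda>m. U (R m) $$ (i, j))" if "i < n" "j < n" for i j
  proof -
    have "(\<lambda>m. Re (U (r m) $$ (i, j))) \<in> F" "(\<lambda>m. Im (U (r m) $$ (i, j))) \<in> F"
      using that by (auto simp: F_def intro!: image_eqI[of _ _ "(i, j)"])
    then have "convergent (\<lambda>m. Re (U (R m) $$ (i, j)))" "convergent (\<lambda>m. Im (U (R m) $$ (i, j)))"
      using q(2) by (auto simp: R_def)
    then obtain a b where "(\<lambda>m. Re (U (R m) $$ (i, j))) \<longlonglongrightarrow> a" "(\<lambda>m. Im (U (R m) $$ (i, j))) \<longlonglongrightarrow> b"
      by (auto simp: convergent_def)
    then have "(\<lambda>m. U (R m) $$ (i, j)) \<longlonglongrightarrow> Complex a b"
      by (simp add: tendsto_complex_iff)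
    then show ?thesis by (rule convergentI)
  qed
  define V where "V = mat n n (\<lambda>(i, j). lim (\<lambda>m. U (R m) $$ (i, j)))"
  have V: "V \<in> carrier_mat n n" by (simp add: V_def)
  have Uc: "U m \<in> carrier_mat n n" for m using U by (rule unitary_carrier)
  have UV: "mat_tendsto n (\<lambda>m. U (R m)) V"
    using conv by (auto simp: mat_tendsto_def V_def convergent_LIMSEQ_iff)
  have lR: "(\<lambda>m. d (R m) i) \<longlonglongrightarrow> l i" if "i < n" for i
    using LIMSEQ_subseq_LIMSEQ[OF l[OF that] q(1)] by (simp add: o_def R_def)
  have l0: "0 \<le> l i" if "i < n" for i
    using lR[OF that] less_imp_le[OF d[OF that]] by (intro LIMSEQ_le_const) auto
  have UVH: "mat_tendsto n (\<lambda>m. (U (R m))\<^sup>\<dagger>) (V\<^sup>\<dagger>)"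
    using Uc V by (intro mat_tendsto_adjoint[OF UV])
  have "mat_tendsto n (\<lambda>m. (U (R m))\<^sup>\<dagger> * U (R m)) (V\<^sup>\<dagger> * V)"
    using Uc V by (intro mat_tendsto_mult[OF UVH UV]) auto
  then have "mat_tendsto n (\<lambda>m. 1\<^sub>m n) (V\<^sup>\<dagger> * V)"
    using unitary_left[OF U] by simp
  then have VV: "V\<^sup>\<dagger> * V = 1\<^sub>m n"
    using V by (intro mat_tendsto_unique[OF _ mat_tendsto_const]) auto
  have conj: "mat_tendsto n (\<lambda>m. U (R m) * rdiag n (f m) * (U (R m))\<^sup>\<dagger>) (V * rdiag n g * V\<^sup>\<dagger>)"
    if "\<And>i. i < n \<Longrightarrow> (\<lambda>m. f m i) \<longlonglongrightarrow> g i" for f g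
    using Uc V by (intro mat_tendsto_mult UV UVH mat_tendsto_rdiag that) auto
  have "mat_tendsto n (\<lambda>m. X (R m)) (V * rdiag n l * V\<^sup>\<dagger>)"
    using conj[OF lR] S by (simp add: spectral_form_def)
  then have "L = V * rdiag n l * V\<^sup>\<dagger>"
    using V X(2) by (intro mat_tendsto_unique[OF mat_tendsto_subseq[OF X(1) R]]) auto
  then have SL: "spectral_form n L V l"
    using V VV by (simp add: spectral_form_def unitary_def)
  note SLp = spectral_form_mat_powr[OF SL l0, of p]
  have "mat_tendsto n (\<lambda>m. U (R m) * rdiag n (\<lambda>i. d (R m) i powr p) * (U (R m))\<^sup>\<dagger>)
      (V * rdiag n (\<lambda>i. l i powr p) * V\<^sup>\<dagger>)"
  proof (rule conj)
    fix i assume i: "i < n"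
    show "(\<lambda>m. d (R m) i powr p) \<longlonglongrightarrow> l i powr p"
      using p less_imp_le[OF d[OF i]] by (intro tendsto_powr' lR i tendsto_const) auto
  qed
  moreover have "mat_powr (X (R m)) p = U (R m) * rdiag n (\<lambda>i. d (R m) i powr p) * (U (R m))\<^sup>\<dagger>" for m
    using spectral_form_mat_powr[OF S less_imp_le[OF d]] by (simp add: spectral_form_def)
  ultimately have "mat_tendsto n (\<lambda>m. mat_powr (X (R m)) p) (mat_powr L p)"
    using SLp by (simp add: spectral_form_def)
  with R show thesis using that[of R] spectral_form_carrier[OF SLp] by blast
qed

lemma sorted_wrt_map_upt:
  assumes "\<And>i j. i \<le> j \<Longrightarrow> j < n \<Longrightarrow> e j \<le> e i"
  shows "sorted_wrt (\<ge>) (map (e :: nat \<Rightarrow> real) [0..<n])"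
  using assms by (auto simp: sorted_wrt_iff_nth_less)

lemma log_majorized_eigs:
  assumes "spectral_majorization n p M N e z"
  shows "eigs M \<prec>\<^sub>l\<^sub>o\<^sub>g list_powr (eigs N) p"
proof -
  have eM: "eigs M = map e [0..<n]" and eN: "eigs N = map z [0..<n]"
    using assms unfolding spectral_majorization_def decreasing_spectrum_def
    by (auto intro!: eigs_eqI sorted_wrt_map_upt)
  have "(\<Prod>i<k. map e [0..<n] ! i) = (\<Prod>i<k. e i)"
    "(\<Prod>i<k. list_powr (map z [0..<n]) p ! i) = (\<Prod>i<k. z i) powr p" if "k \<le> n" for k
    using that by (auto simp: list_powr_def prod_powr_distrib intro!: prod.cong)
  then show ?thesis
    unfolding eM eN log_majorized_def using assms by (auto simp: list_powr_def spectral_majorization_def)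
qed

text \<open>Four successive subsequences make the powers of \<open>X\<close>, the powers of \<open>Y\<close>, the eigenvalues of the
  product and the eigenvalues of \<open>Z\<close> converge. The limits are again eigenvalue sequences, and
  the inequalities and the equality between products are preserved.\<close>

lemma log_majorization_limit:
  assumes X: "mat_tendsto n X X'" "X' \<in> carrier_mat n n" "\<And>m. pos_def n (X m)"
    and Y: "mat_tendsto n Y Y'" "Y' \<in> carrier_mat n n" "\<And>m. pos_def n (Y m)"
    and Z: "mat_tendsto n Z Z'" "Z' \<in> carrier_mat n n" "\<And>m. Z m \<in> carrier_mat n n"
    and p: "p > 0"
    and ex: "\<And>m. \<exists>e z. spectral_majorization n p (mat_powr (X m) p * mat_powr (Y m) p) (Z m) e z"
  shows "eigs (mat_powr X' p * mat_powr Y' p) \<prec>\<^sub>l\<^sub>o\<^sub>g list_powr (eigs Z') p"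
proof -
  have "\<forall>m. \<exists>w. spectral_majorization n p (mat_powr (X m) p * mat_powr (Y m) p) (Z m) (fst w) (snd w)"
    using ex by simp
  from choice[OF this] obtain w where
    w: "\<And>m. spectral_majorization n p (mat_powr (X m) p * mat_powr (Y m) p) (Z m) (fst (w m)) (snd (w m))"
    by blast
  define e where "e m = fst (w m)" for m
  define z where "z m = snd (w m)" for m
  note ez = w[folded e_def z_def, unfolded spectral_majorization_def decreasing_spectrum_def]
  have e: "e m j \<le> e m i" and z: "z m j \<le> z m i" if "i \<le> j" "j < n" for m i j
    using ez[of m] that by auto
  have e0: "0 \<le> e m i" and z0m: "0 \<le> z m i" if "i < n" for m i
    using ez[of m] that by auto
  have cpXY: "char_poly (mat_powr (X m) p * mat_powr (Y m) p) = (\<Prod>x\<leftarrow>map (e m) [0..<n]. [:- complex_of_real x, 1:])"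
    and cpZ: "char_poly (Z m) = (\<Prod>x\<leftarrow>map (z m) [0..<n]. [:- complex_of_real x, 1:])" for m
    using ez[of m] by blast+
  have le: "(\<Prod>i<k. e m i) \<le> (\<Prod>i<k. z m i) powr p" if "k \<le> n" for m k
    using ez[of m] that by blast
  have eq: "(\<Prod>i<n. e m i) = (\<Prod>i<n. z m i) powr p" for m
    using ez[of m] by blast
  obtain r1 where r1: "strict_mono r1" "mat_tendsto n (\<lambda>m. mat_powr (X (r1 m)) p) (mat_powr X' p)"
    and Xp: "mat_powr X' p \<in> carrier_mat n n"
    by (rule mat_powr_convergent_subsequence[OF X p]) (rule that)
  obtain r2 where r2: "strict_mono r2" "mat_tendsto n (\<lambda>m. mat_powr (Y (r1 (r2 m))) p) (mat_powr Y' p)"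
    and Yp: "mat_powr Y' p \<in> carrier_mat n n"
    by (rule mat_powr_convergent_subsequence[OF mat_tendsto_subseq[OF Y(1) r1(1)] Y(2) Y(3) p]) (rule that)
  have pc: "mat_powr (X m) p \<in> carrier_mat n n" "mat_powr (Y m) p \<in> carrier_mat n n" for m
    using X(3) Y(3) by (auto intro: mat_powr_carrier)
  have lim: "mat_tendsto n (\<lambda>m. mat_powr (X (r1 (r2 m))) p * mat_powr (Y (r1 (r2 m))) p) (mat_powr X' p * mat_powr Y' p)"
    using pc Xp Yp by (intro mat_tendsto_mult r2(2) mat_tendsto_subseq[OF r1(2) r2(1)])
  obtain r3 e' where r3: "strict_mono r3" and e3: "\<And>i. i < n \<Longrightarrow> (\<lambda>m. e (r1 (r2 (r3 m))) i) \<longlonglongrightarrow> e' i"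
    and cp': "char_poly (mat_powr X' p * mat_powr Y' p) = (\<Prod>x\<leftarrow>map e' [0..<n]. [:- complex_of_real x, 1:])"
    by (rule eigenvalues_convergent_subsequence[OF lim _ _ cpXY], (simp add: pc Xp Yp)+, erule e0) (rule that)
  define r where "r m = r1 (r2 (r3 m))" for m
  have r: "strict_mono r"
    using strict_mono_o[OF r1(1) strict_mono_o[OF r2(1) r3]] by (simp add: r_def[abs_def] o_def)
  obtain r4 z' where r4: "strict_mono r4" and z4: "\<And>i. i < n \<Longrightarrow> (\<lambda>m. z (r (r4 m)) i) \<longlonglongrightarrow> z' i"
    and cpZ': "char_poly Z' = (\<Prod>x\<leftarrow>map z' [0..<n]. [:- complex_of_real x, 1:])"
    by (rule eigenvalues_convergent_subsequence[OF mat_tendsto_subseq[OF Z(1) r] Z(3) Z(2) cpZ], erule z0m) (rule that)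
  have e4: "(\<lambda>m. e (r (r4 m)) i) \<longlonglongrightarrow> e' i" if "i < n" for i
    using LIMSEQ_subseq_LIMSEQ[OF e3[OF that] r4] by (simp add: o_def r_def)
  have z0: "0 \<le> z' i" if "i < n" for i
    using z4[OF that] z0m[OF that] by (intro LIMSEQ_le_const) auto
  have pe: "(\<lambda>m. \<Prod>i<k. e (r (r4 m)) i) \<longlonglongrightarrow> (\<Prod>i<k. e' i)" if "k \<le> n" for k
    using that by (intro tendsto_prod e4) auto
  have pz: "(\<lambda>m. (\<Prod>i<k. z (r (r4 m)) i) powr p) \<longlonglongrightarrow> (\<Prod>i<k. z' i) powr p" if "k \<le> n" for k
  proof (rule tendsto_powr'[OF _ tendsto_const])
    show "(\<lambda>m. \<Prod>i<k. z (r (r4 m)) i) \<longlonglongrightarrow> (\<Prod>i<k. z' i)"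
      using that by (intro tendsto_prod z4) auto
    have "0 \<le> (\<Prod>i<k. z (r (r4 m)) i)" for m
      using that z0m by (intro prod_nonneg) auto
    then show "(\<Prod>i<k. z' i) \<noteq> 0 \<or> 0 < p \<and> (\<forall>\<^sub>F m in sequentially. 0 \<le> (\<Prod>i<k. z (r (r4 m)) i))"
      using p by simp
  qed
  have "e' j \<le> e' i" "z' j \<le> z' i" if "i \<le> j" "j < n" for i j
    using that e z by (auto intro!: LIMSEQ_le[OF e4 e4] LIMSEQ_le[OF z4 z4])
  moreover have "0 \<le> e' i" if "i < n" for i
    using e4[OF that] e0[OF that] by (intro LIMSEQ_le_const) auto
  moreover have "(\<Prod>i<k. e' i) \<le> (\<Prod>i<k. z' i) powr p" if "k \<le> n" for k
    using le that by (intro LIMSEQ_le[OF pe pz]) auto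
  moreover have "(\<Prod>i<n. e' i) = (\<Prod>i<n. z' i) powr p"
    using pe[of n] pz[of n] by (intro LIMSEQ_unique) (auto simp: eq)
  ultimately have "spectral_majorization n p (mat_powr X' p * mat_powr Y' p) Z' e' z'"
    unfolding spectral_majorization_def decreasing_spectrum_def using cp' cpZ' z0 by simp
  then show ?thesis by (rule log_majorized_eigs)
qed

section \<open>Positive semi-definite matrices\<close>

lemma pos_semidef_regularized:
  assumes "pos_semidef n A" "\<epsilon> > 0"
  shows "pos_def n (A + complex_of_real \<epsilon> \<cdot>\<^sub>m 1\<^sub>m n)"
  unfolding pos_def_def
proof (intro conjI ballI impI)
  have A: "A \<in> carrier_mat n n" "A\<^sup>\<dagger> = A" using assms by (auto simp: pos_semidef_def)
  show "A + complex_of_real \<epsilon> \<cdot>\<^sub>m 1\<^sub>m n \<in> carrier_mat n n" using A by simp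
  show "(A + complex_of_real \<epsilon> \<cdot>\<^sub>m 1\<^sub>m n)\<^sup>\<dagger> = A + complex_of_real \<epsilon> \<cdot>\<^sub>m 1\<^sub>m n"
  proof (rule eq_matI)
    fix i j
    assume "i < dim_row (A + complex_of_real \<epsilon> \<cdot>\<^sub>m 1\<^sub>m n)" "j < dim_col (A + complex_of_real \<epsilon> \<cdot>\<^sub>m 1\<^sub>m n)"
    then have ij: "i < n" "j < n" by auto
    have "cnj (A $$ (j, i)) = A $$ (i, j)"
      using adjoint_index[of i A j] ij A by simp
    then show "(A + complex_of_real \<epsilon> \<cdot>\<^sub>m 1\<^sub>m n)\<^sup>\<dagger> $$ (i, j) = (A + complex_of_real \<epsilon> \<cdot>\<^sub>m 1\<^sub>m n) $$ (i, j)"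
      using ij A(1) by (auto simp: adjoint_index)
  qed (use A in auto)
  fix v :: "complex vec" assume v: "v \<in> carrier_vec n" "v \<noteq> 0\<^sub>v n"
  have "(A + complex_of_real \<epsilon> \<cdot>\<^sub>m 1\<^sub>m n) *\<^sub>v v = A *\<^sub>v v + complex_of_real \<epsilon> \<cdot>\<^sub>v v"
    using A v by (simp add: add_mult_distrib_mat_vec[of _ n n] square_smult_vec[where n = n])
  also have "(A *\<^sub>v v + complex_of_real \<epsilon> \<cdot>\<^sub>v v) \<bullet>c v = (A *\<^sub>v v) \<bullet>c v + complex_of_real \<epsilon> * (v \<bullet>c v)"
    using A v by (simp add: add_scalar_prod_distrib[of _ n])
  finally show "0 < Re (((A + complex_of_real \<epsilon> \<cdot>\<^sub>m 1\<^sub>m n) *\<^sub>v v) \<bullet>c v)"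
    using assms cinner_self_pos[OF v] v by (simp add: pos_semidef_def add_nonneg_pos)
qed

lemma ext_value_tendsto:
  assumes "ext_defined n F A B" "\<not> (pos_def n A \<and> pos_def n B)" "filterlim \<epsilon> (at_right 0) sequentially"
  shows "mat_tendsto n (\<lambda>m. regularized n F A B (\<epsilon> m)) (ext_value n F A B)" "ext_value n F A B \<in> carrier_mat n n"
proof -
  show "mat_tendsto n (\<lambda>m. regularized n F A B (\<epsilon> m)) (ext_value n F A B)"
    unfolding mat_tendsto_def
  proof (intro allI impI)
    fix i j assume ij: "i < n" "j < n"
    then obtain l where l: "((\<lambda>\<epsilon>. regularized n F A B \<epsilon> $$ (i, j)) \<longlongrightarrow> l) (at_right 0)"
      using assms(1,2) unfolding ext_defined_def by blast
    have "Lim (at_right 0) (\<lambda>\<epsilon>. regularized n F A B \<epsilon> $$ (i, j)) = l"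
      by (rule tendsto_Lim[OF _ l]) simp
    then have "ext_value n F A B $$ (i, j) = l"
      unfolding ext_value_def if_not_P[OF assms(2)] using ij by simp
    then show "(\<lambda>m. regularized n F A B (\<epsilon> m) $$ (i, j)) \<longlonglongrightarrow> ext_value n F A B $$ (i, j)"
      using filterlim_compose[OF l assms(3)] by simp
  qed
  show "ext_value n F A B \<in> carrier_mat n n"
    unfolding ext_value_def if_not_P[OF assms(2)] by simp
qed

theorem theorem2p1:
  fixes n :: nat and A B :: "complex mat" and p r s t :: real
  assumes "pos_semidef n A" and "pos_semidef n B"
    and "1 \<le> p" and "p \<le> 2"
    and "r * s > 0"
    and "(r * p - r) / ((r + s) * p) \<le> t" and "t \<le> (r * p + s) / ((r + s) * p)"
    and "sharp_defined n r t A B"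
    and "sharp_defined n s (1 - t) A B"
    and "powr_times_defined n (r + s - 1) A B"
  shows "eigs (mat_powr (sharp n r t A B) p * mat_powr (sharp n s (1 - t) A B) p)
           \<prec>\<^sub>l\<^sub>o\<^sub>g list_powr (eigs (powr_times n (r + s - 1) A B)) p"
proof (cases "pos_def n A \<and> pos_def n B")
  case True
  then show ?thesis
    unfolding ext_value_def if_P[OF True]
    using pos_def_log_majorization[OF _ _ assms(3-7), of n A B] log_majorized_eigs by blast
next
  case False
  define \<epsilon> where "\<epsilon> m = inverse (real (Suc m))" for m
  have pos: "\<epsilon> m > 0" for m by (simp add: \<epsilon>_def)
  have lim: "filterlim \<epsilon> (at_right 0) sequentially"
    unfolding filterlim_at using LIMSEQ_inverse_real_of_nat pos
    by (auto simp: \<epsilon>_def[abs_def])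
  define A' where "A' m = A + complex_of_real (\<epsilon> m) \<cdot>\<^sub>m 1\<^sub>m n" for m
  define B' where "B' m = B + complex_of_real (\<epsilon> m) \<cdot>\<^sub>m 1\<^sub>m n" for m
  have A': "pos_def n (A' m)" and B': "pos_def n (B' m)" for m
    unfolding A'_def B'_def using pos assms(1,2) by (auto intro: pos_semidef_regularized)
  have reg: "regularized n F A B (\<epsilon> m) = F (A' m) (B' m)" for F m
    by (simp add: regularized_def A'_def B'_def)
  note ext = ext_value_tendsto[OF _ False lim, unfolded reg]
  show ?thesis
  proof (rule log_majorization_limit[OF ext[OF assms(8)] _ ext[OF assms(9)] _ ext[OF assms(10)]])
    show "pos_def n (sharp_formula r t (A' m) (B' m))" "pos_def n (sharp_formula s (1 - t) (A' m) (B' m))" for m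
      using A' B' by (simp_all add: sharp_formula_pos_def)
    show "powr_times_formula (r + s - 1) (A' m) (B' m) \<in> carrier_mat n n" for m
      using mat_powr_carrier[OF A'] pos_def_carrier[OF B'] by (simp add: powr_times_formula_def)
    show "p > 0" using assms(3) by simp
    show "\<exists>e z. spectral_majorization n p
        (mat_powr (sharp_formula r t (A' m) (B' m)) p * mat_powr (sharp_formula s (1 - t) (A' m) (B' m)) p)
        (powr_times_formula (r + s - 1) (A' m) (B' m)) e z" for m
      by (rule pos_def_log_majorization[OF A' B' assms(3-7)])
  qed
qed

end
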